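(* Let $\Lambda_{a,b,c}\subset\mathbb R^3$ be a Sierpinski sponge with parameters $0<a\le b\le c<1$ and alphabet $\mathcal I$, such that $\underline t<\overline t$, where $$\underline t=\min_{(i,j)\in\mathcal J}\frac{\log m_{ij}}{-\log a},\qquad \overline t=\max_{(i,j)\in\mathcal J}\frac{\log m_{ij}}{-\log a}.$$ There exists a constant $C$ (depending only on $a,b,c$ and $\mathcal I$) such that for every sufficiently small $\varepsilon>0$ and every $(a,b,c;\varepsilon)$-sponge $\Lambda_{a,b,c;\varepsilon}$ with the same alphabet $\mathcal I$, $$\mathrm{VP}(\Lambda_{a,b,c;\varepsilon})\ \le\ \dim_{\mathrm H}\Lambda_{a,b,c;\varepsilon}\ \le\ \mathrm{VP}(\Lambda_{a,b,c;\varepsilon})+C\varepsilon.$$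
   Context: $\dim_{\mathrm H}$ denotes Hausdorff dimension. **Self-affine sponges in $\mathbb R^3$.** Let $\mathcal I=\{(i,j,k):1\le i\le m,\ 1\le j\le m_i,\ 1\le k\le m_{ij}\}$ be a finite index set, called the alphabet ($m,m_i,m_{ij}$ positive integers), and $\mathcal J=\{(i,j):(i,j,k)\in\mathcal I\text{ for some }k\}$. Let $c_i,b_{ij},a_{ijk}\in(0,1)$ satisfy $a_{ijk}\le b_{ij}\le c_i$, $\sum_{i=1}^mc_i\le1$, $\sum_{j=1}^{m_i}b_{ij}\le1$ for each $i$, and $\sum_{k=1}^{m_{ij}}a_{ijk}\le1$ for each $(i,j)\in\mathcal J$. Let $u_i,u_{ij},u_{ijk}\in[0,1)$ be strictly increasing in their last index and satisfy $u_{i+1}-u_i\ge c_i$, $u_{i(j+1)}-u_{ij}\ge b_{ij}$, $u_{ij(k+1)}-u_{ijk}\ge a_{ijk}$, where if the last index has its maximal value ($i=m$, $j=m_i$, $k=m_{ij}$, respectively) the first term of the difference is replaced by $1$. Define $A_{ijk}(x,y,z)=(a_{ijk}x+u_{ijk},\,b_{ij}y+u_{ij},\,c_iz+u_i)$ for $(i,j,k)\in\mathcal I$. The unique nonempty compact set $\Lambda\subset\mathbb R^3$ with $\Lambda=\bigcup_{(i,j,k)\in\mathcal I}A_{ijk}(\Lambda)$ is called a self-affine sponge (with alphabet $\mathcal I$). **$(a,b,c;\varepsilon)$-sponges.** For numbers $0<a\le b\le c<1$ and $\varepsilon\ge0$, a self-affine sponge is an $(a,b,c;\varepsilon)$-sponge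 if $$e^{-\varepsilon}\le\frac{a_{ijk}}a\le e^\varepsilon,\quad e^{-\varepsilon}\le\frac{b_{ij}}b\le e^\varepsilon,\quad e^{-\varepsilon}\le\frac{c_i}c\le e^\varepsilon\qquad\text{for every }(i,j,k)\in\mathcal I.$$ A Sierpinski sponge $\Lambda_{a,b,c}$ is an $(a,b,c;0)$-sponge, i.e. $a_{ijk}=a$, $b_{ij}=b$, $c_i=c$ for all indices. **The quantity $\mathrm{VP}$.** For a self-affine sponge $\Lambda$ and a collection $\mathbf p=(p_{ij})_{(i,j)\in\mathcal J}$ of non-negative numbers with $\sum_{i,j}p_{ij}=1$, put $p_i=\sum_jp_{ij}$ and (with $0\log0=0$) $$\lambda_1(\mathbf p)=\frac{\sum_ip_i\log p_i}{\sum_ip_i\log c_i},\qquad \lambda_2(\mathbf p)=\frac{\sum_{i,j}p_{ij}\log p_{ij}-\sum_ip_i\log p_i}{\sum_{i,j}p_{ij}\log b_{ij}},$$ and let $t(\mathbf p)$ be the unique real in $[0,1]$ with $\sum_{i,j}p_{ij}\log\big(\sum_ka_{ijk}^{t(\mathbf p)}\big)=0$. Then $\mathrm{VP}(\Lambda)=\sup_{\mathbf p}\{\lambda_1(\mathbf p)+\lambda_2(\mathbf p)+t(\mathbf p)\}$, the supremum being over all such $\mathbf p$. *)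

theory Defs
  imports "HOL-Analysis.Analysis"
begin

subsection \<open>Hausdorff dimension\<close>

text \<open>The size of a covering set, with the conventions that the empty set has size 0 and that a
  nonempty set of diameter 0 has 0-dimensional size 1 (whereas \<open>0 powr 0 = 0\<close>).\<close>

definition hausdorff_gauge :: "real \<Rightarrow> 'a::metric_space set \<Rightarrow> ennreal" where
  "hausdorff_gauge s U =
     (if U = {} then 0 else if s = 0 then 1 else ennreal (diameter U powr s))"

text \<open>Boundedness is required because \<open>diameter\<close> is real-valued and meaningless on unbounded
  sets. Finite covers are included, as covering sets may be empty.\<close>

definition hausdorff_premeasure :: "real \<Rightarrow> real \<Rightarrow> 'a::metric_space set \<Rightarrow> ennreal" where
  "hausdorff_premeasure s \<delta> E =
     (INF U \<in> {U :: nat \<Rightarrow> 'a set. E \<subseteq> (\<Union>n. U n) \<and>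
                 (\<forall>n. bounded (U n) \<and> diameter (U n) \<le> \<delta>)}.
        \<Sum>n. hausdorff_gauge s (U n))"

definition hausdorff_measure :: "real \<Rightarrow> 'a::metric_space set \<Rightarrow> ennreal" where
  "hausdorff_measure s E = (SUP \<delta> \<in> {0<..}. hausdorff_premeasure s \<delta> E)"

definition hausdorff_dim :: "'a::metric_space set \<Rightarrow> ereal" where
  "hausdorff_dim E = (INF s \<in> {s. 0 \<le> s \<and> hausdorff_measure s E = 0}. ereal s)"


subsection \<open>Self-affine sponges\<close>

text \<open>An alphabet is given by the numbers $m$, $m_i$, $m_{ij}$. Values of these functions, and of
  the functions in \<open>sponge_data\<close> below, at indices outside the alphabet are irrelevant.\<close>

record alphabet =
  num_i :: nat
  num_j :: "nat \<Rightarrow> nat"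
  num_k :: "nat \<Rightarrow> nat \<Rightarrow> nat"

definition valid_alphabet :: "alphabet \<Rightarrow> bool" where
  "valid_alphabet \<A> \<longleftrightarrow>
     num_i \<A> > 0 \<and>
     (\<forall>i\<in>{1..num_i \<A>}. num_j \<A> i > 0 \<and> (\<forall>j\<in>{1..num_j \<A> i}. num_k \<A> i j > 0))"

definition idx3 :: "alphabet \<Rightarrow> (nat \<times> nat \<times> nat) set" where
  "idx3 \<A> = {(i, j, k). i \<in> {1..num_i \<A>} \<and> j \<in> {1..num_j \<A> i} \<and> k \<in> {1..num_k \<A> i j}}"

definition idx2 :: "alphabet \<Rightarrow> (nat \<times> nat) set" where
  "idx2 \<A> = {(i, j). \<exists>k. (i, j, k) \<in> idx3 \<A>}"

text \<open>The contraction ratios $a_{ijk}$, $b_{ij}$, $c_i$ and the translations $u_{ijk}$, $u_{ij}$,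
  $u_i$, in the directions of the first, second and third coordinate.\<close>

record sponge_data =
  ratio_x :: "nat \<Rightarrow> nat \<Rightarrow> nat \<Rightarrow> real"
  ratio_y :: "nat \<Rightarrow> nat \<Rightarrow> real"
  ratio_z :: "nat \<Rightarrow> real"
  shift_x :: "nat \<Rightarrow> nat \<Rightarrow> nat \<Rightarrow> real"
  shift_y :: "nat \<Rightarrow> nat \<Rightarrow> real"
  shift_z :: "nat \<Rightarrow> real"

text \<open>Intervals $[u_i, u_i + r_i]$, $1 \le i \le n$, placed in increasing order in $[0,1]$ without
  overlapping interiors.\<close>

definition ordered_placement :: "nat \<Rightarrow> (nat \<Rightarrow> real) \<Rightarrow> (nat \<Rightarrow> real) \<Rightarrow> bool" where
  "ordered_placement n r u \<longleftrightarrow>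
     (\<Sum>i=1..n. r i) \<le> 1 \<and>
     (\<forall>i\<in>{1..n}. 0 < r i \<and> r i < 1 \<and> 0 \<le> u i \<and> u i < 1) \<and>
     strict_mono_on {1..n} u \<and>
     (\<forall>i\<in>{1..n}. (if i = n then 1 else u (i + 1)) - u i \<ge> r i)"

definition self_affine_sponge :: "alphabet \<Rightarrow> sponge_data \<Rightarrow> bool" where
  "self_affine_sponge \<A> S \<longleftrightarrow>
     valid_alphabet \<A> \<and>
     (\<forall>(i, j, k)\<in>idx3 \<A>. ratio_x S i j k \<le> ratio_y S i j \<and> ratio_y S i j \<le> ratio_z S i) \<and>
     ordered_placement (num_i \<A>) (ratio_z S) (shift_z S) \<and>
     (\<forall>i\<in>{1..num_i \<A>}. ordered_placement (num_j \<A> i) (ratio_y S i) (shift_y S i)) \<and>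
     (\<forall>(i, j)\<in>idx2 \<A>. ordered_placement (num_k \<A> i j) (ratio_x S i j) (shift_x S i j))"

definition sponge_map :: "sponge_data \<Rightarrow> nat \<times> nat \<times> nat \<Rightarrow> real^3 \<Rightarrow> real^3" where
  "sponge_map S = (\<lambda>(i, j, k) v.
     vector [ratio_x S i j k * v $ 1 + shift_x S i j k,
             ratio_y S i j * v $ 2 + shift_y S i j,
             ratio_z S i * v $ 3 + shift_z S i])"

definition sponge_set :: "alphabet \<Rightarrow> sponge_data \<Rightarrow> (real^3) set" where
  "sponge_set \<A> S =
     (THE \<Lambda>. \<Lambda> \<noteq> {} \<and> compact \<Lambda> \<and> \<Lambda> = (\<Union>w\<in>idx3 \<A>. sponge_map S w ` \<Lambda>))"

definition abc_sponge ::
  "real \<Rightarrow> real \<Rightarrow> real \<Rightarrow> real \<Rightarrow> alphabet \<Rightarrow> sponge_data \<Rightarrow> bool" where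
  "abc_sponge a b c \<epsilon> \<A> S \<longleftrightarrow>
     0 < a \<and> a \<le> b \<and> b \<le> c \<and> c < 1 \<and> 0 \<le> \<epsilon> \<and>
     self_affine_sponge \<A> S \<and>
     (\<forall>(i, j, k)\<in>idx3 \<A>.
        exp (-\<epsilon>) \<le> ratio_x S i j k / a \<and> ratio_x S i j k / a \<le> exp \<epsilon> \<and>
        exp (-\<epsilon>) \<le> ratio_y S i j / b \<and> ratio_y S i j / b \<le> exp \<epsilon> \<and>
        exp (-\<epsilon>) \<le> ratio_z S i / c \<and> ratio_z S i / c \<le> exp \<epsilon>)"

definition sierpinski_sponge ::
  "real \<Rightarrow> real \<Rightarrow> real \<Rightarrow> alphabet \<Rightarrow> sponge_data \<Rightarrow> bool" where
  "sierpinski_sponge a b c \<A> S \<longleftrightarrow> abc_sponge a b c 0 \<A> S"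


subsection \<open>The quantity VP\<close>

text \<open>The convention $0 \log 0 = 0$ is automatic, as \<open>0 * ln 0 = 0\<close>.\<close>

definition prob_vectors :: "alphabet \<Rightarrow> (nat \<Rightarrow> nat \<Rightarrow> real) set" where
  "prob_vectors \<A> = {p. (\<forall>(i, j)\<in>idx2 \<A>. 0 \<le> p i j) \<and> (\<Sum>(i, j)\<in>idx2 \<A>. p i j) = 1}"

definition marginal :: "alphabet \<Rightarrow> (nat \<Rightarrow> nat \<Rightarrow> real) \<Rightarrow> nat \<Rightarrow> real" where
  "marginal \<A> p i = (\<Sum>j=1..num_j \<A> i. p i j)"

definition lambda1 :: "alphabet \<Rightarrow> sponge_data \<Rightarrow> (nat \<Rightarrow> nat \<Rightarrow> real) \<Rightarrow> real" where
  "lambda1 \<A> S p =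
     (\<Sum>i=1..num_i \<A>. marginal \<A> p i * ln (marginal \<A> p i)) /
     (\<Sum>i=1..num_i \<A>. marginal \<A> p i * ln (ratio_z S i))"

definition lambda2 :: "alphabet \<Rightarrow> sponge_data \<Rightarrow> (nat \<Rightarrow> nat \<Rightarrow> real) \<Rightarrow> real" where
  "lambda2 \<A> S p =
     ((\<Sum>(i, j)\<in>idx2 \<A>. p i j * ln (p i j)) -
      (\<Sum>i=1..num_i \<A>. marginal \<A> p i * ln (marginal \<A> p i))) /
     (\<Sum>(i, j)\<in>idx2 \<A>. p i j * ln (ratio_y S i j))"

definition t_exponent :: "alphabet \<Rightarrow> sponge_data \<Rightarrow> (nat \<Rightarrow> nat \<Rightarrow> real) \<Rightarrow> real" where
  "t_exponent \<A> S p =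
     (THE t. t \<in> {0..1} \<and>
        (\<Sum>(i, j)\<in>idx2 \<A>. p i j * ln (\<Sum>k=1..num_k \<A> i j. ratio_x S i j k powr t)) = 0)"

definition VP :: "alphabet \<Rightarrow> sponge_data \<Rightarrow> real" where
  "VP \<A> S = (SUP p\<in>prob_vectors \<A>. lambda1 \<A> S p + lambda2 \<A> S p + t_exponent \<A> S p)"

definition t_lower :: "real \<Rightarrow> alphabet \<Rightarrow> real" where
  "t_lower a \<A> = Min ((\<lambda>(i, j). ln (real (num_k \<A> i j)) / - ln a) ` idx2 \<A>)"

definition t_upper :: "real \<Rightarrow> alphabet \<Rightarrow> real" where
  "t_upper a \<A> = Max ((\<lambda>(i, j). ln (real (num_k \<A> i j)) / - ln a) ` idx2 \<A>)"

end

theory Submission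
  imports Defs "HOL-Probability.Probability" "HOL-Combinatorics.Multiset_Permutations" "HOL-Real_Asymp.Real_Asymp"
begin

text \<open>
  \<^bold>\<open>The idea.\<close> Both inequalities compare the sponge with its code space, the set of infinite words over
  the alphabet. At scale \<open>\<delta>\<close> the sponge is governed by approximate cubes: fix the letter
  \<open>(i, j, k)\<close> as long as the product of the ratios \<open>a\<^sub>i\<^sub>j\<^sub>k\<close> exceeds \<open>\<delta>\<close>, then only \<open>(i, j)\<close> as long as
  the product of the \<open>b\<^sub>i\<^sub>j\<close> exceeds \<open>\<delta>\<close>, then only \<open>i\<close> as long as the product of the \<open>c\<^sub>i\<close> does.
  Their sides are comparable to \<open>\<delta>\<close>, and since the maps place intervals without overlap, a set of
  diameter \<open>\<delta>\<close> meets boundedly many of them.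

  \<^bold>\<open>Lower bound.\<close> It holds for every sponge and every probability vector \<open>p\<close>. Distribute
  \<open>p\<^sub>i\<^sub>j\<close> over \<open>k\<close> proportionally to \<open>a\<^sub>i\<^sub>j\<^sub>k\<close> to the power \<open>t(p)\<close>; the definition of \<open>t(p)\<close> says that the
  conditional entropy of \<open>k\<close> divided by the Lyapunov exponent in direction \<open>x\<close> is then exactly
  \<open>t(p)\<close>. Instead of a Bernoulli measure, whose cubes have random masses, consider all
  words of a length about \<open>N\<close> in which each letter occurs with exactly the prescribed
  frequency, up to rounding. All these words have the same three contraction ratios, and by
  symmetry under permutations the number of them lying over a given word in \<open>i\<close>, or over a given
  word in \<open>(i, j)\<close>, is constant. So in the uniform product measure on sequences of such words all
  approximate cubes of one size have equal, explicit masses (\<open>homogeneous_blocks_dim_ge\<close>), and the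
  mass distribution principle applies. The word counts are multinomial coefficients, which grow like
  the exponential of \<open>N\<close> times an entropy, so for \<open>N \<rightarrow> \<infinity>\<close> the exponents tend to
  \<open>\<lambda>\<^sub>1(p) + \<lambda>\<^sub>2(p) + t(p)\<close> (\<open>VP_value_le_dim\<close>).

  \<^bold>\<open>Upper bound.\<close> For the unperturbed parameters the supremum of this sum is attained at an explicit vector
  and equals \<open>log Z / (- log c)\<close>, where \<open>Z\<close> is the partition sum obtained by maximising
  successively over the conditional distributions. The associated Bernoulli weights of the cells of
  level \<open>n\<close> are \<open>Z\<close> to the power \<open>-n\<close>, up to a factor whose logarithm is a combination of differences
  \<open>\<alpha> S\<^sub>n - S\<^bsub>\<alpha>n\<^esub>\<close> of Birkhoff sums along the code. Such differences cancel in logarithmic average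
  (\<open>dilated_sums_log_average\<close>), so along every code there are infinitely many levels with weight at least
  \<open>(Z e\<^sup>\<eta>)\<close> to the power \<open>-n\<close>. As weights add up to one, few cells are that heavy, and they form an
  efficient cover. The argument only sees the code space: an \<open>\<epsilon>\<close>-perturbation enlarges
  the bound for the diameters of cells of level \<open>n\<close> by a factor \<open>e\<^bsup>\<epsilon>n\<^esup>\<close>, whence the dimension is at most
  \<open>log Z / (- log c - \<epsilon>)\<close> (\<open>hausdorff_dim_le\<close>). Finally the explicit vector, inserted in the variational
  quantity of the perturbed sponge, loses only \<open>O(\<epsilon>)\<close> against \<open>log Z / (- log c)\<close> (\<open>opt_value_ge\<close>).
\<close>

section \<open>Coding points of the line\<close>

text \<open>A word \<open>\<sigma>\<close> codes a point of the line: its first \<open>n\<close> letters select the interval with left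
  endpoint \<open>code_left r u \<sigma> n\<close> and length \<open>code_ratio r \<sigma> n\<close>, the image of \<open>[0, 1]\<close> under the composition of
  the maps \<open>x \<mapsto> r w * x + u w\<close>. Everything is stated for an arbitrary set of letters, so that the three
  coordinates of a sponge share one code.\<close>
definition code_ratio :: "('w \<Rightarrow> real) \<Rightarrow> (nat \<Rightarrow> 'w) \<Rightarrow> nat \<Rightarrow> real" where
  "code_ratio r \<sigma> n = (\<Prod>l<n. r (\<sigma> l))"

definition code_left :: "('w \<Rightarrow> real) \<Rightarrow> ('w \<Rightarrow> real) \<Rightarrow> (nat \<Rightarrow> 'w) \<Rightarrow> nat \<Rightarrow> real" where
  "code_left r u \<sigma> n = (\<Sum>k<n. code_ratio r \<sigma> k * u (\<sigma> k))"

definition code_val :: "('w \<Rightarrow> real) \<Rightarrow> ('w \<Rightarrow> real) \<Rightarrow> (nat \<Rightarrow> 'w) \<Rightarrow> real" where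
  "code_val r u \<sigma> = (\<Sum>k. code_ratio r \<sigma> k * u (\<sigma> k))"

lemma code_ratio_0 [simp]: "code_ratio r \<sigma> 0 = 1"
  and code_ratio_Suc: "code_ratio r \<sigma> (Suc n) = code_ratio r \<sigma> n * r (\<sigma> n)"
  and code_left_0 [simp]: "code_left r u \<sigma> 0 = 0"
  and code_left_Suc: "code_left r u \<sigma> (Suc n) = code_left r u \<sigma> n + code_ratio r \<sigma> n * u (\<sigma> n)"
  by (simp_all add: code_ratio_def code_left_def)

lemma code_ratio_cong: "(\<And>l. l < n \<Longrightarrow> r (\<sigma> l) = r (\<tau> l)) \<Longrightarrow> code_ratio r \<sigma> n = code_ratio r \<tau> n"
  by (simp add: code_ratio_def)

lemma code_left_cong:
  assumes "\<And>l. l < n \<Longrightarrow> r (\<sigma> l) = r (\<tau> l) \<and> u (\<sigma> l) = u (\<tau> l)"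
  shows "code_left r u \<sigma> n = code_left r u \<tau> n"
  unfolding code_left_def
proof (rule sum.cong[OF refl])
  fix k assume "k \<in> {..<n}"
  then show "code_ratio r \<sigma> k * u (\<sigma> k) = code_ratio r \<tau> k * u (\<tau> k)"
    using assms code_ratio_cong[of k r \<sigma> \<tau>] by simp
qed

locale line_code =
  fixes W :: "'w set" and r u :: "'w \<Rightarrow> real"
  assumes finite_W: "finite W"
    and ratio_pos: "w \<in> W \<Longrightarrow> 0 < r w"
    and ratio_less_1: "w \<in> W \<Longrightarrow> r w < 1"
    and shift_nonneg: "w \<in> W \<Longrightarrow> 0 \<le> u w"
    and shift_ratio_le_1: "w \<in> W \<Longrightarrow> u w + r w \<le> 1"
begin

definition max_ratio :: real where "max_ratio = Max (insert (1/2) (r ` W))"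

lemma max_ratio: "0 < max_ratio" "max_ratio < 1" "w \<in> W \<Longrightarrow> r w \<le> max_ratio"
proof -
  \<comment> \<open>The entry 1/2 only makes the maximum positive and well defined for empty \<open>W\<close>.\<close>
  have fin: "finite (insert (1/2) (r ` W))" using finite_W by simp
  show "0 < max_ratio" unfolding max_ratio_def using fin
    by (intro less_le_trans[OF _ Max_ge[of _ "1/2"]]) auto
  show "max_ratio < 1" unfolding max_ratio_def using fin ratio_less_1 by (subst Max_less_iff) auto
  show "w \<in> W \<Longrightarrow> r w \<le> max_ratio" unfolding max_ratio_def using fin by (intro Max_ge) auto
qed

context
  fixes \<sigma> :: "nat \<Rightarrow> 'w" assumes \<sigma>: "range \<sigma> \<subseteq> W"
begin

lemma code_in [simp]: "\<sigma> n \<in> W"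
  using \<sigma> by auto

lemma code_ratio_pos: "0 < code_ratio r \<sigma> n"
  unfolding code_ratio_def using \<sigma> by (intro prod_pos) (auto intro: ratio_pos)

lemma code_ratio_le_power: "code_ratio r \<sigma> n \<le> max_ratio ^ n"
proof -
  have "code_ratio r \<sigma> n \<le> (\<Prod>l<n. max_ratio)"
    unfolding code_ratio_def using \<sigma> by (intro prod_mono) (auto intro: max_ratio less_imp_le[OF ratio_pos])
  then show ?thesis by simp
qed

lemma code_ratio_tendsto_0: "(\<lambda>n. code_ratio r \<sigma> n) \<longlonglongrightarrow> 0"
proof (rule tendsto_sandwich[where f="\<lambda>_. 0" and h="\<lambda>n. max_ratio ^ n"])
  show "(\<lambda>n. max_ratio ^ n) \<longlonglongrightarrow> 0" using max_ratio by (intro LIMSEQ_realpow_zero) auto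
  show "\<forall>\<^sub>F n in sequentially. 0 \<le> code_ratio r \<sigma> n"
    using code_ratio_pos less_imp_le by (intro always_eventually) blast
  show "\<forall>\<^sub>F n in sequentially. code_ratio r \<sigma> n \<le> max_ratio ^ n"
    using code_ratio_le_power by (intro always_eventually) blast
qed simp

lemma code_left_mono: "n \<le> m \<Longrightarrow> code_left r u \<sigma> n \<le> code_left r u \<sigma> m"
proof (rule lift_Suc_mono_le[of "code_left r u \<sigma>"])
  fix n show "code_left r u \<sigma> n \<le> code_left r u \<sigma> (Suc n)"
    using code_ratio_pos[of n] shift_nonneg[OF code_in, of n] by (auto simp: code_left_Suc)
qed

text \<open>The intervals selected by longer and longer prefixes are nested; together with \<open>code_left_mono\<close> this
  bounds all later left endpoints, and hence the coded point.\<close>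
lemma code_right_antimono:
  "n \<le> m \<Longrightarrow> code_left r u \<sigma> m + code_ratio r \<sigma> m \<le> code_left r u \<sigma> n + code_ratio r \<sigma> n"
proof (rule lift_Suc_antimono_le[of "\<lambda>n. code_left r u \<sigma> n + code_ratio r \<sigma> n"])
  fix n
  have "code_ratio r \<sigma> n * (u (\<sigma> n) + r (\<sigma> n)) \<le> code_ratio r \<sigma> n * 1"
    using code_ratio_pos[of n] shift_ratio_le_1[OF code_in, of n] by (intro mult_left_mono) auto
  then show "code_left r u \<sigma> (Suc n) + code_ratio r \<sigma> (Suc n) \<le> code_left r u \<sigma> n + code_ratio r \<sigma> n"
    by (simp add: code_left_Suc code_ratio_Suc algebra_simps)
qed

lemma code_left_le: "n \<le> m \<Longrightarrow> code_left r u \<sigma> m \<le> code_left r u \<sigma> n + code_ratio r \<sigma> n"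
  using code_right_antimono[of n m] code_ratio_pos[of m] by linarith

lemma summable_code: "summable (\<lambda>k. code_ratio r \<sigma> k * u (\<sigma> k))"
proof (rule bounded_imp_summable[of _ 1])
  show "0 \<le> code_ratio r \<sigma> k * u (\<sigma> k)" for k
    using code_ratio_pos[of k] shift_nonneg[OF code_in, of k] by auto
  show "(\<Sum>k\<le>n. code_ratio r \<sigma> k * u (\<sigma> k)) \<le> 1" for n
    using code_left_le[of 0 "Suc n"] by (simp add: code_left_def lessThan_Suc_atMost)
qed

lemma code_left_tendsto: "code_left r u \<sigma> \<longlonglongrightarrow> code_val r u \<sigma>"
  using summable_LIMSEQ[OF summable_code] unfolding code_left_def code_val_def .

lemma code_val_ge: "code_left r u \<sigma> n \<le> code_val r u \<sigma>"
  using code_left_tendsto by (rule LIMSEQ_le_const) (use code_left_mono in auto)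

lemma code_val_le: "code_val r u \<sigma> \<le> code_left r u \<sigma> n + code_ratio r \<sigma> n"
  using code_left_tendsto by (rule LIMSEQ_le_const2) (use code_left_le in auto)

end

lemma code_val_shift:
  assumes \<sigma>: "range \<sigma> \<subseteq> W"
  shows "code_val r u \<sigma> = r (\<sigma> 0) * code_val r u (\<lambda>n. \<sigma> (Suc n)) + u (\<sigma> 0)"
proof -
  have "code_ratio r \<sigma> (Suc k) = r (\<sigma> 0) * code_ratio r (\<lambda>n. \<sigma> (Suc n)) k" for k
    unfolding code_ratio_def by (subst prod.lessThan_Suc_shift) simp
  then have "code_ratio r \<sigma> (Suc k) * u (\<sigma> (Suc k)) =
      r (\<sigma> 0) * (code_ratio r (\<lambda>n. \<sigma> (Suc n)) k * u (\<sigma> (Suc k)))" for k by simp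
  moreover have "code_val r u \<sigma> = (\<Sum>k. code_ratio r \<sigma> (Suc k) * u (\<sigma> (Suc k))) + u (\<sigma> 0)"
    unfolding code_val_def using suminf_split_head[OF summable_code[OF \<sigma>]] by simp
  moreover have "range (\<lambda>n. \<sigma> (Suc n)) \<subseteq> W" using \<sigma> by auto
  note summable_code[OF this]
  ultimately show ?thesis by (simp only: code_val_def suminf_mult)
qed

text \<open>The words may differ before position \<open>l\<close>, as long as they select the same intervals there: in
  the second coordinate of a sponge only the letters \<open>(i, j)\<close> are seen, in the third only \<open>i\<close>.\<close>
lemma code_intervals_separated:
  assumes \<sigma>: "range \<sigma> \<subseteq> W" and \<tau>: "range \<tau> \<subseteq> W"
    and eq: "\<And>k. k < l \<Longrightarrow> r (\<sigma> k) = r (\<tau> k) \<and> u (\<sigma> k) = u (\<tau> k)" and l: "l < n"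
    and sep: "u (\<sigma> l) + r (\<sigma> l) \<le> u (\<tau> l)"
  shows "code_left r u \<sigma> n + code_ratio r \<sigma> n \<le> code_left r u \<tau> n"
proof -
  have "code_left r u \<sigma> n + code_ratio r \<sigma> n \<le> code_left r u \<sigma> (Suc l) + code_ratio r \<sigma> (Suc l)"
    using l by (intro code_right_antimono[OF \<sigma>]) auto
  also have "\<dots> = code_left r u \<sigma> l + code_ratio r \<sigma> l * (u (\<sigma> l) + r (\<sigma> l))"
    by (simp add: code_left_Suc code_ratio_Suc algebra_simps)
  also have "\<dots> \<le> code_left r u \<sigma> l + code_ratio r \<sigma> l * u (\<tau> l)"
    using code_ratio_pos[OF \<sigma>, of l] sep by auto
  also have "\<dots> = code_left r u \<tau> (Suc l)"
    using code_left_cong[of l r \<sigma> \<tau> u] code_ratio_cong[of l r \<sigma> \<tau>] eq by (simp add: code_left_Suc)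
  also have "\<dots> \<le> code_left r u \<tau> n" using l by (intro code_left_mono[OF \<tau>]) auto
  finally show ?thesis .
qed

lemma code_val_uniform_limit:
  "uniform_limit {\<sigma>. range \<sigma> \<subseteq> W} (\<lambda>n \<sigma>. code_left r u \<sigma> n) (code_val r u) sequentially"
proof (rule uniform_limitI)
  fix e :: real assume "e > 0"
  have "(\<lambda>n. max_ratio ^ n) \<longlonglongrightarrow> 0" using max_ratio by (intro LIMSEQ_realpow_zero) auto
  then have "\<forall>\<^sub>F n in sequentially. max_ratio ^ n < e"
    using \<open>e > 0\<close> by (rule order_tendstoD(2))
  then show "\<forall>\<^sub>F n in sequentially. \<forall>\<sigma>\<in>{\<sigma>. range \<sigma> \<subseteq> W}. dist (code_left r u \<sigma> n) (code_val r u \<sigma>) < e"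
  proof eventually_elim
    case (elim n)
    show ?case
    proof safe
      fix \<sigma> :: "nat \<Rightarrow> 'w" assume \<sigma>: "range \<sigma> \<subseteq> W"
      show "dist (code_left r u \<sigma> n) (code_val r u \<sigma>) < e"
        using code_val_ge[OF \<sigma>, of n] code_val_le[OF \<sigma>, of n] code_ratio_le_power[OF \<sigma>, of n] elim
        by (auto simp: dist_real_def)
    qed
  qed
qed

end

lemma continuous_on_code_left:
  fixes W :: "'w::t1_space set"
  assumes "finite W"
  shows "continuous_on {\<sigma>. range \<sigma> \<subseteq> W} (\<lambda>\<sigma>. code_left r u \<sigma> n)"
proof -
  have *: "continuous_on {\<sigma>. range \<sigma> \<subseteq> W} (\<lambda>\<sigma>. f (\<sigma> l))" for l :: nat and f :: "'w \<Rightarrow> real"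
  proof (rule continuous_on_compose2[of W f])
    show "continuous_on W f" using assms by (rule continuous_on_finite)
    show "continuous_on {\<sigma>. range \<sigma> \<subseteq> W} (\<lambda>\<sigma>. \<sigma> l)"
      by (rule continuous_on_subset[OF continuous_on_product_coordinates]) simp
  qed auto
  show ?thesis unfolding code_left_def code_ratio_def by (intro continuous_intros *)
qed

lemma compact_code_space:
  fixes W :: "'w::t1_space set"
  assumes "finite W"
  shows "compact {\<sigma> :: nat \<Rightarrow> 'w. range \<sigma> \<subseteq> W}"
proof -
  have "compactin (product_topology (\<lambda>_. euclidean) UNIV) (PiE UNIV (\<lambda>_::nat. W))"
    using assms by (subst compactin_PiE) (auto simp: finite_imp_compact)
  moreover have "PiE UNIV (\<lambda>_::nat. W) = {\<sigma>. range \<sigma> \<subseteq> W}" by (auto simp: PiE_def Pi_def)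
  ultimately show ?thesis by (simp add: euclidean_product_topology)
qed

text \<open>A bounded orbit under the inverse maps is determined by its letters, because the error after \<open>n\<close> steps
  is contracted by \<open>code_ratio r \<sigma> n\<close>. This identifies points of an invariant set with coded points.\<close>
lemma (in line_code) code_val_unique:
  assumes \<sigma>: "range \<sigma> \<subseteq> W" and rec: "\<And>n. x n = r (\<sigma> n) * x (Suc n) + u (\<sigma> n)"
    and bounded: "\<And>n. \<bar>x n\<bar> \<le> B"
  shows "x 0 = code_val r u \<sigma>"
proof -
  have eq: "x 0 = code_left r u \<sigma> n + code_ratio r \<sigma> n * x n" for n
  proof (induction n)
    case (Suc n)
    then show ?case using rec[of n] by (simp add: code_left_Suc code_ratio_Suc algebra_simps)
  qed simp
  have "(\<lambda>n. code_ratio r \<sigma> n * x n) \<longlonglongrightarrow> 0"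
  proof (rule Lim_null_comparison)
    show "(\<lambda>n. code_ratio r \<sigma> n * B) \<longlonglongrightarrow> 0"
      using tendsto_mult_right[OF code_ratio_tendsto_0[OF \<sigma>], of B] by (simp add: mult.commute)
    show "\<forall>\<^sub>F n in sequentially. norm (code_ratio r \<sigma> n * x n) \<le> code_ratio r \<sigma> n * B"
      using code_ratio_pos[OF \<sigma>] bounded
      by (intro always_eventually allI) (simp add: abs_mult less_imp_le mult_left_mono)
  qed
  then have "(\<lambda>n. code_left r u \<sigma> n + code_ratio r \<sigma> n * x n) \<longlonglongrightarrow> code_val r u \<sigma> + 0"
    by (intro tendsto_add code_left_tendsto[OF \<sigma>])
  then have "(\<lambda>n::nat. x 0) \<longlonglongrightarrow> code_val r u \<sigma>" using eq by simp
  then show ?thesis by (simp add: LIMSEQ_const_iff)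
qed

lemma (in line_code) code_tendsto_val:
  assumes \<sigma>: "range \<sigma> \<subseteq> W"
  shows "(\<lambda>n. code_left r u \<sigma> n + code_ratio r \<sigma> n * x) \<longlonglongrightarrow> code_val r u \<sigma>"
  using tendsto_add[OF code_left_tendsto[OF \<sigma>] tendsto_mult_right[OF code_ratio_tendsto_0[OF \<sigma>], of x]]
  by (simp add: mult.commute)

lemma continuous_on_code_val:
  fixes W :: "'w::t1_space set"
  assumes "line_code W r u"
  shows "continuous_on {\<sigma>. range \<sigma> \<subseteq> W} (code_val r u)"
proof -
  interpret line_code W r u by fact
  show ?thesis
    by (rule uniform_limit_theorem[OF always_eventually code_val_uniform_limit])
      (auto intro: continuous_on_code_left finite_W)
qed

section \<open>Coding the points of a sponge\<close>

lemma ordered_placement_separated: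
  assumes "ordered_placement n r u" "i \<in> {1..n}" "i' \<in> {1..n}" "i < i'"
  shows "u i + r i \<le> u i'"
proof -
  have "r i \<le> (if i = n then 1 else u (i + 1)) - u i" using assms(1,2) unfolding ordered_placement_def by blast
  moreover have "i \<noteq> n" using assms by auto
  moreover have "u (i + 1) \<le> u i'"
    using assms by (cases "i + 1 = i'") (auto simp: ordered_placement_def strict_mono_on_def less_imp_le)
  ultimately show ?thesis by simp
qed

lemma ordered_placement_le_1:
  assumes "ordered_placement n r u" "i \<in> {1..n}"
  shows "u i + r i \<le> 1"
proof -
  have r: "r i \<le> (if i = n then 1 else u (i + 1)) - u i" using assms by (simp add: ordered_placement_def)
  have "u (i + 1) < 1" if "i \<noteq> n" using assms that by (simp add: ordered_placement_def)
  with r show ?thesis by (cases "i = n") auto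
qed

lemma idx3_Sigma: "idx3 \<A> = (SIGMA i:{1..num_i \<A>}. SIGMA j:{1..num_j \<A> i}. {1..num_k \<A> i j})"
  by (auto simp: idx3_def)

lemma finite_idx3 [simp]: "finite (idx3 \<A>)"
  by (simp add: idx3_Sigma)

lemma idx2_Sigma: "valid_alphabet \<A> \<Longrightarrow> idx2 \<A> = (SIGMA i:{1..num_i \<A>}. {1..num_j \<A> i})"
  by (force simp: idx2_def idx3_def valid_alphabet_def)

lemma idx3_nonempty: "valid_alphabet \<A> \<Longrightarrow> (1, 1, 1) \<in> idx3 \<A>"
  by (auto simp: idx3_def valid_alphabet_def Suc_le_eq)

text \<open>The ratios and shifts as functions of the whole letter, so that one word codes all coordinates.\<close>
definition rx :: "sponge_data \<Rightarrow> nat \<times> nat \<times> nat \<Rightarrow> real" where "rx S = (\<lambda>(i, j, k). ratio_x S i j k)"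
definition ry :: "sponge_data \<Rightarrow> nat \<times> nat \<times> nat \<Rightarrow> real" where "ry S = (\<lambda>(i, j, k). ratio_y S i j)"
definition rz :: "sponge_data \<Rightarrow> nat \<times> nat \<times> nat \<Rightarrow> real" where "rz S = (\<lambda>(i, j, k). ratio_z S i)"
definition ux :: "sponge_data \<Rightarrow> nat \<times> nat \<times> nat \<Rightarrow> real" where "ux S = (\<lambda>(i, j, k). shift_x S i j k)"
definition uy :: "sponge_data \<Rightarrow> nat \<times> nat \<times> nat \<Rightarrow> real" where "uy S = (\<lambda>(i, j, k). shift_y S i j)"
definition uz :: "sponge_data \<Rightarrow> nat \<times> nat \<times> nat \<Rightarrow> real" where "uz S = (\<lambda>(i, j, k). shift_z S i)"

lemma sponge_map_eq:
  "sponge_map S w v = vector [rx S w * v $ 1 + ux S w, ry S w * v $ 2 + uy S w, rz S w * v $ 3 + uz S w]"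
  by (simp add: sponge_map_def rx_def ry_def rz_def ux_def uy_def uz_def split: prod.split)

definition proj1 :: "nat \<times> nat \<times> nat \<Rightarrow> nat" where "proj1 = fst"
definition proj2 :: "nat \<times> nat \<times> nat \<Rightarrow> nat \<times> nat" where "proj2 = (\<lambda>(i, j, k). (i, j))"

definition code_space :: "alphabet \<Rightarrow> (nat \<Rightarrow> nat \<times> nat \<times> nat) set" where
  "code_space \<A> = {\<sigma>. range \<sigma> \<subseteq> idx3 \<A>}"

definition sponge_point :: "sponge_data \<Rightarrow> (nat \<Rightarrow> nat \<times> nat \<times> nat) \<Rightarrow> real^3" where
  "sponge_point S \<sigma> = vector [code_val (rx S) (ux S) \<sigma>, code_val (ry S) (uy S) \<sigma>, code_val (rz S) (uz S) \<sigma>]"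

locale index_set =
  fixes \<A> :: alphabet
  assumes valid: "valid_alphabet \<A>"
begin

lemma sum_idx2: "(\<Sum>(i, j)\<in>idx2 \<A>. f i j) = (\<Sum>i=1..num_i \<A>. \<Sum>j=1..num_j \<A> i. f i j)"
  unfolding idx2_Sigma[OF valid] by (subst sum.Sigma) auto

lemma finite_idx2 [simp]: "finite (idx2 \<A>)"
  unfolding idx2_Sigma[OF valid] by simp

lemma idx3_eq_Sigma_idx2: "idx3 \<A> = (\<lambda>((i, j), k). (i, j, k)) ` (SIGMA (i, j):idx2 \<A>. {1..num_k \<A> i j})"
  by (force simp: idx2_Sigma[OF valid] idx3_Sigma image_iff)

lemma sum_idx3: "(\<Sum>w\<in>idx3 \<A>. f w) = (\<Sum>(i, j)\<in>idx2 \<A>. \<Sum>k=1..num_k \<A> i j. f (i, j, k))"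
proof -
  have "(\<Sum>w\<in>idx3 \<A>. f w) = (\<Sum>((i, j), k)\<in>(SIGMA (i, j):idx2 \<A>. {1..num_k \<A> i j}). f (i, j, k))"
    unfolding idx3_eq_Sigma_idx2 by (subst sum.reindex) (auto simp: inj_on_def intro!: sum.cong)
  also have "\<dots> = (\<Sum>x\<in>idx2 \<A>. \<Sum>k\<in>(case x of (i, j) \<Rightarrow> {1..num_k \<A> i j}). case (x, k) of ((i, j), k) \<Rightarrow> f (i, j, k))"
    by (subst sum.Sigma) (auto intro!: sum.cong)
  also have "\<dots> = (\<Sum>(i, j)\<in>idx2 \<A>. \<Sum>k=1..num_k \<A> i j. f (i, j, k))"
    by (intro sum.cong) auto
  finally show ?thesis .
qed

lemma idx3_iff_idx2: "(i, j, k) \<in> idx3 \<A> \<longleftrightarrow> (i, j) \<in> idx2 \<A> \<and> k \<in> {1..num_k \<A> i j}"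
  by (auto simp: idx2_Sigma[OF valid] idx3_Sigma)

lemma num_k_pos: "(i, j) \<in> idx2 \<A> \<Longrightarrow> 0 < num_k \<A> i j"
  using valid by (auto simp: valid_alphabet_def idx2_Sigma[OF valid])

end

locale sponge =
  fixes \<A> :: alphabet and S :: sponge_data
  assumes sponge: "self_affine_sponge \<A> S"
begin

sublocale index_set \<A>
  using sponge by unfold_locales (simp add: self_affine_sponge_def)

lemma placement_z: "ordered_placement (num_i \<A>) (ratio_z S) (shift_z S)"
  and placement_y: "i \<in> {1..num_i \<A>} \<Longrightarrow> ordered_placement (num_j \<A> i) (ratio_y S i) (shift_y S i)"
  and placement_x: "(i, j) \<in> idx2 \<A> \<Longrightarrow> ordered_placement (num_k \<A> i j) (ratio_x S i j) (shift_x S i j)"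
  using sponge by (auto simp: self_affine_sponge_def)

lemma ratio_order: "w \<in> idx3 \<A> \<Longrightarrow> rx S w \<le> ry S w" "w \<in> idx3 \<A> \<Longrightarrow> ry S w \<le> rz S w"
  using sponge by (auto simp: self_affine_sponge_def rx_def ry_def rz_def)

lemma placement_at:
  assumes "(i, j, k) \<in> idx3 \<A>"
  shows "ordered_placement (num_j \<A> i) (ratio_y S i) (shift_y S i)"
    "ordered_placement (num_k \<A> i j) (ratio_x S i j) (shift_x S i j)"
    "i \<in> {1..num_i \<A>}" "j \<in> {1..num_j \<A> i}" "k \<in> {1..num_k \<A> i j}"
proof -
  have "(i, j) \<in> idx2 \<A>" using assms by (auto simp: idx2_def)
  then show "ordered_placement (num_k \<A> i j) (ratio_x S i j) (shift_x S i j)" by (rule placement_x)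
  show "ordered_placement (num_j \<A> i) (ratio_y S i) (shift_y S i)"
    "i \<in> {1..num_i \<A>}" "j \<in> {1..num_j \<A> i}" "k \<in> {1..num_k \<A> i j}"
    using assms placement_y by (auto simp: idx3_def)
qed

sublocale X: line_code "idx3 \<A>" "rx S" "ux S"
proof
  fix w assume w: "w \<in> idx3 \<A>"
  obtain i j k where [simp]: "w = (i, j, k)" by (cases w)
  note p = placement_at[OF w[simplified]]
  show "0 < rx S w" "rx S w < 1" "0 \<le> ux S w" "ux S w + rx S w \<le> 1"
    using p ordered_placement_le_1[OF p(2,5)] by (auto simp: ordered_placement_def rx_def ux_def)
qed simp

sublocale Y: line_code "idx3 \<A>" "ry S" "uy S"
proof
  fix w assume w: "w \<in> idx3 \<A>"
  obtain i j k where [simp]: "w = (i, j, k)" by (cases w)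
  note p = placement_at[OF w[simplified]]
  show "0 < ry S w" "ry S w < 1" "0 \<le> uy S w" "uy S w + ry S w \<le> 1"
    using p ordered_placement_le_1[OF p(1,4)] by (auto simp: ordered_placement_def ry_def uy_def)
qed simp

sublocale Z: line_code "idx3 \<A>" "rz S" "uz S"
proof
  fix w assume w: "w \<in> idx3 \<A>"
  obtain i j k where [simp]: "w = (i, j, k)" by (cases w)
  note p = placement_at[OF w[simplified]]
  show "0 < rz S w" "rz S w < 1" "0 \<le> uz S w" "uz S w + rz S w \<le> 1"
    using p placement_z ordered_placement_le_1[OF placement_z p(3)]
    by (auto simp: ordered_placement_def rz_def uz_def)
qed simp

text \<open>Separation is only available fibrewise: in direction \<open>z\<close> for different \<open>i\<close>, in direction \<open>y\<close> for
  different \<open>j\<close> over the same \<open>i\<close>, in direction \<open>x\<close> for different \<open>k\<close> over the same \<open>(i, j)\<close>.\<close>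
lemma separated_z:
  assumes "w \<in> idx3 \<A>" "w' \<in> idx3 \<A>" "proj1 w \<noteq> proj1 w'"
  shows "uz S w + rz S w \<le> uz S w' \<or> uz S w' + rz S w' \<le> uz S w"
proof -
  obtain i j k i' j' k' where [simp]: "w = (i, j, k)" "w' = (i', j', k')" by (cases w, cases w')
  have "i < i' \<or> i' < i" using assms(3) by (auto simp: proj1_def)
  then show ?thesis
    using ordered_placement_separated[OF placement_z, of i i']
      ordered_placement_separated[OF placement_z, of i' i] assms placement_at
    by (auto simp: uz_def rz_def)
qed

lemma separated_y:
  assumes "w \<in> idx3 \<A>" "w' \<in> idx3 \<A>" "proj1 w = proj1 w'" "proj2 w \<noteq> proj2 w'"
  shows "uy S w + ry S w \<le> uy S w' \<or> uy S w' + ry S w' \<le> uy S w"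
proof -
  obtain i j k i' j' k' where [simp]: "w = (i, j, k)" "w' = (i', j', k')" by (cases w, cases w')
  have [simp]: "i' = i" and "j < j' \<or> j' < j" using assms(3,4) by (auto simp: proj1_def proj2_def)
  then show ?thesis
    using ordered_placement_separated[OF placement_at(1), of i j k j j']
      ordered_placement_separated[OF placement_at(1), of i j k j' j] assms placement_at(4)[of i j k] placement_at(4)[of i j' k']
    by (auto simp: uy_def ry_def)
qed

lemma separated_x:
  assumes "w \<in> idx3 \<A>" "w' \<in> idx3 \<A>" "proj2 w = proj2 w'" "w \<noteq> w'"
  shows "ux S w + rx S w \<le> ux S w' \<or> ux S w' + rx S w' \<le> ux S w"
proof -
  obtain i j k i' j' k' where [simp]: "w = (i, j, k)" "w' = (i', j', k')" by (cases w, cases w')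
  have [simp]: "i' = i" "j' = j" and "k < k' \<or> k' < k" using assms(3,4) by (auto simp: proj2_def)
  then show ?thesis
    using ordered_placement_separated[OF placement_at(2), of i j k k k']
      ordered_placement_separated[OF placement_at(2), of i j k k' k] assms placement_at(5)[of i j k] placement_at(5)[of i j k']
    by (auto simp: ux_def rx_def)
qed

lemma compact_sponge_points: "compact (sponge_point S ` code_space \<A>)"
proof (rule compact_continuous_image)
  show "compact (code_space \<A>)" unfolding code_space_def by (rule compact_code_space) simp
  have c: "continuous_on (code_space \<A>) (code_val (rx S) (ux S))"
    "continuous_on (code_space \<A>) (code_val (ry S) (uy S))"
    "continuous_on (code_space \<A>) (code_val (rz S) (uz S))"
    unfolding code_space_def
    by (rule continuous_on_code_val X.line_code_axioms Y.line_code_axioms Z.line_code_axioms)+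
  show "continuous_on (code_space \<A>) (sponge_point S)"
    unfolding continuous_on_def
  proof (intro ballI vec_tendstoI)
    fix \<sigma> i assume "\<sigma> \<in> code_space \<A>"
    then have "\<forall>i. ((\<lambda>\<tau>. sponge_point S \<tau> $ i) \<longlongrightarrow> sponge_point S \<sigma> $ i) (at \<sigma> within code_space \<A>)"
      using c unfolding forall_3 sponge_point_def continuous_on_def vector_3 by blast
    then show "((\<lambda>\<tau>. sponge_point S \<tau> $ i) \<longlongrightarrow> sponge_point S \<sigma> $ i) (at \<sigma> within code_space \<A>)" by blast
  qed
qed

lemma sponge_points_invariant:
  "sponge_point S ` code_space \<A> = (\<Union>w\<in>idx3 \<A>. sponge_map S w ` sponge_point S ` code_space \<A>)"
proof -
  have shift: "sponge_point S \<sigma> = sponge_map S (\<sigma> 0) (sponge_point S (\<lambda>n. \<sigma> (Suc n)))"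
    if "\<sigma> \<in> code_space \<A>" for \<sigma>
    using that X.code_val_shift[of \<sigma>] Y.code_val_shift[of \<sigma>] Z.code_val_shift[of \<sigma>]
    by (simp add: sponge_map_eq sponge_point_def code_space_def vector_3)
  show ?thesis
  proof (intro equalityI subsetI)
    fix v assume "v \<in> sponge_point S ` code_space \<A>"
    then obtain \<sigma> where \<sigma>: "\<sigma> \<in> code_space \<A>" "v = sponge_point S \<sigma>" by blast
    moreover have "\<sigma> 0 \<in> idx3 \<A>" "(\<lambda>n. \<sigma> (Suc n)) \<in> code_space \<A>" using \<sigma> by (auto simp: code_space_def)
    ultimately show "v \<in> (\<Union>w\<in>idx3 \<A>. sponge_map S w ` sponge_point S ` code_space \<A>)"
      using shift[OF \<sigma>(1)] by blast
  next
    fix v assume "v \<in> (\<Union>w\<in>idx3 \<A>. sponge_map S w ` sponge_point S ` code_space \<A>)"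
    then obtain w \<sigma> where w: "w \<in> idx3 \<A>" "\<sigma> \<in> code_space \<A>" "v = sponge_map S w (sponge_point S \<sigma>)" by blast
    have c: "case_nat w \<sigma> \<in> code_space \<A>"
      using w by (auto simp: code_space_def split: nat.splits)
    have "v = sponge_point S (case_nat w \<sigma>)" using shift[OF c] w by simp
    then show "v \<in> sponge_point S ` code_space \<A>" using c by blast
  qed
qed

text \<open>Pulling a point of \<open>K\<close> back within \<open>K\<close> yields a word that codes it; conversely a coded point is the limit
  of images of any fixed point of \<open>K\<close> under the compositions along its code, and \<open>K\<close> is closed.\<close>
lemma invariant_compact_unique:
  assumes "K \<noteq> {}" "compact K" and inv: "K = (\<Union>w\<in>idx3 \<A>. sponge_map S w ` K)"
  shows "K = sponge_point S ` code_space \<A>"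
proof (intro equalityI subsetI)
  fix v assume "v \<in> K"
  have "\<forall>v\<in>K. \<exists>wv. fst wv \<in> idx3 \<A> \<and> snd wv \<in> K \<and> v = sponge_map S (fst wv) (snd wv)"
    by (subst inv) force
  then obtain f where f: "\<And>v. v \<in> K \<Longrightarrow> fst (f v) \<in> idx3 \<A> \<and> snd (f v) \<in> K \<and> v = sponge_map S (fst (f v)) (snd (f v))"
    by metis
  define vs where "vs n = ((snd \<circ> f) ^^ n) v" for n
  define \<sigma> where "\<sigma> n = fst (f (vs n))" for n
  have vs_K: "vs n \<in> K" for n
    by (induction n) (use \<open>v \<in> K\<close> f in \<open>auto simp: vs_def\<close>)
  have \<sigma>: "range \<sigma> \<subseteq> idx3 \<A>" using f vs_K by (auto simp: \<sigma>_def)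
  have vs: "vs n = sponge_map S (\<sigma> n) (vs (Suc n))" for n
    using f[OF vs_K[of n]] by (simp add: \<sigma>_def) (simp add: vs_def)
  obtain B where B: "\<And>v. v \<in> K \<Longrightarrow> norm v \<le> B"
    using compact_imp_bounded[OF \<open>compact K\<close>] by (auto simp: bounded_iff)
  have bound: "\<bar>vs n $ i\<bar> \<le> B" for n i
    using component_le_norm_cart[of "vs n" i] B[OF vs_K[of n]] by linarith
  have "vs 0 $ 1 = code_val (rx S) (ux S) \<sigma>"
    by (rule X.code_val_unique[where x="\<lambda>n. vs n $ 1", OF \<sigma> _ bound]) (subst vs, simp add: sponge_map_eq vector_3)
  moreover have "vs 0 $ 2 = code_val (ry S) (uy S) \<sigma>"
    by (rule Y.code_val_unique[where x="\<lambda>n. vs n $ 2", OF \<sigma> _ bound]) (subst vs, simp add: sponge_map_eq vector_3)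
  moreover have "vs 0 $ 3 = code_val (rz S) (uz S) \<sigma>"
    by (rule Z.code_val_unique[where x="\<lambda>n. vs n $ 3", OF \<sigma> _ bound]) (subst vs, simp add: sponge_map_eq vector_3)
  ultimately have "v = sponge_point S \<sigma>"
    by (simp add: vec_eq_iff forall_3 sponge_point_def vector_3 vs_def)
  then show "v \<in> sponge_point S ` code_space \<A>" using \<sigma> by (auto simp: code_space_def)
next
  fix v assume "v \<in> sponge_point S ` code_space \<A>"
  then obtain \<sigma> where \<sigma>: "range \<sigma> \<subseteq> idx3 \<A>" and v: "v = sponge_point S \<sigma>" by (auto simp: code_space_def)
  obtain x where "x \<in> K" using \<open>K \<noteq> {}\<close> by blast
  define y :: "real^3 \<Rightarrow> nat \<Rightarrow> real^3" where
    "y x n = vector [code_left (rx S) (ux S) \<sigma> n + code_ratio (rx S) \<sigma> n * x $ 1,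
      code_left (ry S) (uy S) \<sigma> n + code_ratio (ry S) \<sigma> n * x $ 2,
      code_left (rz S) (uz S) \<sigma> n + code_ratio (rz S) \<sigma> n * x $ 3]" for x n
  have "y x n \<in> K" if "x \<in> K" for x n
    using that
  proof (induction n arbitrary: x)
    case 0
    have "y x 0 = x" by (simp add: y_def vec_eq_iff forall_3 vector_3)
    then show ?case using 0 by simp
  next
    case (Suc n)
    have "sponge_map S (\<sigma> n) x \<in> K" by (subst inv) (use Suc.prems \<sigma> in auto)
    then have "y (sponge_map S (\<sigma> n) x) n \<in> K" by (rule Suc.IH)
    also have "y (sponge_map S (\<sigma> n) x) n = y x (Suc n)"
      by (simp add: y_def sponge_map_eq vector_3 code_left_Suc code_ratio_Suc algebra_simps)
    finally show ?case .
  qed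
  moreover have "y x \<longlonglongrightarrow> v"
  proof (rule vec_tendstoI)
    fix i
    have "\<forall>i. (\<lambda>n. y x n $ i) \<longlonglongrightarrow> v $ i"
      unfolding forall_3 y_def v sponge_point_def vector_3
      by (intro conjI X.code_tendsto_val Y.code_tendsto_val Z.code_tendsto_val \<sigma>)
    then show "(\<lambda>n. y x n $ i) \<longlonglongrightarrow> v $ i" by blast
  qed
  ultimately show "v \<in> K"
    using closed_sequentially[OF compact_imp_closed[OF \<open>compact K\<close>]] \<open>x \<in> K\<close> by blast
qed

lemma code_space_nonempty: "code_space \<A> \<noteq> {}"
proof -
  have "(\<lambda>_. (1, 1, 1)) \<in> code_space \<A>" using idx3_nonempty[OF valid] by (auto simp: code_space_def)
  then show ?thesis by blast
qed

lemma sponge_set_eq: "sponge_set \<A> S = sponge_point S ` code_space \<A>"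
  unfolding sponge_set_def
proof (rule the_equality)
  show "sponge_point S ` code_space \<A> \<noteq> {} \<and> compact (sponge_point S ` code_space \<A>) \<and>
    sponge_point S ` code_space \<A> = (\<Union>w\<in>idx3 \<A>. sponge_map S w ` sponge_point S ` code_space \<A>)"
    using code_space_nonempty compact_sponge_points sponge_points_invariant by blast
  show "K = sponge_point S ` code_space \<A>"
    if "K \<noteq> {} \<and> compact K \<and> K = (\<Union>w\<in>idx3 \<A>. sponge_map S w ` K)" for K
    using that by (intro invariant_compact_unique) blast+
qed

end

section \<open>Entropy of types\<close>

text \<open>The function \<open>x * ln x\<close> is continuous on \<open>[0, \<infinity>)\<close> including the point \<open>0\<close>; letters of probability zero
  require this endpoint.\<close>
lemma tendsto_x_ln_x:
  assumes "(x \<longlongrightarrow> p) F" "\<forall>\<^sub>F n in F. 0 \<le> x n" "0 \<le> p"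
  shows "((\<lambda>n. x n * ln (x n)) \<longlongrightarrow> p * ln (p::real)) F"
proof (cases "p = 0")
  case True
  have "((\<lambda>x::real. x * ln x) \<longlongrightarrow> 0) (at_right 0)" by real_asymp
  then have "continuous (at_right 0) (\<lambda>x::real. x * ln x)"
    by (simp add: continuous_within)
  then have "continuous (at (0::real) within {0..}) (\<lambda>x::real. x * ln x)"
    by (simp add: at_within_Ici_at_right)
  then have "((\<lambda>n. x n * ln (x n)) \<longlongrightarrow> 0 * ln (0::real)) F"
    using assms True by (intro continuous_within_tendsto_compose[where S="{0..}" and f="\<lambda>x. x * ln x"]) auto
  then show ?thesis using True by simp
next
  case False
  then show ?thesis using assms by (intro tendsto_intros) auto
qed

text \<open>A weak form of Stirling's formula: a logarithmic error disappears after division by \<open>N\<close>.\<close>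
lemma ln_fact_bounds:
  assumes "n > 0"
  shows "real n * ln n - n \<le> ln (fact n)" "ln (fact n) \<le> real n * ln n - n + ln n + 1"
proof -
  have step: "real n * (ln (real n + 1) - ln n) \<le> 1" "1 \<le> (real n + 1) * (ln (real n + 1) - ln n)" if "n > 0" for n
  proof -
    have "ln (1 + 1 / real n) \<le> 1 / real n" by (rule ln_add_one_self_le_self) simp
    moreover have "ln (1 + 1 / real n) = ln (real n + 1) - ln n"
      using that ln_div[of "real n + 1" "real n"] by (simp add: add_divide_distrib)
    ultimately have "real n * (ln (real n + 1) - ln n) \<le> real n * (1 / real n)" by (intro mult_left_mono) auto
    then show "real n * (ln (real n + 1) - ln n) \<le> 1" using that by simp
    have "ln (1 - 1 / (real n + 1)) \<le> - (1 / (real n + 1))"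
      using that by (intro order_trans[OF ln_le_minus_one]) (auto simp: field_simps)
    moreover have "ln (1 - 1 / (real n + 1)) = ln n - ln (real n + 1)"
      using that ln_div[of "real n" "real n + 1"] by (simp add: diff_divide_eq_iff)
    ultimately have "(real n + 1) * (ln n - ln (real n + 1)) \<le> (real n + 1) * (- (1 / (real n + 1)))"
      by (intro mult_left_mono) auto
    then show "1 \<le> (real n + 1) * (ln (real n + 1) - ln n)" by (simp add: algebra_simps)
  qed
  have fact_step: "ln (fact (Suc n) :: real) = ln (real n + 1) + ln (fact n)" for n
    by (simp add: ln_mult_pos add.commute del: distrib_left_numeral)
  show "real n * ln n - n \<le> ln (fact n)"
    using assms
  proof (induction n rule: nat_induct_non_zero)
    case (Suc n)
    then show ?case using step(1)[of n] unfolding fact_step by (simp add: algebra_simps)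
  qed simp
  show "ln (fact n) \<le> real n * ln n - n + ln n + 1"
    using assms
  proof (induction n rule: nat_induct_non_zero)
    case (Suc n)
    then show ?case using step(2)[of n] unfolding fact_step by (simp add: algebra_simps)
  qed simp
qed

text \<open>The terms that are linear in \<open>k N\<close> are subtracted because they cancel in multinomial
  coefficients; what is left is the entropy term \<open>p * ln p\<close>.\<close>
lemma ln_fact_asymptotic:
  fixes k :: "nat \<Rightarrow> nat"
  assumes k: "(\<lambda>N. real (k N) / real N) \<longlonglongrightarrow> p"
  shows "(\<lambda>N. (ln (fact (k N)) - real (k N) * ln N + real (k N)) / N) \<longlonglongrightarrow> p * ln p"
proof -
  define err where "err N = ln (fact (k N)) - (real (k N) * ln (k N) - real (k N))" for N
  have err: "\<bar>err N\<bar> \<le> ln (real (k N) + 1) + 1" for N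
  proof (cases "k N = 0")
    case False
    have "ln (real (k N)) \<le> ln (real (k N) + 1)" using False by simp
    moreover have "0 \<le> ln (real (k N) + 1)" by simp
    ultimately show ?thesis using ln_fact_bounds[of "k N"] False unfolding err_def by linarith
  qed (simp add: err_def)
  have "\<forall>\<^sub>F N in sequentially. real (k N) / real N < p + 1"
    using k by (rule order_tendstoD(2)) simp
  then have ev: "\<forall>\<^sub>F N in sequentially. norm (err N / N) \<le> (ln ((p + 1) * N + 1) + 1) / N"
    using eventually_gt_at_top[of 0]
  proof eventually_elim
    case (elim N)
    then have "real (k N) + 1 \<le> (p + 1) * N + 1" by (simp add: field_simps)
    then have "ln (real (k N) + 1) \<le> ln ((p + 1) * N + 1)" by (intro ln_mono) auto
    then show ?case using err[of N] elim by (auto simp: divide_right_mono)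
  qed
  have "p \<ge> 0" using k by (rule LIMSEQ_le_const) auto
  then have "p + 1 > 0" by simp
  then have "(\<lambda>N. (ln ((p + 1) * real N + 1) + 1) / real N) \<longlonglongrightarrow> 0" by real_asymp
  then have err_lim: "(\<lambda>N. err N / N) \<longlonglongrightarrow> 0" by (rule Lim_null_comparison[OF ev])
  have "(\<lambda>N. real (k N) / N * ln (real (k N) / N)) \<longlonglongrightarrow> p * ln p"
    using k \<open>p \<ge> 0\<close> by (intro tendsto_x_ln_x) auto
  from tendsto_add[OF this err_lim]
  have "(\<lambda>N. real (k N) / N * ln (real (k N) / N) + err N / N) \<longlonglongrightarrow> p * ln p" by simp
  moreover have "\<forall>\<^sub>F N in sequentially. real (k N) / N * ln (real (k N) / N) + err N / N =
      (ln (fact (k N)) - real (k N) * ln N + real (k N)) / N"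
    using eventually_gt_at_top[of 0]
  proof eventually_elim
    case (elim N)
    then show ?case by (cases "k N = 0") (auto simp: err_def ln_div field_simps)
  qed
  ultimately show ?thesis by (rule Lim_transform_eventually)
qed

text \<open>The number of words with prescribed letter frequencies is a multinomial coefficient, whose exponential
  growth rate is the entropy of the frequencies.\<close>
lemma ln_card_permutations_asymptotic:
  fixes A :: "nat \<Rightarrow> 'a multiset"
  assumes X: "finite X" "\<And>N. set_mset (A N) \<subseteq> X"
    and q: "\<And>x. x \<in> X \<Longrightarrow> (\<lambda>N. real (count (A N) x) / N) \<longlonglongrightarrow> q x" "(\<Sum>x\<in>X. q x) = 1"
  shows "(\<lambda>N. ln (card (permutations_of_multiset (A N))) / N) \<longlonglongrightarrow> - (\<Sum>x\<in>X. q x * ln (q x))"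
proof -
  define G where "G N k = (ln (fact k) - real k * ln (real N) + real k) / real N" for N k :: nat
  have size: "real (size (A N)) = (\<Sum>x\<in>X. real (count (A N) x))" for N
    unfolding size_multiset_overloaded_eq of_nat_sum
    by (rule sum.mono_neutral_left) (use X in \<open>auto simp: not_in_iff\<close>)
  have "(\<lambda>N. real (size (A N)) / N) \<longlonglongrightarrow> 1"
    unfolding size sum_divide_distrib q(2)[symmetric] by (intro tendsto_sum q)
  then have "(\<lambda>N. G N (size (A N)) - (\<Sum>x\<in>X. G N (count (A N) x))) \<longlonglongrightarrow> 1 * ln 1 - (\<Sum>x\<in>X. q x * ln (q x))"
    unfolding G_def by (intro tendsto_diff tendsto_sum ln_fact_asymptotic q)
  moreover have "G N (size (A N)) - (\<Sum>x\<in>X. G N (count (A N) x)) = ln (card (permutations_of_multiset (A N))) / N" for N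
  proof -
    have "real (card (permutations_of_multiset (A N))) * (\<Prod>x\<in>X. fact (count (A N) x)) = fact (size (A N))"
    proof -
      have "(\<Prod>x\<in>X. fact (count (A N) x)) = (\<Prod>x\<in>set_mset (A N). fact (count (A N) x) :: nat)"
        by (rule prod.mono_neutral_right) (use X in \<open>auto simp: not_in_iff\<close>)
      then have "card (permutations_of_multiset (A N)) * (\<Prod>x\<in>X. fact (count (A N) x)) = fact (size (A N))"
        using card_permutations_of_multiset_aux[of "A N"] by simp
      from arg_cong[OF this, of real] show ?thesis by simp
    qed
    moreover have "card (permutations_of_multiset (A N)) > 0"
      by (simp add: card_gt_0_iff permutations_of_multiset_nonempty)
    ultimately have "ln (real (card (permutations_of_multiset (A N)))) + ln (\<Prod>x\<in>X. fact (count (A N) x)) = ln (fact (size (A N)))"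
      by (subst ln_mult_pos[symmetric]) (auto intro: prod_pos)
    moreover have "ln (\<Prod>x\<in>X. fact (count (A N) x) :: real) = (\<Sum>x\<in>X. ln (fact (count (A N) x)))"
      using X by (intro ln_prod) auto
    moreover have sum_G: "(\<Sum>x\<in>X. G N (count (A N) x)) =
        ((\<Sum>x\<in>X. ln (fact (count (A N) x))) - real (size (A N)) * ln N + real (size (A N))) / N"
      unfolding G_def size by (simp add: sum_divide_distrib[symmetric] sum.distrib sum_subtractf sum_distrib_right)
    ultimately have "ln (real (card (permutations_of_multiset (A N)))) =
        (ln (fact (size (A N))) - real (size (A N)) * ln N + real (size (A N))) -
        ((\<Sum>x\<in>X. ln (fact (count (A N) x))) - real (size (A N)) * ln N + real (size (A N)))" by linarith
    then show ?thesis
      unfolding sum_G unfolding G_def by (simp only: diff_divide_distrib[symmetric])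
  qed
  ultimately show ?thesis by simp
qed

text \<open>Permuting positions carries the words lying over \<open>v\<close> injectively into those lying over any
  rearrangement of \<open>v\<close>, so all fibres of \<open>map f\<close> have the same size.\<close>
lemma permutations_of_multiset_fibre_card:
  assumes v: "v \<in> permutations_of_multiset (image_mset f A)"
  shows "card {w \<in> permutations_of_multiset A. map f w = v} * card (permutations_of_multiset (image_mset f A))
    = card (permutations_of_multiset A)"
proof -
  let ?F = "\<lambda>v. {w \<in> permutations_of_multiset A. map f w = v}"
  have le: "card (?F v) \<le> card (?F v')"
    if "v \<in> permutations_of_multiset (image_mset f A)" "v' \<in> permutations_of_multiset (image_mset f A)" for v v'
  proof -
    have "mset v' = mset v" using that by (simp add: permutations_of_multiset_def)
    then obtain \<pi> where \<pi>: "\<pi> permutes {..<length v}" "permute_list \<pi> v = v'"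
      by (rule mset_eq_permutation)
    show ?thesis
    proof (rule card_inj_on_le)
      show "inj_on (permute_list \<pi>) (?F v)"
      proof (rule inj_onI)
        fix w w' assume w: "w \<in> ?F v" "w' \<in> ?F v" and eq: "permute_list \<pi> w = permute_list \<pi> w'"
        then have len: "length w = length v" "length w' = length v"
          using length_map[of f w] length_map[of f w'] by auto
        show "w = w'"
        proof (rule nth_equalityI)
          fix i assume "i < length w"
          then obtain j where "j < length v" "\<pi> j = i"
            using permutes_image[OF \<pi>(1)] len by (metis (no_types, lifting) imageE lessThan_iff)
          then show "w ! i = w' ! i"
            using arg_cong[OF eq, of "\<lambda>w. w ! j"] \<pi>(1) len by (simp add: permute_list_nth)
        qed (use len in simp)
      qed
      show "permute_list \<pi> ` ?F v \<subseteq> ?F v'"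
        using \<pi> by (auto simp: permutations_of_multiset_def permute_list_map[symmetric])
    qed simp
  qed
  have "card (permutations_of_multiset A) = (\<Sum>v'\<in>permutations_of_multiset (image_mset f A). card (?F v'))"
  proof -
    have "permutations_of_multiset A = (\<Union>v'\<in>permutations_of_multiset (image_mset f A). ?F v')"
      by (auto simp: permutations_of_multiset_image)
    then have "card (permutations_of_multiset A) = card (\<Union>v'\<in>permutations_of_multiset (image_mset f A). ?F v')"
      by (rule arg_cong)
    also have "\<dots> = (\<Sum>v'\<in>permutations_of_multiset (image_mset f A). card (?F v'))"
      by (rule card_UN_disjoint) auto
    finally show ?thesis .
  qed
  also have "\<dots> = (\<Sum>v'\<in>permutations_of_multiset (image_mset f A). card (?F v))"
    by (intro sum.cong refl antisym le v)
  finally show ?thesis by simp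
qed

lemma card_permutations_of_multiset_pos: "0 < card (permutations_of_multiset A)"
  by (simp add: card_gt_0_iff permutations_of_multiset_nonempty)

lemma permutations_of_multiset_fibre_fraction:
  assumes "w \<in> permutations_of_multiset A"
  shows "card {w'\<in>permutations_of_multiset A. map f w' = map f w} / card (permutations_of_multiset A)
    \<le> exp (- ln (card (permutations_of_multiset (image_mset f A))))"
proof -
  have "map f w \<in> permutations_of_multiset (image_mset f A)"
    using assms by (auto simp: permutations_of_multiset_image)
  from arg_cong[OF permutations_of_multiset_fibre_card[OF this], of real]
  have "real (card {w'\<in>permutations_of_multiset A. map f w' = map f w}) * real (card (permutations_of_multiset (image_mset f A)))
      = real (card (permutations_of_multiset A))" by simp
  moreover have "0 < card (permutations_of_multiset A)" "0 < card (permutations_of_multiset (image_mset f A))"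
    by (rule card_permutations_of_multiset_pos)+
  ultimately show ?thesis by (simp add: exp_minus divide_simps)
qed

section \<open>Lower bounds for the Hausdorff dimension\<close>

text \<open>Preimages of covering sets are asked to lie in measurable sets of small measure, and countable
  subadditivity is applied to those; for coded points such sets are finite unions of cylinders.\<close>
lemma mass_distribution_principle:
  fixes E :: "'a::metric_space set" and X :: "'w \<Rightarrow> 'a" and D B :: real
  assumes "prob_space M" and X: "\<And>\<omega>. \<omega> \<in> space M \<Longrightarrow> X \<omega> \<in> E" and "B > 0"
    and mass: "\<And>U r. bounded U \<Longrightarrow> diameter U \<le> r \<Longrightarrow> 0 < r \<Longrightarrow> r \<le> 1 \<Longrightarrow>
      \<exists>C\<in>sets M. {\<omega>\<in>space M. X \<omega> \<in> U} \<subseteq> C \<and> measure M C \<le> B * r powr D"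
  shows "ereal D \<le> hausdorff_dim E"
  unfolding hausdorff_dim_def
proof (rule INF_greatest, clarify)
  interpret prob_space M by fact
  fix s :: real assume "0 \<le> s" and null: "hausdorff_measure s E = 0"
  show "ereal D \<le> ereal s"
  proof (rule ccontr)
    assume "\<not> ereal D \<le> ereal s"
    then have "s < D" by simp
    then have "D > 0" using \<open>0 \<le> s\<close> by simp
    define \<eta> where "\<eta> = min 1 (1 / (2 * B))"
    have \<eta>: "0 < \<eta>" "\<eta> \<le> 1" "B * (2 * \<eta>) \<le> 1" using \<open>B > 0\<close> by (auto simp: \<eta>_def min_def field_simps)
    have "hausdorff_premeasure s 1 E \<le> hausdorff_measure s E"
      unfolding hausdorff_measure_def by (rule SUP_upper) simp
    then have "hausdorff_premeasure s 1 E < ennreal \<eta>" using null \<eta> by simp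
    then obtain U where U: "E \<subseteq> (\<Union>n. U n)" "\<And>n. bounded (U n)" "\<And>n. diameter (U n) \<le> 1"
      and small: "(\<Sum>n. hausdorff_gauge s (U n)) < ennreal \<eta>"
      unfolding hausdorff_premeasure_def by (auto simp: INF_less_iff)
    define e where "e n = \<eta> * (1/2) ^ Suc n" for n
    have e: "0 < e n" "e n \<le> 1" for n
    proof -
      have "(1/2 :: real) ^ Suc n \<le> 1" by (rule power_le_one) auto
      then show "0 < e n" "e n \<le> 1" unfolding e_def using \<eta> by (auto intro: mult_le_one simp del: power_Suc)
    qed
    have "\<exists>C\<in>sets M. {\<omega>\<in>space M. X \<omega> \<in> U n} \<subseteq> C \<and>
        emeasure M C \<le> ennreal B * (hausdorff_gauge s (U n) + ennreal (e n))" for n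
    proof (cases "U n = {}")
      case False
      define d where "d = diameter (U n)"
      have d: "0 \<le> d" "d \<le> 1" using U(3)[of n] diameter_ge_0[OF U(2)[of n]] by (auto simp: d_def)
      \<comment> \<open>Singletons have diameter 0, so the diameter is replaced by a positive radius.\<close>
      define r where "r = max d (e n powr (1 / D))"
      have r: "0 < r" "r \<le> 1" "d \<le> r"
        using d e[of n] \<open>D > 0\<close> by (auto simp: r_def powr_le1 less_max_iff_disj)
      obtain C where C: "C \<in> sets M" "{\<omega>\<in>space M. X \<omega> \<in> U n} \<subseteq> C" "measure M C \<le> B * r powr D"
        using mass[OF U(2)[of n], of r] r by (auto simp: d_def)
      have "r powr D \<le> d powr D + e n"
      proof (cases "e n powr (1 / D) \<le> d")
        case False
        then have "r powr D = e n" using \<open>D > 0\<close> e[of n] by (simp add: r_def max_def powr_powr)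
        then show ?thesis by simp
      qed (use e[of n] in \<open>simp add: r_def max_def\<close>)
      moreover have "ennreal (d powr D) \<le> hausdorff_gauge s (U n)"
      proof (cases "s = 0")
        case True
        then show ?thesis using False d \<open>D > 0\<close> by (simp add: hausdorff_gauge_def powr_le1)
      next
        case s: False
        have "d powr D \<le> d powr s"
          using d \<open>s < D\<close> by (intro powr_mono') auto
        then show ?thesis using False s by (simp add: hausdorff_gauge_def d_def ennreal_leI)
      qed
      ultimately have "ennreal (r powr D) \<le> hausdorff_gauge s (U n) + ennreal (e n)"
        using e[of n]
        by (intro order_trans[OF ennreal_leI[of "r powr D" "d powr D + e n"]]) (auto simp: ennreal_plus intro!: add_mono)
      then have "ennreal B * ennreal (r powr D) \<le> ennreal B * (hausdorff_gauge s (U n) + ennreal (e n))"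
        by (rule mult_left_mono) simp
      moreover have "emeasure M C \<le> ennreal B * ennreal (r powr D)"
        using C(3) \<open>B > 0\<close> by (simp add: emeasure_eq_measure ennreal_mult[symmetric] ennreal_leI)
      ultimately show ?thesis using C by (meson order_trans)
    qed (auto intro!: bexI[of _ "{}"])
    then obtain C where C: "\<And>n. C n \<in> sets M" "\<And>n. {\<omega>\<in>space M. X \<omega> \<in> U n} \<subseteq> C n"
      "\<And>n. emeasure M (C n) \<le> ennreal B * (hausdorff_gauge s (U n) + ennreal (e n))"
      by metis
    have "space M \<subseteq> (\<Union>n. C n)"
    proof
      fix \<omega> assume "\<omega> \<in> space M"
      moreover obtain n where "X \<omega> \<in> U n" using X[OF \<open>\<omega> \<in> space M\<close>] U(1) by blast
      ultimately show "\<omega> \<in> (\<Union>n. C n)" using C(2)[of n] by blast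
    qed
    then have "1 \<le> emeasure M (\<Union>n. C n)"
      using emeasure_mono[of "space M" "\<Union>n. C n" M] C(1) emeasure_space_1 by auto
    also have "\<dots> \<le> (\<Sum>n. emeasure M (C n))"
      using C(1) by (intro emeasure_subadditive_countably) auto
    also have "\<dots> \<le> (\<Sum>n. ennreal B * (hausdorff_gauge s (U n) + ennreal (e n)))"
      by (intro suminf_le C(3)) auto
    also have "\<dots> = ennreal B * ((\<Sum>n. hausdorff_gauge s (U n)) + (\<Sum>n. ennreal (e n)))"
      by (simp add: ennreal_suminf_cmult suminf_add)
    also have "\<dots> = ennreal B * (ennreal \<eta> + (\<Sum>n. hausdorff_gauge s (U n)))"
    proof -
      have "e sums (\<eta> * 1)" unfolding e_def by (intro sums_mult power_half_series)
      then have "(\<Sum>n. ennreal (e n)) = ennreal \<eta>"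
        using e by (intro suminf_ennreal_eq) (auto intro: less_imp_le)
      then show ?thesis by (simp only: add.commute)
    qed
    also have "\<dots> < ennreal B * (ennreal \<eta> + ennreal \<eta>)"
    proof (rule ennreal_mult_strict_left_mono)
      show "ennreal \<eta> + (\<Sum>n. hausdorff_gauge s (U n)) < ennreal \<eta> + ennreal \<eta>"
        using small by (simp only: ennreal_add_left_cancel_less) simp
    qed (use \<open>B > 0\<close> in auto)
    also have "\<dots> = ennreal (B * (2 * \<eta>))"
      using \<eta> \<open>B > 0\<close> by (simp add: ennreal_plus[symmetric] ennreal_mult[symmetric] del: ennreal_plus)
    also have "\<dots> \<le> 1" using \<eta> by (simp add: ennreal_le_1)
    finally show False by simp
  qed
qed

text \<open>Look at the first position at which the projected letters differ; the intervals selected there do not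
  overlap, so the left endpoints are at least \<open>\<rho>\<close> apart.\<close>
lemma (in line_code) code_close_imp_agree:
  assumes \<sigma>: "range \<sigma> \<subseteq> W" and \<tau>: "range \<tau> \<subseteq> W"
    and proj: "\<And>w w'. proj w = proj w' \<Longrightarrow> r w = r w' \<and> u w = u w'"
    and sep: "\<And>l. l < n \<Longrightarrow> proj (\<sigma> l) \<noteq> proj (\<tau> l) \<Longrightarrow>
      u (\<sigma> l) + r (\<sigma> l) \<le> u (\<tau> l) \<or> u (\<tau> l) + r (\<tau> l) \<le> u (\<sigma> l)"
    and ratio: "\<rho> \<le> code_ratio r \<sigma> n" "\<rho> \<le> code_ratio r \<tau> n"
    and close: "\<bar>code_left r u \<sigma> n - code_left r u \<tau> n\<bar> < \<rho>"
    and "l < n"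
  shows "proj (\<sigma> l) = proj (\<tau> l)"
proof (rule ccontr)
  assume "proj (\<sigma> l) \<noteq> proj (\<tau> l)"
  define k where "k = (LEAST k. proj (\<sigma> k) \<noteq> proj (\<tau> k))"
  have k: "proj (\<sigma> k) \<noteq> proj (\<tau> k)" "k \<le> l"
    using LeastI[of "\<lambda>k. proj (\<sigma> k) \<noteq> proj (\<tau> k)" l] Least_le[of "\<lambda>k. proj (\<sigma> k) \<noteq> proj (\<tau> k)" l]
      \<open>proj (\<sigma> l) \<noteq> proj (\<tau> l)\<close> unfolding k_def by blast+
  then have "k < n" using \<open>l < n\<close> by simp
  have "proj (\<sigma> i) = proj (\<tau> i)" if "i < k" for i
    using not_less_Least[of i "\<lambda>k. proj (\<sigma> k) \<noteq> proj (\<tau> k)"] that by (auto simp: k_def)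
  then have eq: "r (\<sigma> i) = r (\<tau> i) \<and> u (\<sigma> i) = u (\<tau> i)" if "i < k" for i using that proj by blast
  then have eq': "r (\<tau> i) = r (\<sigma> i) \<and> u (\<tau> i) = u (\<sigma> i)" if "i < k" for i using that by simp
  from sep[OF \<open>k < n\<close> k(1)] show False
  proof
    assume "u (\<sigma> k) + r (\<sigma> k) \<le> u (\<tau> k)"
    from code_intervals_separated[OF \<sigma> \<tau> eq \<open>k < n\<close> this] show False using ratio close by linarith
  next
    assume "u (\<tau> k) + r (\<tau> k) \<le> u (\<sigma> k)"
    from code_intervals_separated[OF \<tau> \<sigma> eq' \<open>k < n\<close> this] show False using ratio close by linarith
  qed
qed

text \<open>Rounding the position of a selected interval to multiples of its length leaves four possible
  values when the coded point is within that length of \<open>v\<close>. This bounds the number of approximate cubes met by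
  a small set.\<close>
lemma (in line_code) code_interval_offset:
  assumes \<sigma>: "range \<sigma> \<subseteq> W" and ratio: "code_ratio r \<sigma> n = \<rho>" and close: "\<bar>code_val r u \<sigma> - v\<bar> \<le> \<rho>"
  shows "\<lfloor>(code_left r u \<sigma> n - v) / \<rho>\<rfloor> \<in> {-2..1}"
proof -
  have "\<rho> > 0" using code_ratio_pos[OF \<sigma>, of n] ratio by simp
  have "- 2 * \<rho> \<le> code_left r u \<sigma> n - v" "code_left r u \<sigma> n - v \<le> 1 * \<rho>"
    using code_val_ge[OF \<sigma>, of n] code_val_le[OF \<sigma>, of n] ratio close by linarith+
  then have "- 2 \<le> (code_left r u \<sigma> n - v) / \<rho>" "(code_left r u \<sigma> n - v) / \<rho> \<le> 1"
    using \<open>\<rho> > 0\<close> by (simp_all add: field_simps)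
  then show ?thesis by (auto simp: le_floor_iff floor_le_iff)
qed

lemma floor_div_eq_imp_close:
  fixes x y \<rho> :: real
  assumes "\<lfloor>(x - v) / \<rho>\<rfloor> = \<lfloor>(y - v) / \<rho>\<rfloor>" "\<rho> > 0"
  shows "\<bar>x - y\<bar> < \<rho>"
proof -
  have "\<bar>(x - v) / \<rho> - (y - v) / \<rho>\<bar> < 1" using assms(1) by linarith
  moreover have "(x - v) / \<rho> - (y - v) / \<rho> = (x - y) / \<rho>" by (simp add: diff_divide_distrib)
  ultimately show ?thesis using assms(2) by (simp add: abs_divide)
qed

definition flatten_blocks :: "nat \<Rightarrow> (nat \<Rightarrow> 'w list) \<Rightarrow> nat \<Rightarrow> 'w" where
  "flatten_blocks m \<omega> l = \<omega> (l div m) ! (l mod m)"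

lemma flatten_blocks_nth: "i < m \<Longrightarrow> flatten_blocks m \<omega> (m * b + i) = \<omega> b ! i"
  by (simp add: flatten_blocks_def)

lemma flatten_blocks_in:
  assumes "m > 0" "\<And>b. length (\<omega> b) = m \<and> set (\<omega> b) \<subseteq> W"
  shows "range (flatten_blocks m \<omega>) \<subseteq> W"
proof clarify
  fix l
  have "l mod m < length (\<omega> (l div m))" using assms by simp
  then have "flatten_blocks m \<omega> l \<in> set (\<omega> (l div m))" unfolding flatten_blocks_def by (rule nth_mem)
  then show "flatten_blocks m \<omega> l \<in> W" using assms(2) by blast
qed

lemma code_ratio_flatten_blocks:
  assumes "\<And>b. length (\<omega> b) = m" "\<And>b. prod_list (map r (\<omega> b)) = \<rho>"
  shows "code_ratio r (flatten_blocks m \<omega>) (m * q) = \<rho> ^ q"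
proof (induction q)
  case (Suc q)
  have "code_ratio r (flatten_blocks m \<omega>) (m * q + i) =
      code_ratio r (flatten_blocks m \<omega>) (m * q) * (\<Prod>l<i. r (\<omega> q ! l))" if "i \<le> m" for i
    using that by (induction i) (simp_all add: code_ratio_Suc flatten_blocks_nth)
  from this[of m] have "code_ratio r (flatten_blocks m \<omega>) (m * Suc q) = \<rho> ^ q * (\<Prod>l<m. r (\<omega> q ! l))"
    by (simp add: Suc add.commute)
  also have "(\<Prod>l<m. r (\<omega> q ! l)) = prod_list (map r (\<omega> q))"
    using assms(1)[of q] by (simp add: prod.list_conv_set_nth lessThan_atLeast0)
  finally show ?case using assms(2)[of q] by simp
qed simp

lemma flatten_blocks_agree:
  assumes "\<And>b. length (\<omega> b) = m" "\<And>b. length (\<omega>' b) = m" "b < q"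
    and agree: "\<And>l. l < m * q \<Longrightarrow> f (flatten_blocks m \<omega> l) = f (flatten_blocks m \<omega>' l)"
  shows "map f (\<omega> b) = map f (\<omega>' b)"
proof (rule nth_equalityI)
  fix i assume "i < length (map f (\<omega> b))"
  then have "i < m" using assms(1) by simp
  moreover have "m * b + i < m * q"
  proof -
    have "m * b + i < m * Suc b" using \<open>i < m\<close> by simp
    also have "\<dots> \<le> m * q" using \<open>b < q\<close> by (intro mult_le_mono2) simp
    finally show ?thesis .
  qed
  ultimately show "map f (\<omega> b) ! i = map f (\<omega>' b) ! i"
    using agree[of "m * b + i"] assms(1,2) by (simp add: flatten_blocks_nth)
qed (use assms in simp)

lemma measure_uniform_product_cylinder:
  assumes "finite T" "T \<noteq> {}" "\<And>l. l < q \<Longrightarrow> E l \<subseteq> T"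
  shows "{\<omega>\<in>space (PiM UNIV (\<lambda>_::nat. uniform_count_measure T)). \<forall>l\<in>{..<q}. \<omega> l \<in> E l}
      \<in> sets (PiM UNIV (\<lambda>_::nat. uniform_count_measure T))"
    and "measure (PiM UNIV (\<lambda>_::nat. uniform_count_measure T))
      {\<omega>\<in>space (PiM UNIV (\<lambda>_::nat. uniform_count_measure T)). \<forall>l\<in>{..<q}. \<omega> l \<in> E l} = (\<Prod>l<q. card (E l) / card T)"
proof -
  have prob: "prob_space (uniform_count_measure T)"
    using assms by (intro prob_space_uniform_count_measure)
  then interpret product_prob_space "\<lambda>_::nat. uniform_count_measure T" UNIV
    by (intro product_prob_spaceI)
  have sets: "E l \<in> sets (uniform_count_measure T)" if "l < q" for l
    using assms(3)[OF that] by (simp add: sets_uniform_count_measure)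
  show "{\<omega>\<in>space (PiM UNIV (\<lambda>_::nat. uniform_count_measure T)). \<forall>l\<in>{..<q}. \<omega> l \<in> E l}
      \<in> sets (PiM UNIV (\<lambda>_::nat. uniform_count_measure T))"
  proof -
    have "{\<omega>\<in>space (PiM UNIV (\<lambda>_::nat. uniform_count_measure T)). \<forall>l\<in>{..<q}. \<omega> l \<in> E l}
        = prod_emb UNIV (\<lambda>_::nat. uniform_count_measure T) {..<q} (PiE {..<q} E)"
      unfolding prod_emb_def by (auto simp: space_PiM Pi_iff)
    also have "\<dots> \<in> sets (PiM UNIV (\<lambda>_::nat. uniform_count_measure T))"
      by (rule sets_PiM_I) (use sets in auto)
    finally show ?thesis .
  qed
  have "emeasure (PiM UNIV (\<lambda>_::nat. uniform_count_measure T))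
      {\<omega>\<in>space (PiM UNIV (\<lambda>_::nat. uniform_count_measure T)). \<forall>l\<in>{..<q}. \<omega> l \<in> E l} =
      (\<Prod>l<q. emeasure (uniform_count_measure T) (E l))"
    by (intro emeasure_PiM_Collect) (use sets in auto)
  also have "\<dots> = (\<Prod>l<q. ennreal (card (E l) / card T))"
    using assms by (intro prod.cong refl emeasure_uniform_count_measure) auto
  also have "\<dots> = ennreal (\<Prod>l<q. card (E l) / card T)" by (simp add: prod_ennreal)
  finally show "measure (PiM UNIV (\<lambda>_::nat. uniform_count_measure T))
      {\<omega>\<in>space (PiM UNIV (\<lambda>_::nat. uniform_count_measure T)). \<forall>l\<in>{..<q}. \<omega> l \<in> E l} = (\<Prod>l<q. card (E l) / card T)"
    by (simp add: measure_def prod_nonneg)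
qed

text \<open>The exponent is the largest \<open>q\<close> for which intervals of length \<open>\<rho> ^ q\<close> are not shorter than \<open>r\<close>.\<close>
lemma power_nat_floor_ln_ratio:
  assumes "0 < \<rho>" "\<rho> < 1" "0 < r" "r \<le> (1::real)"
  shows "r \<le> \<rho> ^ nat \<lfloor>ln r / ln \<rho>\<rfloor>" and "ln r / ln \<rho> - 1 \<le> real (nat \<lfloor>ln r / ln \<rho>\<rfloor>)"
proof -
  have neg: "ln \<rho> < 0" "ln r \<le> 0" using assms by auto
  then have "0 \<le> ln r / ln \<rho>" by (simp add: divide_nonpos_neg)
  then have le: "real (nat \<lfloor>ln r / ln \<rho>\<rfloor>) \<le> ln r / ln \<rho>" by (simp add: of_nat_nat)
  have "ln r = ln r / ln \<rho> * ln \<rho>" using neg by simp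
  also have "\<dots> \<le> real (nat \<lfloor>ln r / ln \<rho>\<rfloor>) * ln \<rho>"
    using le neg by (intro mult_right_mono_neg) auto
  also have "\<dots> = ln (\<rho> ^ nat \<lfloor>ln r / ln \<rho>\<rfloor>)" using assms by (simp add: ln_realpow)
  finally show "r \<le> \<rho> ^ nat \<lfloor>ln r / ln \<rho>\<rfloor>" using assms by (subst (asm) ln_le_cancel_iff) auto
  show "ln r / ln \<rho> - 1 \<le> real (nat \<lfloor>ln r / ln \<rho>\<rfloor>)" by linarith
qed

lemma prod_card_cylinder_le:
  fixes k1 k2 k3 :: real
  assumes q: "q3 \<le> q2" "q2 \<le> q1" and nonneg: "\<And>l. 0 \<le> f l"
    and f3: "\<And>l. l < q3 \<Longrightarrow> f l \<le> exp (- k3)"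
    and f2: "\<And>l. q3 \<le> l \<Longrightarrow> l < q2 \<Longrightarrow> f l \<le> exp (- k2)"
    and f1: "\<And>l. q2 \<le> l \<Longrightarrow> l < q1 \<Longrightarrow> f l \<le> exp (- k1)"
  shows "(\<Prod>l<q1. f l) \<le> exp (- (real q1 * k1 + real q2 * (k2 - k1) + real q3 * (k3 - k2)))"
proof -
  define g where "g l = (if l < q3 then - k3 else if l < q2 then - k2 else - k1)" for l
  have "(\<Prod>l<q1. f l) \<le> (\<Prod>l<q1. exp (g l))"
    using nonneg f1 f2 f3 by (intro prod_mono) (auto simp: g_def)
  also have "\<dots> = exp (\<Sum>l<q1. g l)" by (simp add: exp_sum)
  also have "(\<Sum>l<q1. g l) = (\<Sum>l<q1. - k1 - (if l < q2 then k2 - k1 else 0) - (if l < q3 then k3 - k2 else 0))"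
    using q by (intro sum.cong) (auto simp: g_def)
  also have "\<dots> = (\<Sum>l<q1. - k1) - (\<Sum>l<q1. if l < q2 then k2 - k1 else 0) - (\<Sum>l<q1. if l < q3 then k3 - k2 else 0)"
    by (simp only: sum_subtractf)
  also have "(\<Sum>l<q1. if l < q2 then k2 - k1 else 0) = (\<Sum>l<q2. k2 - k1)"
    by (rule sum.mono_neutral_cong_right) (use q in auto)
  also have "(\<Sum>l<q1. if l < q3 then k3 - k2 else 0) = (\<Sum>l<q3. k3 - k2)"
    by (rule sum.mono_neutral_cong_right) (use q in auto)
  finally show ?thesis by (simp add: algebra_simps)
qed

context sponge
begin

text \<open>The numbers \<open>k1\<close>, \<open>k2\<close>, \<open>k3\<close> play the role of entropies per block of the words in \<open>i\<close>, in \<open>(i, j)\<close> and in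
  \<open>(i, j, k)\<close>. At scale \<open>r\<close> an approximate cube fixes \<open>q3\<close> full blocks, their projections to \<open>(i, j)\<close> up to block
  \<open>q2\<close>, and those to \<open>i\<close> up to block \<open>q1\<close>, so its mass is at most
  \<open>exp (- (q1 * k1 + q2 * (k2 - k1) + q3 * (k3 - k2)))\<close>. A set of diameter at most \<open>r\<close> meets
  at most \<open>4 ^ 3 = 64\<close> of these cubes.\<close>
lemma homogeneous_blocks_dim_ge:
  fixes T :: "(nat \<times> nat \<times> nat) list set" and \<rho>x \<rho>y \<rho>z k1 k2 k3 :: real
  assumes T: "finite T" "T \<noteq> {}" and "m > 0"
    and words: "\<And>w. w \<in> T \<Longrightarrow> length w = m \<and> set w \<subseteq> idx3 \<A>"
    and rx: "\<And>w. w \<in> T \<Longrightarrow> prod_list (map (rx S) w) = \<rho>x"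
    and ry: "\<And>w. w \<in> T \<Longrightarrow> prod_list (map (ry S) w) = \<rho>y"
    and rz: "\<And>w. w \<in> T \<Longrightarrow> prod_list (map (rz S) w) = \<rho>z"
    and \<rho>: "0 < \<rho>x" "\<rho>x \<le> \<rho>y" "\<rho>y \<le> \<rho>z" "\<rho>z < 1"
    and k: "0 \<le> k1" "k1 \<le> k2" "k2 \<le> k3"
    and card1: "\<And>w. w \<in> T \<Longrightarrow> card {w'\<in>T. map proj1 w' = map proj1 w} / card T \<le> exp (- k1)"
    and card2: "\<And>w. w \<in> T \<Longrightarrow> card {w'\<in>T. map proj2 w' = map proj2 w} / card T \<le> exp (- k2)"
    and card3: "1 / card T \<le> exp (- k3)"
  shows "ereal (k1 / - ln \<rho>z + (k2 - k1) / - ln \<rho>y + (k3 - k2) / - ln \<rho>x) \<le> hausdorff_dim (sponge_set \<A> S)"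
proof -
  define M where "M = PiM UNIV (\<lambda>_::nat. uniform_count_measure T)"
  define pt where "pt \<omega> = sponge_point S (flatten_blocks m \<omega>)" for \<omega>
  define D where "D = k1 / - ln \<rho>z + (k2 - k1) / - ln \<rho>y + (k3 - k2) / - ln \<rho>x"
  have prob: "prob_space M" unfolding M_def
    using T by (intro prob_space_PiM prob_space_uniform_count_measure)
  then interpret prob_space M .
  have space_T: "\<omega> b \<in> T" if "\<omega> \<in> space M" for \<omega> b
    using that by (auto simp: M_def space_PiM space_uniform_count_measure)
  have flat: "range (flatten_blocks m \<omega>) \<subseteq> idx3 \<A>" if "\<omega> \<in> space M" for \<omega>
    using words space_T[OF that] \<open>m > 0\<close> by (intro flatten_blocks_in) auto
  have ratio: "code_ratio (rx S) (flatten_blocks m \<omega>) (m * q) = \<rho>x ^ q"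
    "code_ratio (ry S) (flatten_blocks m \<omega>) (m * q) = \<rho>y ^ q"
    "code_ratio (rz S) (flatten_blocks m \<omega>) (m * q) = \<rho>z ^ q" if "\<omega> \<in> space M" for \<omega> q
    using words rx ry rz space_T[OF that] by (intro code_ratio_flatten_blocks; simp)+
  have "\<exists>C\<in>sets M. {\<omega>\<in>space M. pt \<omega> \<in> U} \<subseteq> C \<and> measure M C \<le> (64 * exp k3) * r powr D"
    if U: "bounded U" "diameter U \<le> r" "0 < r" "r \<le> 1" for U r
  proof (cases "{\<omega>\<in>space M. pt \<omega> \<in> U} = {}")
    case False
    then obtain \<omega>0 where \<omega>0: "\<omega>0 \<in> space M" "pt \<omega>0 \<in> U" by blast
    define v where "v = pt \<omega>0"
    define q1 where "q1 = nat \<lfloor>ln r / ln \<rho>z\<rfloor>"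
    define q2 where "q2 = nat \<lfloor>ln r / ln \<rho>y\<rfloor>"
    define q3 where "q3 = nat \<lfloor>ln r / ln \<rho>x\<rfloor>"
    have mono: "ln r / ln s \<le> ln r / ln t" if "0 < s" "s \<le> t" "t < 1" for s t :: real
    proof -
      have "ln s \<le> ln t" "ln t < 0" "ln r \<le> 0" using that U by auto
      then have "(- ln r) / (- ln s) \<le> (- ln r) / (- ln t)" by (intro divide_left_mono) (auto intro: mult_neg_neg)
      then show ?thesis by simp
    qed
    have q: "q3 \<le> q2" "q2 \<le> q1"
      unfolding q1_def q2_def q3_def using \<rho> by (auto intro!: nat_mono floor_mono mono)
    have size: "r \<le> \<rho>z ^ q1" "r \<le> \<rho>y ^ q2" "r \<le> \<rho>x ^ q3"
      unfolding q1_def q2_def q3_def using \<rho> U by (auto intro!: power_nat_floor_ln_ratio(1))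
    \<comment> \<open>The grid position of the interval selected in each coordinate, relative to the
      reference point \<open>v\<close>; equal positions will force the same approximate cube.\<close>
    define gx where "gx \<omega> = \<lfloor>(code_left (rx S) (ux S) (flatten_blocks m \<omega>) (m * q3) - v $ 1) / \<rho>x ^ q3\<rfloor>" for \<omega>
    define gy where "gy \<omega> = \<lfloor>(code_left (ry S) (uy S) (flatten_blocks m \<omega>) (m * q2) - v $ 2) / \<rho>y ^ q2\<rfloor>" for \<omega>
    define gz where "gz \<omega> = \<lfloor>(code_left (rz S) (uz S) (flatten_blocks m \<omega>) (m * q1) - v $ 3) / \<rho>z ^ q1\<rfloor>" for \<omega>
    define g where "g \<omega> = (gx \<omega>, gy \<omega>, gz \<omega>)" for \<omega>
    define P where "P = {\<omega>\<in>space M. pt \<omega> \<in> U}"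
    have close: "\<bar>pt \<omega> $ i - v $ i\<bar> \<le> r" if "\<omega> \<in> P" for \<omega> i
    proof -
      have "dist (pt \<omega>) v \<le> r"
        using diameter_bounded_bound[OF U(1), of "pt \<omega>" v] that \<omega>0 U(2) by (auto simp: P_def v_def)
      then show ?thesis using dist_vec_nth_le[of "pt \<omega>" i v] by (simp add: dist_real_def)
    qed
    have g_range: "g \<omega> \<in> {-2..1} \<times> {-2..1} \<times> {-2..1}" if "\<omega> \<in> P" for \<omega>
    proof -
      have \<omega>: "\<omega> \<in> space M" using that by (simp add: P_def)
      have "gx \<omega> \<in> {-2..1}" unfolding gx_def
        using close[OF that, of 1] size
        by (intro X.code_interval_offset[OF flat[OF \<omega>] ratio(1)[OF \<omega>]]) (simp add: pt_def sponge_point_def vector_3)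
      moreover have "gy \<omega> \<in> {-2..1}" unfolding gy_def
        using close[OF that, of 2] size
        by (intro Y.code_interval_offset[OF flat[OF \<omega>] ratio(2)[OF \<omega>]]) (simp add: pt_def sponge_point_def vector_3)
      moreover have "gz \<omega> \<in> {-2..1}" unfolding gz_def
        using close[OF that, of 3] size
        by (intro Z.code_interval_offset[OF flat[OF \<omega>] ratio(3)[OF \<omega>]]) (simp add: pt_def sponge_point_def vector_3)
      ultimately show ?thesis by (simp add: g_def)
    qed
    define E where "E \<omega> l = (if l < q3 then {\<omega> l} else if l < q2 then {w\<in>T. map proj2 w = map proj2 (\<omega> l)}
      else {w\<in>T. map proj1 w = map proj1 (\<omega> l)})" for \<omega> l
    define Cyl where "Cyl \<omega> = {\<omega>'\<in>space M. \<forall>l\<in>{..<q1}. \<omega>' l \<in> E \<omega> l}" for \<omega>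
    have Cyl_sets: "Cyl \<omega> \<in> sets M" and Cyl_measure: "measure M (Cyl \<omega>) \<le> exp k3 * r powr D" if "\<omega> \<in> space M" for \<omega>
    proof -
      have E: "E \<omega> l \<subseteq> T" for l using space_T[OF that] by (auto simp: E_def)
      show "Cyl \<omega> \<in> sets M" unfolding Cyl_def M_def
        by (rule measure_uniform_product_cylinder[OF T E])
      have "measure M (Cyl \<omega>) = (\<Prod>l<q1. card (E \<omega> l) / card T)" unfolding Cyl_def M_def
        by (rule measure_uniform_product_cylinder[OF T E])
      also have "\<dots> \<le> exp (- (real q1 * k1 + real q2 * (k2 - k1) + real q3 * (k3 - k2)))"
      proof (rule prod_card_cylinder_le[OF q])
        fix l
        show "card (E \<omega> l) / card T \<le> exp (- k3)" if "l < q3" using card3 that by (simp add: E_def)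
        show "card (E \<omega> l) / card T \<le> exp (- k2)" if "q3 \<le> l" "l < q2"
          using card2 that space_T[OF \<open>\<omega> \<in> space M\<close>] by (simp add: E_def)
        show "card (E \<omega> l) / card T \<le> exp (- k1)" if "q2 \<le> l" "l < q1"
          using card1 that space_T[OF \<open>\<omega> \<in> space M\<close>] q by (simp add: E_def)
      qed simp
      also have "\<dots> \<le> exp (k3 + D * ln r)"
      proof -
        have "k1 * (ln r / ln \<rho>z - 1) \<le> k1 * real q1" "(k2 - k1) * (ln r / ln \<rho>y - 1) \<le> (k2 - k1) * real q2"
          "(k3 - k2) * (ln r / ln \<rho>x - 1) \<le> (k3 - k2) * real q3"
          unfolding q1_def q2_def q3_def using \<rho> U k by (auto intro!: mult_left_mono power_nat_floor_ln_ratio(2))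
        then have "k1 * (ln r / ln \<rho>z) + (k2 - k1) * (ln r / ln \<rho>y) + (k3 - k2) * (ln r / ln \<rho>x) - k3
            \<le> real q1 * k1 + real q2 * (k2 - k1) + real q3 * (k3 - k2)"
          by (simp add: algebra_simps)
        moreover have "k1 * (ln r / ln \<rho>z) + (k2 - k1) * (ln r / ln \<rho>y) + (k3 - k2) * (ln r / ln \<rho>x) = - (D * ln r)"
          by (simp add: D_def algebra_simps)
        ultimately show ?thesis by simp
      qed
      also have "\<dots> = exp k3 * r powr D" using U by (simp add: exp_add powr_def)
      finally show "measure M (Cyl \<omega>) \<le> exp k3 * r powr D" .
    qed
    \<comment> \<open>The coordinates are treated in the order z, y, x: agreement of the coarser letters makes the
      finer intervals comparable, and the inequalities between \<open>q1\<close>, \<open>q2\<close>, \<open>q3\<close> provide it far enough.\<close>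
    have agree: "\<omega>' \<in> Cyl \<omega>" if "\<omega> \<in> P" "\<omega>' \<in> P" "g \<omega> = g \<omega>'" for \<omega> \<omega>'
    proof -
      let ?\<sigma> = "flatten_blocks m \<omega>" and ?\<tau> = "flatten_blocks m \<omega>'"
      have \<omega>: "\<omega> \<in> space M" "\<omega>' \<in> space M" using that by (auto simp: P_def)
      have in_idx: "?\<sigma> l \<in> idx3 \<A>" "?\<tau> l \<in> idx3 \<A>" for l using flat[OF \<omega>(1)] flat[OF \<omega>(2)] by auto
      have len: "length (\<omega> b) = m" "length (\<omega>' b) = m" for b
        using words space_T[OF \<omega>(1)] space_T[OF \<omega>(2)] by auto
      have pos: "0 < \<rho>x ^ q3" "0 < \<rho>y ^ q2" "0 < \<rho>z ^ q1" using \<rho> by auto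
      have g_eq: "gx \<omega> = gx \<omega>'" "gy \<omega> = gy \<omega>'" "gz \<omega> = gz \<omega>'" using that(3) by (auto simp: g_def)
      have 1: "proj1 (?\<sigma> l) = proj1 (?\<tau> l)" if "l < m * q1" for l
      proof (rule Z.code_close_imp_agree[OF flat[OF \<omega>(1)] flat[OF \<omega>(2)] _ _ _ _ _ that])
        show "\<rho>z ^ q1 \<le> code_ratio (rz S) ?\<sigma> (m * q1)" "\<rho>z ^ q1 \<le> code_ratio (rz S) ?\<tau> (m * q1)"
          using ratio(3) \<omega> by simp_all
        show "\<bar>code_left (rz S) (uz S) ?\<sigma> (m * q1) - code_left (rz S) (uz S) ?\<tau> (m * q1)\<bar> < \<rho>z ^ q1"
          using g_eq(3) pos(3) unfolding gz_def by (rule floor_div_eq_imp_close)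
      qed (use separated_z in_idx in \<open>auto simp: rz_def uz_def proj1_def split: prod.splits\<close>)
      have 2: "proj2 (?\<sigma> l) = proj2 (?\<tau> l)" if "l < m * q2" for l
      proof (rule Y.code_close_imp_agree[OF flat[OF \<omega>(1)] flat[OF \<omega>(2)] _ _ _ _ _ that])
        show "\<rho>y ^ q2 \<le> code_ratio (ry S) ?\<sigma> (m * q2)" "\<rho>y ^ q2 \<le> code_ratio (ry S) ?\<tau> (m * q2)"
          using ratio(2) \<omega> by simp_all
        show "\<bar>code_left (ry S) (uy S) ?\<sigma> (m * q2) - code_left (ry S) (uy S) ?\<tau> (m * q2)\<bar> < \<rho>y ^ q2"
          using g_eq(2) pos(2) unfolding gy_def by (rule floor_div_eq_imp_close)
        show "uy S (?\<sigma> l) + ry S (?\<sigma> l) \<le> uy S (?\<tau> l) \<or> uy S (?\<tau> l) + ry S (?\<tau> l) \<le> uy S (?\<sigma> l)"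
          if "l < m * q2" "proj2 (?\<sigma> l) \<noteq> proj2 (?\<tau> l)" for l
        proof -
          have "l < m * q1" using that(1) q(2) by (meson less_le_trans mult_le_mono2)
          then show ?thesis using 1 in_idx that(2) by (intro separated_y)
        qed
      qed (auto simp: ry_def uy_def proj2_def split: prod.splits)
      have 3: "?\<sigma> l = ?\<tau> l" if "l < m * q3" for l
      proof (rule X.code_close_imp_agree[where proj = "\<lambda>w. w", OF flat[OF \<omega>(1)] flat[OF \<omega>(2)] _ _ _ _ _ that])
        show "\<rho>x ^ q3 \<le> code_ratio (rx S) ?\<sigma> (m * q3)" "\<rho>x ^ q3 \<le> code_ratio (rx S) ?\<tau> (m * q3)"
          using ratio(1) \<omega> by simp_all
        show "\<bar>code_left (rx S) (ux S) ?\<sigma> (m * q3) - code_left (rx S) (ux S) ?\<tau> (m * q3)\<bar> < \<rho>x ^ q3"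
          using g_eq(1) pos(1) unfolding gx_def by (rule floor_div_eq_imp_close)
        show "ux S (?\<sigma> l) + rx S (?\<sigma> l) \<le> ux S (?\<tau> l) \<or> ux S (?\<tau> l) + rx S (?\<tau> l) \<le> ux S (?\<sigma> l)"
          if "l < m * q3" "?\<sigma> l \<noteq> ?\<tau> l" for l
        proof -
          have "l < m * q2" using that(1) q(1) by (meson less_le_trans mult_le_mono2)
          then show ?thesis using 2 in_idx that(2) by (intro separated_x)
        qed
      qed auto
      have "\<omega>' b \<in> E \<omega> b" if "b < q1" for b
      proof -
        have "map proj1 (\<omega> b) = map proj1 (\<omega>' b)"
          by (rule flatten_blocks_agree[OF len that]) (rule 1)
        moreover have "map proj2 (\<omega> b) = map proj2 (\<omega>' b)" if "b < q2"
          by (rule flatten_blocks_agree[OF len that]) (rule 2)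
        moreover have "\<omega> b = \<omega>' b" if "b < q3"
        proof -
          have "map (\<lambda>w. w) (\<omega> b) = map (\<lambda>w. w) (\<omega>' b)"
            by (rule flatten_blocks_agree[OF len that]) (rule 3)
          then show ?thesis by simp
        qed
        ultimately show ?thesis using space_T[OF \<omega>(2), of b] by (auto simp: E_def)
      qed
      then show ?thesis using \<omega> by (auto simp: Cyl_def)
    qed
    define rep where "rep = inv_into P g"
    have rep: "rep y \<in> P" "g (rep y) = y" if "y \<in> g ` P" for y
      using inv_into_into[OF that] f_inv_into_f[OF that] by (simp_all add: rep_def)
    have fin: "finite (g ` P)" and card_le: "card (g ` P) \<le> 64"
    proof -
      have sub: "g ` P \<subseteq> {-2..1} \<times> {-2..1} \<times> {-2..1}" using g_range by blast
      then show "finite (g ` P)" by (rule finite_subset) simp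
      show "card (g ` P) \<le> 64" using card_mono[OF _ sub] by (simp add: card_cartesian_product)
    qed
    have rep_space: "rep y \<in> space M" if "y \<in> g ` P" for y using rep[OF that] by (simp add: P_def)
    show ?thesis
    proof (intro bexI conjI)
      show "{\<omega>\<in>space M. pt \<omega> \<in> U} \<subseteq> (\<Union>y\<in>g ` P. Cyl (rep y))"
      proof
        fix \<omega> assume "\<omega> \<in> {\<omega>\<in>space M. pt \<omega> \<in> U}"
        then have "\<omega> \<in> P" by (simp add: P_def)
        then have "\<omega> \<in> Cyl (rep (g \<omega>))" using rep[of "g \<omega>"] by (intro agree) auto
        then show "\<omega> \<in> (\<Union>y\<in>g ` P. Cyl (rep y))" using \<open>\<omega> \<in> P\<close> by blast
      qed
      show "(\<Union>y\<in>g ` P. Cyl (rep y)) \<in> sets M"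
        using fin by (intro sets.finite_UN Cyl_sets rep_space)
      have "measure M (\<Union>y\<in>g ` P. Cyl (rep y)) \<le> (\<Sum>y\<in>g ` P. measure M (Cyl (rep y)))"
        using fin by (intro finite_measure_subadditive_finite) (auto intro: Cyl_sets rep_space)
      also have "\<dots> \<le> (\<Sum>y\<in>g ` P. exp k3 * r powr D)"
        by (intro sum_mono Cyl_measure rep_space)
      also have "\<dots> \<le> 64 * (exp k3 * r powr D)"
        unfolding sum_constant using card_le by (intro mult_right_mono) auto
      finally show "measure M (\<Union>y\<in>g ` P. Cyl (rep y)) \<le> (64 * exp k3) * r powr D" by (simp add: mult.assoc)
    qed
  qed (auto intro!: bexI[of _ "{}"])
  moreover have "pt \<omega> \<in> sponge_set \<A> S" if "\<omega> \<in> space M" for \<omega>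
    using flat[OF that] unfolding sponge_set_eq pt_def code_space_def by blast
  ultimately show ?thesis unfolding D_def[symmetric]
    by (intro mass_distribution_principle[OF prob, where X = pt and B = "64 * exp k3"]) auto
qed

end

section \<open>The value of VP is a lower bound\<close>

context sponge
begin

lemma ratio_x_bounds: "(i, j) \<in> idx2 \<A> \<Longrightarrow> k \<in> {1..num_k \<A> i j} \<Longrightarrow> 0 < ratio_x S i j k \<and> ratio_x S i j k < 1"
  using placement_x by (auto simp: ordered_placement_def)

lemma ratio_y_bounds: "(i, j) \<in> idx2 \<A> \<Longrightarrow> 0 < ratio_y S i j \<and> ratio_y S i j < 1"
  using placement_y by (auto simp: ordered_placement_def idx2_Sigma[OF valid])

lemma ratio_z_bounds: "i \<in> {1..num_i \<A>} \<Longrightarrow> 0 < ratio_z S i \<and> ratio_z S i < 1"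
  using placement_z by (auto simp: ordered_placement_def)

lemma x_pressure_pos: "(i, j) \<in> idx2 \<A> \<Longrightarrow> 0 < (\<Sum>k=1..num_k \<A> i j. ratio_x S i j k powr t)"
proof (rule sum_pos)
  assume ij: "(i, j) \<in> idx2 \<A>"
  show "{1..num_k \<A> i j} \<noteq> {}" using num_k_pos[OF ij] by (simp add: Suc_le_eq)
  show "0 < ratio_x S i j k powr t" if "k \<in> {1..num_k \<A> i j}" for k
    using ratio_x_bounds[OF ij that] by simp
qed simp

lemma x_pressure_strict_antimono:
  assumes "(i, j) \<in> idx2 \<A>" "s < t"
  shows "(\<Sum>k=1..num_k \<A> i j. ratio_x S i j k powr t) < (\<Sum>k=1..num_k \<A> i j. ratio_x S i j k powr s)"
proof (rule sum_strict_mono)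
  fix k assume "k \<in> {1..num_k \<A> i j}"
  then show "ratio_x S i j k powr t < ratio_x S i j k powr s"
    using ratio_x_bounds[OF assms(1), of k] assms(2) by (auto simp: powr_def)
qed (use num_k_pos[OF assms(1)] in \<open>auto simp: Suc_le_eq\<close>)

text \<open>The number \<open>t(p)\<close> is the zero of this function, which is strictly decreasing because all ratios are
  less than 1.\<close>
definition pressure :: "(nat \<Rightarrow> nat \<Rightarrow> real) \<Rightarrow> real \<Rightarrow> real" where
  "pressure p t = (\<Sum>(i, j)\<in>idx2 \<A>. p i j * ln (\<Sum>k=1..num_k \<A> i j. ratio_x S i j k powr t))"

context
  fixes p assumes p: "p \<in> prob_vectors \<A>"
begin

lemma p_nonneg: "(i, j) \<in> idx2 \<A> \<Longrightarrow> 0 \<le> p i j"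
  using p by (auto simp: prob_vectors_def)

lemma p_sum: "(\<Sum>(i, j)\<in>idx2 \<A>. p i j) = 1"
  using p by (auto simp: prob_vectors_def)

lemma exists_p_pos: "\<exists>(i, j)\<in>idx2 \<A>. 0 < p i j"
proof (rule ccontr)
  assume none: "\<not> (\<exists>(i, j)\<in>idx2 \<A>. 0 < p i j)"
  have "(\<Sum>(i, j)\<in>idx2 \<A>. p i j) = 0"
  proof (rule sum.neutral, clarify)
    fix i j assume "(i, j) \<in> idx2 \<A>"
    then show "p i j = 0" using none p_nonneg[of i j] by fastforce
  qed
  then show False using p_sum by simp
qed

lemma weighted_sum_neg:
  assumes "\<And>i j. (i, j) \<in> idx2 \<A> \<Longrightarrow> f i j < 0"
  shows "(\<Sum>(i, j)\<in>idx2 \<A>. p i j * f i j) < 0"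
proof -
  obtain i0 j0 where ij: "(i0, j0) \<in> idx2 \<A>" "0 < p i0 j0" using exists_p_pos by auto
  have "(\<Sum>(i, j)\<in>idx2 \<A>. p i j * f i j) < (\<Sum>(i, j)\<in>idx2 \<A>. 0)"
  proof (rule sum_strict_mono_ex1)
    show "\<forall>x\<in>idx2 \<A>. (case x of (i, j) \<Rightarrow> p i j * f i j) \<le> (case x of (i, j) \<Rightarrow> 0)"
    proof clarify
      fix i j assume "(i, j) \<in> idx2 \<A>"
      then show "p i j * f i j \<le> 0" using assms[of i j] p_nonneg[of i j] by (intro mult_nonneg_nonpos) auto
    qed
    show "\<exists>x\<in>idx2 \<A>. (case x of (i, j) \<Rightarrow> p i j * f i j) < (case x of (i, j) \<Rightarrow> 0)"
      using assms ij by (intro bexI[of _ "(i0, j0)"]) (auto intro: mult_pos_neg)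
  qed simp
  then show ?thesis by simp
qed

lemma pressure_strict_antimono: "s < t \<Longrightarrow> pressure p t < pressure p s"
proof -
  assume "s < t"
  have "(\<Sum>(i, j)\<in>idx2 \<A>. p i j * (ln (\<Sum>k=1..num_k \<A> i j. ratio_x S i j k powr t)
      - ln (\<Sum>k=1..num_k \<A> i j. ratio_x S i j k powr s))) < 0"
    using x_pressure_strict_antimono[OF _ \<open>s < t\<close>] x_pressure_pos by (intro weighted_sum_neg) simp
  then show ?thesis by (simp add: pressure_def case_prod_unfold right_diff_distrib sum_subtractf)
qed

lemma t_exponent: "t_exponent \<A> S p \<in> {0..1}" "pressure p (t_exponent \<A> S p) = 0"
proof -
  have "\<exists>t\<ge>0. t \<le> 1 \<and> pressure p t = 0"
  proof (rule IVT2')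
    show "pressure p 1 \<le> 0"
      unfolding pressure_def
    proof (intro sum_nonpos, clarify)
      fix i j assume ij: "(i, j) \<in> idx2 \<A>"
      have "(\<Sum>k=1..num_k \<A> i j. ratio_x S i j k powr 1) = (\<Sum>k=1..num_k \<A> i j. ratio_x S i j k)"
      proof (rule sum.cong[OF refl])
        show "ratio_x S i j k powr 1 = ratio_x S i j k" if "k \<in> {1..num_k \<A> i j}" for k
          using ratio_x_bounds[OF ij that] by simp
      qed
      then have "(\<Sum>k=1..num_k \<A> i j. ratio_x S i j k powr 1) \<le> 1"
        using placement_x[OF ij] by (simp add: ordered_placement_def)
      then show "p i j * ln (\<Sum>k=1..num_k \<A> i j. ratio_x S i j k powr 1) \<le> 0"
        using p_nonneg[OF ij] x_pressure_pos[OF ij, of 1] by (intro mult_nonneg_nonpos) auto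
    qed
    show "0 \<le> pressure p 0"
      unfolding pressure_def
    proof (intro sum_nonneg, clarify)
      fix i j assume ij: "(i, j) \<in> idx2 \<A>"
      have "(\<Sum>k=1..num_k \<A> i j. ratio_x S i j k powr 0) = (\<Sum>k=1..num_k \<A> i j. 1)"
      proof (rule sum.cong[OF refl])
        show "ratio_x S i j k powr 0 = 1" if "k \<in> {1..num_k \<A> i j}" for k
          using ratio_x_bounds[OF ij that] by simp
      qed
      then show "0 \<le> p i j * ln (\<Sum>k=1..num_k \<A> i j. ratio_x S i j k powr 0)"
        using p_nonneg[OF ij] num_k_pos[OF ij] by simp
    qed
    show "continuous_on {0..1} (pressure p)"
      unfolding pressure_def case_prod_unfold
    proof (intro continuous_intros ballI)
      fix x s assume x: "x \<in> idx2 \<A>"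
      show "ratio_x S (fst x) (snd x) k \<noteq> 0" if "k \<in> {1..num_k \<A> (fst x) (snd x)}" for k
        using ratio_x_bounds[of "fst x" "snd x" k] x that by auto
      show "(\<Sum>k=1..num_k \<A> (fst x) (snd x). ratio_x S (fst x) (snd x) k powr s) \<noteq> 0"
        using x_pressure_pos[of "fst x" "snd x" s] x by auto
    qed
  qed simp
  then obtain t where t: "t \<in> {0..1}" "pressure p t = 0" by auto
  moreover have "t' = t" if "pressure p t' = 0" for t'
    using pressure_strict_antimono[of t t'] pressure_strict_antimono[of t' t] t that
    by (metis less_irrefl linorder_neqE)
  ultimately have "t_exponent \<A> S p = t"
    unfolding t_exponent_def pressure_def[symmetric] by (intro the_equality) blast+
  with t show "t_exponent \<A> S p \<in> {0..1}" "pressure p (t_exponent \<A> S p) = 0" by auto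
qed

lemma t_exponent_ge: "0 \<le> pressure p s \<Longrightarrow> s \<le> t_exponent \<A> S p"
  using pressure_strict_antimono[of "t_exponent \<A> S p" s] t_exponent(2) by (cases "s \<le> t_exponent \<A> S p") auto

text \<open>Among all ways of distributing \<open>p\<^sub>i\<^sub>j\<close> over \<open>k\<close>, this one maximises the ratio of conditional entropy to
  Lyapunov exponent in direction \<open>x\<close>.\<close>
definition fibre_measure :: "nat \<times> nat \<times> nat \<Rightarrow> real" where
  "fibre_measure = (\<lambda>(i, j, k). p i j * (ratio_x S i j k powr t_exponent \<A> S p /
     (\<Sum>k=1..num_k \<A> i j. ratio_x S i j k powr t_exponent \<A> S p)))"

lemma fibre_measure_nonneg: "w \<in> idx3 \<A> \<Longrightarrow> 0 \<le> fibre_measure w"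
  using p_nonneg x_pressure_pos
  by (auto simp: fibre_measure_def idx3_iff_idx2 intro!: mult_nonneg_nonneg divide_nonneg_pos split: prod.splits)

lemma sum_fibre_measure_proj2:
  "(\<Sum>w\<in>idx3 \<A>. fibre_measure w * f (proj2 w)) = (\<Sum>(i, j)\<in>idx2 \<A>. p i j * f (i, j))"
proof -
  have "(\<Sum>k=1..num_k \<A> i j. fibre_measure (i, j, k) * f (i, j)) = p i j * f (i, j)" if "(i, j) \<in> idx2 \<A>" for i j
  proof -
    have "(\<Sum>k=1..num_k \<A> i j. fibre_measure (i, j, k) * f (i, j)) =
        p i j * f (i, j) * ((\<Sum>k=1..num_k \<A> i j. ratio_x S i j k powr t_exponent \<A> S p) /
          (\<Sum>k=1..num_k \<A> i j. ratio_x S i j k powr t_exponent \<A> S p))"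
      unfolding sum_divide_distrib sum_distrib_left by (simp add: fibre_measure_def mult_ac)
    then show ?thesis using x_pressure_pos[OF that, of "t_exponent \<A> S p"] by simp
  qed
  then show ?thesis unfolding sum_idx3 by (intro sum.cong) (auto simp: proj2_def)
qed

lemma sum_fibre_measure_proj1:
  "(\<Sum>w\<in>idx3 \<A>. fibre_measure w * f (proj1 w)) = (\<Sum>i=1..num_i \<A>. marginal \<A> p i * f i)"
proof -
  have "(\<Sum>w\<in>idx3 \<A>. fibre_measure w * f (proj1 w)) = (\<Sum>w\<in>idx3 \<A>. fibre_measure w * (f \<circ> fst) (proj2 w))"
    by (intro sum.cong) (auto simp: proj1_def proj2_def split: prod.splits)
  also have "\<dots> = (\<Sum>i=1..num_i \<A>. \<Sum>j=1..num_j \<A> i. p i j * f i)"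
    unfolding sum_fibre_measure_proj2 sum_idx2 by simp
  finally show ?thesis by (simp add: marginal_def sum_distrib_right)
qed

lemma fibre_measure_proj2:
  assumes "(i, j) \<in> idx2 \<A>"
  shows "(\<Sum>w | w \<in> idx3 \<A> \<and> proj2 w = (i, j). fibre_measure w) = p i j"
proof -
  have "(\<Sum>w | w \<in> idx3 \<A> \<and> proj2 w = (i, j). fibre_measure w) =
      (\<Sum>w\<in>idx3 \<A>. fibre_measure w * (if proj2 w = (i, j) then 1 else 0))"
    by (subst sum.inter_filter) (auto intro!: sum.cong)
  also have "\<dots> = (\<Sum>x\<in>idx2 \<A>. if x = (i, j) then p i j else 0)"
    unfolding sum_fibre_measure_proj2[of "\<lambda>x. if x = (i, j) then 1 else 0"] by (intro sum.cong) (auto split: if_splits)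
  finally show ?thesis using assms by simp
qed

lemma fibre_measure_proj1:
  assumes "i \<in> {1..num_i \<A>}"
  shows "(\<Sum>w | w \<in> idx3 \<A> \<and> proj1 w = i. fibre_measure w) = marginal \<A> p i"
proof -
  have "(\<Sum>w | w \<in> idx3 \<A> \<and> proj1 w = i. fibre_measure w) =
      (\<Sum>w\<in>idx3 \<A>. fibre_measure w * (if proj1 w = i then 1 else 0))"
    by (subst sum.inter_filter) (auto intro!: sum.cong)
  also have "\<dots> = (\<Sum>i'=1..num_i \<A>. if i' = i then marginal \<A> p i else 0)"
    unfolding sum_fibre_measure_proj1[of "\<lambda>i'. if i' = i then 1 else 0"] by (intro sum.cong) (auto split: if_splits)
  finally show ?thesis using assms by simp
qed

lemma fibre_measure_sum: "(\<Sum>w\<in>idx3 \<A>. fibre_measure w) = 1"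
  using sum_fibre_measure_proj2[of "\<lambda>_. 1"] p_sum by simp

lemma marginal_sum: "(\<Sum>i=1..num_i \<A>. marginal \<A> p i) = 1"
  using p_sum unfolding sum_idx2 marginal_def .

text \<open>The normalising sums contribute \<open>pressure p (t(p)) = 0\<close>, so in direction \<open>x\<close> the ratio of conditional
  entropy to Lyapunov exponent is exactly \<open>t(p)\<close>.\<close>
lemma fibre_entropy:
  "(\<Sum>w\<in>idx3 \<A>. fibre_measure w * ln (fibre_measure w)) =
    (\<Sum>(i, j)\<in>idx2 \<A>. p i j * ln (p i j)) + t_exponent \<A> S p * (\<Sum>w\<in>idx3 \<A>. fibre_measure w * ln (rx S w))"
proof -
  let ?t = "t_exponent \<A> S p"
  define P where "P = (\<lambda>(i, j). \<Sum>k=1..num_k \<A> i j. ratio_x S i j k powr ?t)"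
  have "fibre_measure w * ln (fibre_measure w) =
      fibre_measure w * ln (case_prod p (proj2 w)) + ?t * (fibre_measure w * ln (rx S w)) - fibre_measure w * ln (P (proj2 w))"
    if "w \<in> idx3 \<A>" for w
  proof -
    obtain i j k where w: "w = (i, j, k)" by (cases w)
    have ij: "(i, j) \<in> idx2 \<A>" "k \<in> {1..num_k \<A> i j}" using that by (auto simp: w idx3_iff_idx2)
    have pos: "0 < ratio_x S i j k" "0 < P (i, j)" using ratio_x_bounds[OF ij] x_pressure_pos[OF ij(1)] by (auto simp: P_def)
    have eq: "fibre_measure w = p i j * (ratio_x S i j k powr ?t / P (i, j))" by (simp add: fibre_measure_def w P_def)
    show ?thesis
    proof (cases "p i j = 0")
      case True
      then show ?thesis by (simp add: eq)
    next
      case False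
      then have "0 < p i j" using p_nonneg[OF ij(1)] by simp
      then have l: "ln (fibre_measure w) = ln (p i j) + (?t * ln (ratio_x S i j k) - ln (P (i, j)))"
        unfolding eq using pos by (simp add: ln_mult_pos ln_div ln_powr)
      show ?thesis unfolding l by (simp add: w proj2_def rx_def algebra_simps)
    qed
  qed
  then have "(\<Sum>w\<in>idx3 \<A>. fibre_measure w * ln (fibre_measure w)) =
      (\<Sum>w\<in>idx3 \<A>. fibre_measure w * ln (case_prod p (proj2 w))) + ?t * (\<Sum>w\<in>idx3 \<A>. fibre_measure w * ln (rx S w))
      - (\<Sum>w\<in>idx3 \<A>. fibre_measure w * ln (P (proj2 w)))"
    by (simp add: sum.distrib sum_subtractf sum_distrib_left)
  also have "(\<Sum>w\<in>idx3 \<A>. fibre_measure w * ln (P (proj2 w))) = pressure p ?t"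
    using sum_fibre_measure_proj2[of "\<lambda>x. ln (P x)"] by (simp add: P_def pressure_def)
  also have "(\<Sum>w\<in>idx3 \<A>. fibre_measure w * ln (case_prod p (proj2 w))) = (\<Sum>(i, j)\<in>idx2 \<A>. p i j * ln (p i j))"
    using sum_fibre_measure_proj2[of "\<lambda>x. ln (case_prod p x)"] by simp
  finally show ?thesis using t_exponent(2) by simp
qed

end

text \<open>The letters of a block: letter \<open>w\<close> occurs \<open>N * q w\<close> times, rounded down. The block length is thus only
  asymptotic to \<open>N\<close>.\<close>
definition type_multiset :: "(nat \<times> nat \<times> nat \<Rightarrow> real) \<Rightarrow> nat \<Rightarrow> (nat \<times> nat \<times> nat) multiset" where
  "type_multiset q N = (\<Sum>w\<in>idx3 \<A>. replicate_mset (nat \<lfloor>real N * q w\<rfloor>) w)"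

lemma count_type_multiset: "count (type_multiset q N) w = (if w \<in> idx3 \<A> then nat \<lfloor>real N * q w\<rfloor> else 0)"
  unfolding type_multiset_def count_sum by simp

lemma set_type_multiset: "set_mset (type_multiset q N) \<subseteq> idx3 \<A>"
  using count_type_multiset[of q N] by (metis not_in_iff subsetI)

lemma prod_type_multiset:
  "prod_mset (image_mset f (type_multiset q N)) = (\<Prod>w\<in>idx3 \<A>. f w ^ count (type_multiset q N) w)"
  unfolding image_prod_mset_multiplicity
  by (rule prod.mono_neutral_left) (use set_type_multiset in \<open>auto simp: not_in_iff\<close>)

lemma count_type_multiset_tendsto:
  assumes "w \<in> idx3 \<A>" "0 \<le> q w"
  shows "(\<lambda>N. real (count (type_multiset q N) w) / N) \<longlonglongrightarrow> q w"
proof -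
  have "(\<lambda>N. real (nat \<lfloor>real N * q w\<rfloor>) / real N) \<longlonglongrightarrow> q w"
  proof (rule tendsto_sandwich[where f="\<lambda>N. q w - 1 / real N" and h="\<lambda>_. q w"])
    show "(\<lambda>N. q w - 1 / real N) \<longlonglongrightarrow> q w" by real_asymp
    show "\<forall>\<^sub>F N in sequentially. q w - 1 / real N \<le> real (nat \<lfloor>real N * q w\<rfloor>) / real N"
      using eventually_gt_at_top[of 0]
    proof eventually_elim
      case (elim N)
      have "real N * q w - 1 \<le> real (nat \<lfloor>real N * q w\<rfloor>)" by linarith
      then have "(real N * q w - 1) / real N \<le> real (nat \<lfloor>real N * q w\<rfloor>) / real N" by (rule divide_right_mono) simp
      then show ?case using elim by (simp add: diff_divide_distrib)
    qed
    show "\<forall>\<^sub>F N in sequentially. real (nat \<lfloor>real N * q w\<rfloor>) / real N \<le> q w"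
      using eventually_gt_at_top[of 0]
    proof eventually_elim
      case (elim N)
      have "real (nat \<lfloor>real N * q w\<rfloor>) \<le> real N * q w" using assms(2) by simp
      then show ?case using elim by (simp add: divide_le_eq mult.commute)
    qed
  qed simp
  then show ?thesis using assms(1) by (simp add: count_type_multiset)
qed

lemma count_image_type_multiset_tendsto:
  assumes "\<And>w. w \<in> idx3 \<A> \<Longrightarrow> 0 \<le> q w"
  shows "(\<lambda>N. real (count (image_mset f (type_multiset q N)) y) / N) \<longlonglongrightarrow> (\<Sum>w | w \<in> idx3 \<A> \<and> f w = y. q w)"
proof -
  have "count (image_mset f (type_multiset q N)) y = (\<Sum>w | w \<in> idx3 \<A> \<and> f w = y. count (type_multiset q N) w)" for N
    unfolding count_image_mset'
    by (rule sum.mono_neutral_left) (use set_type_multiset in \<open>auto simp: not_in_iff\<close>)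
  then show ?thesis
    using count_type_multiset_tendsto assms by (auto simp: sum_divide_distrib intro!: tendsto_sum)
qed

lemma ln_prod_type_multiset_tendsto:
  assumes "\<And>w. w \<in> idx3 \<A> \<Longrightarrow> 0 \<le> q w" "\<And>w. w \<in> idx3 \<A> \<Longrightarrow> 0 < f w"
  shows "(\<lambda>N. ln (prod_mset (image_mset f (type_multiset q N))) / N) \<longlonglongrightarrow> (\<Sum>w\<in>idx3 \<A>. q w * ln (f w))"
proof -
  have eq: "ln (prod_mset (image_mset f (type_multiset q N))) / N =
      (\<Sum>w\<in>idx3 \<A>. real (count (type_multiset q N) w) / N * ln (f w))" for N :: nat
  proof -
    have nz: "f w \<noteq> 0" if "w \<in> idx3 \<A>" for w using assms(2)[OF that] by simp
    have "ln (prod_mset (image_mset f (type_multiset q N))) = (\<Sum>w\<in>idx3 \<A>. ln (f w ^ count (type_multiset q N) w))"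
      unfolding prod_type_multiset using nz by (intro ln_prod) simp_all
    also have "\<dots> = (\<Sum>w\<in>idx3 \<A>. real (count (type_multiset q N) w) * ln (f w))"
      by (simp add: ln_realpow)
    finally show ?thesis by (simp add: sum_divide_distrib)
  qed
  show ?thesis
    unfolding eq by (intro tendsto_sum tendsto_mult tendsto_const count_type_multiset_tendsto assms(1))
qed

text \<open>For fixed \<open>N\<close> the blocks are all rearrangements of \<open>type_multiset q N\<close>; they are homogeneous, and dividing
  numerators and denominators of the resulting dimension bound by \<open>N\<close> gives entropies and
  Lyapunov exponents in the limit.\<close>
lemma VP_value_le_dim:
  assumes p: "p \<in> prob_vectors \<A>"
  shows "ereal (lambda1 \<A> S p + lambda2 \<A> S p + t_exponent \<A> S p) \<le> hausdorff_dim (sponge_set \<A> S)"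
proof -
  define q where "q = fibre_measure p"
  have q_nonneg: "0 \<le> q w" if "w \<in> idx3 \<A>" for w using fibre_measure_nonneg[OF p that] by (simp add: q_def)
  define A where "A N = type_multiset q N" for N
  define k1 where "k1 N = ln (card (permutations_of_multiset (image_mset proj1 (A N))))" for N
  define k2 where "k2 N = ln (card (permutations_of_multiset (image_mset proj2 (A N))))" for N
  define k3 where "k3 N = ln (card (permutations_of_multiset (A N)))" for N
  define \<rho> where "\<rho> r N = prod_mset (image_mset r (A N))" for r :: "nat \<times> nat \<times> nat \<Rightarrow> real" and N
  define lyap where "lyap r = - (\<Sum>w\<in>idx3 \<A>. q w * ln (r w))" for r :: "nat \<times> nat \<times> nat \<Rightarrow> real"
  define h1 where "h1 = - (\<Sum>i=1..num_i \<A>. marginal \<A> p i * ln (marginal \<A> p i))"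
  define h2 where "h2 = - (\<Sum>(i, j)\<in>idx2 \<A>. p i j * ln (p i j))"
  define h3 where "h3 = - (\<Sum>w\<in>idx3 \<A>. q w * ln (q w))"
  have k1_lim: "(\<lambda>N. k1 N / N) \<longlonglongrightarrow> h1"
    unfolding k1_def h1_def
  proof (rule ln_card_permutations_asymptotic)
    show "set_mset (image_mset proj1 (A N)) \<subseteq> {1..num_i \<A>}" for N
      using set_type_multiset[of q N] by (force simp: A_def proj1_def idx3_def)
    show "(\<lambda>N. real (count (image_mset proj1 (A N)) i) / N) \<longlonglongrightarrow> marginal \<A> p i" if "i \<in> {1..num_i \<A>}" for i
      using count_image_type_multiset_tendsto[of q proj1 i] fibre_measure_proj1[OF p that] q_nonneg
      unfolding A_def q_def by simp
  qed (use marginal_sum[OF p] in simp_all)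
  have k2_lim: "(\<lambda>N. k2 N / N) \<longlonglongrightarrow> h2"
  proof -
    have "(\<lambda>N. k2 N / N) \<longlonglongrightarrow> - (\<Sum>x\<in>idx2 \<A>. case_prod p x * ln (case_prod p x))"
      unfolding k2_def
    proof (rule ln_card_permutations_asymptotic)
      show "set_mset (image_mset proj2 (A N)) \<subseteq> idx2 \<A>" for N
        using set_type_multiset[of q N] by (auto simp: A_def proj2_def idx2_def)
      show "(\<lambda>N. real (count (image_mset proj2 (A N)) x) / N) \<longlonglongrightarrow> case_prod p x" if "x \<in> idx2 \<A>" for x
        using count_image_type_multiset_tendsto[of q proj2 x] fibre_measure_proj2[OF p, of "fst x" "snd x"] q_nonneg that
        unfolding A_def q_def by (simp add: case_prod_unfold)
    qed (use p_sum[OF p] in simp_all)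
    then show ?thesis by (simp add: h2_def case_prod_unfold)
  qed
  have k3_lim: "(\<lambda>N. k3 N / N) \<longlonglongrightarrow> h3"
    unfolding k3_def h3_def
  proof (rule ln_card_permutations_asymptotic)
    show "set_mset (A N) \<subseteq> idx3 \<A>" for N using set_type_multiset[of q N] by (simp add: A_def)
    show "(\<lambda>N. real (count (A N) w) / N) \<longlonglongrightarrow> q w" if "w \<in> idx3 \<A>" for w
      using count_type_multiset_tendsto[of w q] q_nonneg that unfolding A_def by simp
  qed (use fibre_measure_sum[OF p] in \<open>simp_all add: q_def\<close>)
  have k_order: "0 \<le> k1 N" "k1 N \<le> k2 N" "k2 N \<le> k3 N" for N
  proof -
    show "0 \<le> k1 N" using card_permutations_of_multiset_pos[of "image_mset proj1 (A N)"] by (simp add: k1_def Suc_le_eq)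
    have "image_mset proj1 (A N) = image_mset fst (image_mset proj2 (A N))"
      by (simp add: multiset.map_comp comp_def proj1_def proj2_def case_prod_unfold)
    then have "card (permutations_of_multiset (image_mset proj1 (A N))) \<le> card (permutations_of_multiset (image_mset proj2 (A N)))"
      by (simp only: permutations_of_multiset_image[of fst]) (rule card_image_le, simp)
    then show "k1 N \<le> k2 N" using card_permutations_of_multiset_pos[of "image_mset proj1 (A N)"] by (simp add: k1_def k2_def)
    have "card (permutations_of_multiset (image_mset proj2 (A N))) \<le> card (permutations_of_multiset (A N))"
      unfolding permutations_of_multiset_image by (rule card_image_le) simp
    then show "k2 N \<le> k3 N" using card_permutations_of_multiset_pos[of "image_mset proj2 (A N)"] by (simp add: k2_def k3_def)
  qed
  have \<rho>_pos: "0 < \<rho> r N" if "\<And>w. w \<in> idx3 \<A> \<Longrightarrow> 0 < r w" for r N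
    unfolding \<rho>_def A_def prod_type_multiset using that by (intro prod_pos) auto
  have \<rho>_mono: "\<rho> r N \<le> \<rho> r' N" if "\<And>w. w \<in> idx3 \<A> \<Longrightarrow> 0 < r w" "\<And>w. w \<in> idx3 \<A> \<Longrightarrow> r w \<le> r' w" for r r' N
    unfolding \<rho>_def A_def prod_type_multiset using that by (intro prod_mono) (simp add: power_mono less_imp_le)
  have \<rho>_lim: "(\<lambda>N. - ln (\<rho> r N) / N) \<longlonglongrightarrow> lyap r" if "\<And>w. w \<in> idx3 \<A> \<Longrightarrow> 0 < r w" for r
    using tendsto_minus[OF ln_prod_type_multiset_tendsto[of q r, OF q_nonneg that]] unfolding \<rho>_def A_def lyap_def by simp
  have lyap_pos: "0 < lyap r" if "\<And>w. w \<in> idx3 \<A> \<Longrightarrow> 0 < r w" "\<And>w. w \<in> idx3 \<A> \<Longrightarrow> r w < 1" for r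
  proof -
    have "\<exists>w\<in>idx3 \<A>. 0 < q w"
    proof (rule ccontr)
      assume "\<not> ?thesis"
      then have "(\<Sum>w\<in>idx3 \<A>. q w) = (\<Sum>w\<in>idx3 \<A>. 0)" using q_nonneg by (intro sum.cong) force+
      then show False using fibre_measure_sum[OF p] by (simp add: q_def)
    qed
    then obtain w where w: "w \<in> idx3 \<A>" "0 < q w" by blast
    have "0 < (\<Sum>w\<in>idx3 \<A>. q w * - ln (r w))"
    proof (rule sum_pos2[OF finite_idx3 w(1)])
      show "0 < q w * - ln (r w)" using w that by (intro mult_pos_pos) auto
      show "0 \<le> q w * - ln (r w)" if "w \<in> idx3 \<A>" for w
        using q_nonneg \<open>\<And>w. w \<in> idx3 \<A> \<Longrightarrow> 0 < r w\<close>[of w] \<open>\<And>w. w \<in> idx3 \<A> \<Longrightarrow> r w < 1\<close>[of w] that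
        by (intro mult_nonneg_nonneg) auto
    qed
    then show ?thesis by (simp add: lyap_def sum_negf)
  qed
  define D where "D N = k1 N / - ln (\<rho> (rz S) N) + (k2 N - k1 N) / - ln (\<rho> (ry S) N) + (k3 N - k2 N) / - ln (\<rho> (rx S) N)" for N
  have D_le: "ereal (D N) \<le> hausdorff_dim (sponge_set \<A> S)" if "\<rho> (rz S) N < 1" for N
    unfolding D_def
  proof (rule homogeneous_blocks_dim_ge)
    define T where "T = permutations_of_multiset (A N)"
    have mset_T: "mset w = A N" if "w \<in> T" for w using that by (simp add: T_def permutations_of_multiset_def)
    show "finite T" "T \<noteq> {}" by (simp_all add: T_def permutations_of_multiset_nonempty)
    show "0 < size (A N)"
    proof (rule ccontr)
      assume "\<not> 0 < size (A N)"
      then have "\<rho> (rz S) N = 1" by (simp add: \<rho>_def)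
      then show False using that by simp
    qed
    show "length w = size (A N) \<and> set w \<subseteq> idx3 \<A>" if "w \<in> T" for w
      using mset_T[OF that] set_type_multiset[of q N] by (metis A_def set_mset_mset size_mset)
    show "prod_list (map (rx S) w) = \<rho> (rx S) N" "prod_list (map (ry S) w) = \<rho> (ry S) N"
      "prod_list (map (rz S) w) = \<rho> (rz S) N" if "w \<in> T" for w
      unfolding \<rho>_def mset_T[OF that, symmetric] by (simp_all add: prod_mset_prod_list[symmetric])
    show "0 < \<rho> (rx S) N" "\<rho> (rx S) N \<le> \<rho> (ry S) N" "\<rho> (ry S) N \<le> \<rho> (rz S) N"
      using \<rho>_pos[of "rx S"] \<rho>_mono[of "rx S" "ry S"] \<rho>_mono[of "ry S" "rz S"] X.ratio_pos Y.ratio_pos ratio_order by auto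
    show "0 \<le> k1 N" "k1 N \<le> k2 N" "k2 N \<le> k3 N" by (rule k_order)+
    show "card {w'\<in>T. map proj1 w' = map proj1 w} / card T \<le> exp (- k1 N)"
      "card {w'\<in>T. map proj2 w' = map proj2 w} / card T \<le> exp (- k2 N)" if "w \<in> T" for w
      unfolding k1_def k2_def T_def by (rule permutations_of_multiset_fibre_fraction, use that in \<open>simp add: T_def\<close>)+
    show "1 / card T \<le> exp (- k3 N)"
      using card_permutations_of_multiset_pos[of "A N"] by (simp add: k3_def T_def exp_minus divide_inverse)
  qed (use that in simp)
  have "(\<lambda>N. (k1 N / N) / (- ln (\<rho> (rz S) N) / N) + (k2 N / N - k1 N / N) / (- ln (\<rho> (ry S) N) / N)
      + (k3 N / N - k2 N / N) / (- ln (\<rho> (rx S) N) / N)) \<longlonglongrightarrow> h1 / lyap (rz S) + (h2 - h1) / lyap (ry S) + (h3 - h2) / lyap (rx S)"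
    using lyap_pos[of "rx S"] lyap_pos[of "ry S"] lyap_pos[of "rz S"]
      X.ratio_pos X.ratio_less_1 Y.ratio_pos Y.ratio_less_1 Z.ratio_pos Z.ratio_less_1
    by (intro tendsto_intros k1_lim k2_lim k3_lim \<rho>_lim) (auto simp: less_imp_neq[symmetric])
  moreover have "\<forall>\<^sub>F N in sequentially. (k1 N / N) / (- ln (\<rho> (rz S) N) / N) + (k2 N / N - k1 N / N) / (- ln (\<rho> (ry S) N) / N)
      + (k3 N / N - k2 N / N) / (- ln (\<rho> (rx S) N) / N) = D N"
    using eventually_gt_at_top[of 0]
    by eventually_elim (simp add: D_def diff_divide_distrib[symmetric])
  ultimately have D_lim: "D \<longlonglongrightarrow> h1 / lyap (rz S) + (h2 - h1) / lyap (ry S) + (h3 - h2) / lyap (rx S)"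
    by (rule Lim_transform_eventually)
  \<comment> \<open>For small \<open>N\<close> the block may be empty, with ratio 1.\<close>
  have ev: "\<forall>\<^sub>F N in sequentially. \<rho> (rz S) N < 1"
  proof -
    have "\<forall>\<^sub>F N in sequentially. 0 < - ln (\<rho> (rz S) N) / N"
      using \<rho>_lim[of "rz S"] lyap_pos[of "rz S"] Z.ratio_pos Z.ratio_less_1 by (intro order_tendstoD(1)) auto
    then show ?thesis
    proof eventually_elim
      case (elim N)
      then have "ln (\<rho> (rz S) N) < 0" by (auto simp: zero_less_divide_iff divide_less_0_iff)
      then show ?case using \<rho>_pos[of "rz S" N] Z.ratio_pos by simp
    qed
  qed
  have "ereal (h1 / lyap (rz S) + (h2 - h1) / lyap (ry S) + (h3 - h2) / lyap (rx S)) \<le> hausdorff_dim (sponge_set \<A> S)"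
  proof (rule tendsto_upperbound)
    show "(\<lambda>N. ereal (D N)) \<longlonglongrightarrow> ereal (h1 / lyap (rz S) + (h2 - h1) / lyap (ry S) + (h3 - h2) / lyap (rx S))"
      using D_lim by (rule tendsto_ereal)
    show "\<forall>\<^sub>F N in sequentially. ereal (D N) \<le> hausdorff_dim (sponge_set \<A> S)"
      using ev by eventually_elim (rule D_le)
  qed simp
  moreover have "h1 / lyap (rz S) = lambda1 \<A> S p"
  proof -
    have "lyap (rz S) = - (\<Sum>i=1..num_i \<A>. marginal \<A> p i * ln (ratio_z S i))"
      using sum_fibre_measure_proj1[OF p, of "\<lambda>i. ln (ratio_z S i)"]
      by (simp add: lyap_def q_def rz_def proj1_def case_prod_unfold)
    then show ?thesis by (simp add: h1_def lambda1_def)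
  qed
  moreover have "(h2 - h1) / lyap (ry S) = lambda2 \<A> S p"
  proof -
    have "(\<Sum>w\<in>idx3 \<A>. q w * ln (ry S w)) = (\<Sum>(i, j)\<in>idx2 \<A>. p i j * ln (ratio_y S i j))"
      using sum_fibre_measure_proj2[OF p, of "\<lambda>(i, j). ln (ratio_y S i j)"]
      by (simp add: q_def ry_def proj2_def case_prod_unfold)
    then show ?thesis
      unfolding lyap_def lambda2_def h1_def h2_def
      using minus_divide_divide[of "(\<Sum>(i, j)\<in>idx2 \<A>. p i j * ln (p i j)) - (\<Sum>i=1..num_i \<A>. marginal \<A> p i * ln (marginal \<A> p i))"]
      by simp
  qed
  moreover have "(h3 - h2) / lyap (rx S) = t_exponent \<A> S p"
  proof -
    have "h3 - h2 = t_exponent \<A> S p * lyap (rx S)"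
      using fibre_entropy[OF p] by (simp add: h3_def h2_def lyap_def q_def)
    then show ?thesis using lyap_pos[of "rx S"] X.ratio_pos X.ratio_less_1 by simp
  qed
  ultimately show ?thesis by simp
qed

end

section \<open>Logarithmic averages\<close>

lemma sum_telescope_reciprocals:
  assumes "0 < k" "k \<le> M + 1"
  shows "(\<Sum>n=k..M. 1 / (real n * (real n + 1))) = 1 / real k - 1 / (real M + 1)"
proof -
  have "(\<Sum>n=k..M. 1 / (real n * (real n + 1))) = 1 / real k - 1 / (real M + 1)" if "k \<le> M"
    using that
  proof (induction M rule: dec_induct)
    case base
    then show ?case using assms by (simp add: field_simps)
  next
    case (step m)
    have "1 / (real (Suc m) * (real (Suc m) + 1)) = 1 / (real m + 1) - 1 / (real (Suc m) + 1)"
      by (simp add: field_simps)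
    with step show ?case by simp
  qed
  moreover have "k = M + 1" if "\<not> k \<le> M" using assms that by simp
  ultimately show ?thesis by (cases "k \<le> M") auto
qed

text \<open>Exchange the summations. With \<open>w n = 1 / (n * (n + 1))\<close> the sum of \<open>w\<close> over \<open>n > l\<close> is about \<open>1 / l\<close> and that
  over \<open>n > l / \<alpha>\<close> about \<open>\<alpha> / l\<close>, so each \<open>f l\<close> receives the coefficient zero up to
  a summable error and the truncation at \<open>M\<close>. This is the discrete form of the invariance of \<open>dn / n\<close>
  under dilations.\<close>
lemma dilated_sums_log_average:
  fixes f :: "nat \<Rightarrow> real" and \<alpha> :: real
  assumes \<alpha>: "0 < \<alpha>" "\<alpha> \<le> 1" and f: "\<And>l. \<bar>f l\<bar> \<le> B"
  shows "\<bar>\<Sum>n=1..M. (\<alpha> * (\<Sum>l<n. f l) - (\<Sum>l<nat \<lfloor>\<alpha> * n\<rfloor>. f l)) / (real n * (real n + 1))\<bar> \<le> 3 * B"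
proof (cases "M = 0")
  case True
  then show ?thesis using f[of 0] by auto
next
  case False
  define w where "w n = 1 / (real n * (real n + 1))" for n
  have w_nonneg: "0 \<le> w n" for n by (simp add: w_def)
  have tele: "sum w {k..M} = 1 / real k - 1 / (real M + 1)" if "0 < k" "k \<le> M + 1" for k
    using sum_telescope_reciprocals[OF that] by (simp add: w_def)
  \<comment> \<open>The coefficient of \<open>f l\<close> in the \<open>n\<close>-th difference, and \<open>K l\<close>, its total weight.\<close>
  define e where "e n l = (if l < n then \<alpha> else 0) - (if l < nat \<lfloor>\<alpha> * n\<rfloor> then 1 else 0)" for n l :: nat
  define K where "K l = (\<Sum>n=1..M. e n l * w n)" for l :: nat
  have floor_le: "nat \<lfloor>\<alpha> * real n\<rfloor> \<le> n" for n
  proof -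
    have "\<alpha> * real n \<le> real n" using \<alpha> by (simp add: mult_left_le_one_le)
    then show ?thesis by linarith
  qed
  have D: "\<alpha> * (\<Sum>l<n. f l) - (\<Sum>l<nat \<lfloor>\<alpha> * n\<rfloor>. f l) = (\<Sum>l<M. f l * e n l)" if "n \<in> {1..M}" for n
  proof -
    have "(\<Sum>l<n. f l) = (\<Sum>l<M. if l < n then f l else 0)"
      by (rule sum.mono_neutral_cong_left) (use that in auto)
    moreover have "(\<Sum>l<nat \<lfloor>\<alpha> * n\<rfloor>. f l) = (\<Sum>l<M. if l < nat \<lfloor>\<alpha> * n\<rfloor> then f l else 0)"
      by (rule sum.mono_neutral_cong_left) (use that floor_le[of n] in auto)
    ultimately have "\<alpha> * (\<Sum>l<n. f l) - (\<Sum>l<nat \<lfloor>\<alpha> * n\<rfloor>. f l) =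
        (\<Sum>l<M. \<alpha> * (if l < n then f l else 0) - (if l < nat \<lfloor>\<alpha> * n\<rfloor> then f l else 0))"
      by (simp only: sum_distrib_left sum_subtractf)
    also have "\<dots> = (\<Sum>l<M. f l * e n l)"
      by (intro sum.cong refl) (simp add: e_def algebra_simps)
    finally show ?thesis .
  qed
  have "(\<Sum>n=1..M. (\<alpha> * (\<Sum>l<n. f l) - (\<Sum>l<nat \<lfloor>\<alpha> * n\<rfloor>. f l)) / (real n * (real n + 1)))
      = (\<Sum>n=1..M. \<Sum>l<M. f l * (e n l * w n))"
    by (intro sum.cong refl, subst D) (simp_all add: w_def sum_divide_distrib)
  also have "\<dots> = (\<Sum>l<M. f l * K l)"
    unfolding K_def sum_distrib_left by (rule sum.swap)
  finally have eq: "(\<Sum>n=1..M. (\<alpha> * (\<Sum>l<n. f l) - (\<Sum>l<nat \<lfloor>\<alpha> * n\<rfloor>. f l)) / (real n * (real n + 1)))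
      = (\<Sum>l<M. f l * K l)" .
  have K: "\<bar>K l\<bar> \<le> 2 * w (l + 1) + 1 / real M" if "l < M" for l
  proof -
    \<comment> \<open>The first level whose dilated sum contains the index \<open>l\<close>.\<close>
    define n0 where "n0 = nat \<lceil>(real l + 1) / \<alpha>\<rceil>"
    have ge: "(real l + 1) / \<alpha> \<le> real n0" and less: "real n0 < (real l + 1) / \<alpha> + 1"
    proof -
      have "0 \<le> (real l + 1) / \<alpha>" using \<alpha> by simp
      then have "real n0 = of_int \<lceil>(real l + 1) / \<alpha>\<rceil>" unfolding n0_def by simp
      then show "(real l + 1) / \<alpha> \<le> real n0" "real n0 < (real l + 1) / \<alpha> + 1"
        using ceiling_correct[of "(real l + 1) / \<alpha>"] by linarith+
    qed
    have "real l + 1 \<le> (real l + 1) / \<alpha>"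
      using \<alpha> mult_right_mono[of \<alpha> 1 "real l + 1"] by (simp add: field_simps)
    with ge have n0_ge: "l + 1 \<le> n0" by linarith
    have iff: "l < nat \<lfloor>\<alpha> * real n\<rfloor> \<longleftrightarrow> n0 \<le> n" for n
    proof -
      have "l < nat \<lfloor>\<alpha> * real n\<rfloor> \<longleftrightarrow> real l + 1 \<le> \<alpha> * real n" by linarith
      also have "\<dots> \<longleftrightarrow> (real l + 1) / \<alpha> \<le> real n" using \<alpha> by (simp add: field_simps)
      also have "\<dots> \<longleftrightarrow> n0 \<le> n" unfolding n0_def by (simp add: nat_le_iff ceiling_le_iff)
      finally show ?thesis .
    qed
    have "K l = (\<Sum>n=1..M. \<alpha> * (if l < n then w n else 0) - (if n0 \<le> n then w n else 0))"
      unfolding K_def by (intro sum.cong refl) (simp add: e_def iff algebra_simps)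
    also have "\<dots> = \<alpha> * (\<Sum>n=1..M. if l < n then w n else 0) - (\<Sum>n=1..M. if n0 \<le> n then w n else 0)"
      by (simp only: sum_distrib_left sum_subtractf)
    also have "(\<Sum>n=1..M. if l < n then w n else 0) = sum w {l+1..M}"
      by (rule sum.mono_neutral_cong_right) auto
    also have "(\<Sum>n=1..M. if n0 \<le> n then w n else 0) = sum w {n0..M}"
      by (rule sum.mono_neutral_cong_right) (use n0_ge in auto)
    also have "sum w {l+1..M} = 1 / real (l + 1) - 1 / (real M + 1)"
      using that by (intro tele) auto
    finally have K_eq: "K l = \<alpha> * (1 / (real l + 1) - 1 / (real M + 1)) - sum w {n0..M}" by (simp add: add.commute)
    show ?thesis
    proof (cases "n0 \<le> M + 1")
      case True
      have "sum w {n0..M} = 1 / real n0 - 1 / (real M + 1)" using True n0_ge by (intro tele) auto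
      then have "K l = (\<alpha> / (real l + 1) - 1 / real n0) + (1 - \<alpha>) / (real M + 1)"
        using K_eq by (simp add: algebra_simps diff_divide_distrib)
      moreover have "1 / real n0 \<le> \<alpha> / (real l + 1)"
        using ge n0_ge \<alpha> by (simp add: field_simps)
      moreover have "\<alpha> / (real l + 1) - 1 / real n0 \<le> 2 * w (l + 1)"
      proof -
        have "real n0 \<le> (real l + 1 + \<alpha>) / \<alpha>" using less \<alpha> by (simp add: field_simps)
        then have "\<alpha> / (real l + 1 + \<alpha>) \<le> 1 / real n0" using n0_ge \<alpha> by (simp add: field_simps)
        then have "\<alpha> / (real l + 1) - 1 / real n0 \<le> \<alpha> / (real l + 1) - \<alpha> / (real l + 1 + \<alpha>)" by simp
        also have "\<dots> = \<alpha> * \<alpha> / ((real l + 1) * (real l + 1 + \<alpha>))" using \<alpha> by (simp add: field_simps)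
        also have "\<dots> \<le> 1 / ((real l + 1) * (real l + 1))"
          using \<alpha> by (intro frac_le mult_left_mono) (auto simp: mult_le_one)
        also have "\<dots> = 2 / (2 * ((real l + 1) * (real l + 1)))" by simp
        also have "\<dots> \<le> 2 / ((real l + 1) * (real l + 2))"
          by (intro divide_left_mono mult_pos_pos) (auto simp: algebra_simps)
        finally show ?thesis by (simp add: w_def add.commute)
      qed
      moreover have "0 \<le> (1 - \<alpha>) / (real M + 1)" "(1 - \<alpha>) / (real M + 1) \<le> 1 / real M"
        using \<alpha> False by (auto intro!: frac_le)
      ultimately show ?thesis by linarith
    next
      case n0: False
      then have "sum w {n0..M} = 0" by simp
      moreover have "\<alpha> / (real l + 1) \<le> 1 / real M"
      proof -
        have "real M \<le> (real l + 1) / \<alpha>" using n0 less by linarith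
        then show ?thesis using \<alpha> False by (simp add: field_simps)
      qed
      moreover have "0 \<le> \<alpha> / (real M + 1)" "\<alpha> / (real M + 1) \<le> \<alpha> / (real l + 1)"
        using \<alpha> that by (auto intro!: divide_left_mono)
      ultimately show ?thesis using K_eq w_nonneg[of "l + 1"] by (simp add: algebra_simps)
    qed
  qed
  have "(\<Sum>l<M. w (l + 1)) \<le> 1"
  proof -
    have "(\<Sum>l<M. w (l + 1)) = sum w {1..M}"
      by (rule sum.reindex_bij_witness[of _ "\<lambda>n. n - 1" "\<lambda>l. l + 1"]) auto
    then show ?thesis using tele[of 1] by simp
  qed
  then have sumK: "(\<Sum>l<M. \<bar>K l\<bar>) \<le> 3"
    using sum_mono[of "{..<M}" "\<lambda>l. \<bar>K l\<bar>" "\<lambda>l. 2 * w (l + 1) + 1 / real M"] K False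
    by (simp add: sum.distrib sum_distrib_left[symmetric])
  have "\<bar>\<Sum>l<M. f l * K l\<bar> \<le> (\<Sum>l<M. B * \<bar>K l\<bar>)"
    by (rule order_trans[OF sum_abs]) (auto simp: abs_mult intro!: sum_mono mult_right_mono f)
  also have "\<dots> \<le> B * 3"
    unfolding sum_distrib_left[symmetric] using sumK f[of 0] by (intro mult_left_mono) auto
  finally show ?thesis unfolding eq by (simp add: mult.commute)
qed

text \<open>Otherwise the averages would eventually decrease like \<open>\<eta>\<close> times the harmonic series.\<close>
lemma frequently_ge_of_bounded_log_average:
  fixes T :: "nat \<Rightarrow> real"
  assumes bounded: "\<And>M. \<bar>\<Sum>n=1..M. T n / (real n * (real n + 1))\<bar> \<le> C" and "\<eta> > 0"
  shows "\<exists>n\<ge>n0. - \<eta> * real n \<le> T n"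
proof (rule ccontr)
  assume "\<not> ?thesis"
  then have less: "T n < - \<eta> * real n" if "n \<ge> n0" for n using that by auto
  define g where "g n = - T n / (real n * (real n + 1))" for n
  define m where "m = n0 + 1"
  have g_ge: "\<eta> / (real n + 1) \<le> g n" if "n \<ge> m" for n
  proof -
    have "\<eta> * real n / (real n * (real n + 1)) \<le> g n"
      unfolding g_def using less[of n] that by (intro divide_right_mono) (auto simp: m_def)
    then show ?thesis using that by (simp add: m_def)
  qed
  have nonneg: "0 \<le> g n" if "n \<ge> m" for n
    by (rule order_trans[OF _ g_ge[OF that]]) (use \<open>\<eta> > 0\<close> in auto)
  have "summable (\<lambda>n. g (n + m))"
  proof (rule bounded_imp_summable)
    show "0 \<le> g (n + m)" for n by (rule nonneg) simp
    show "(\<Sum>k\<le>n. g (k + m)) \<le> C + (\<Sum>i=1..n0. \<bar>g i\<bar>)" for n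
    proof -
      have "(\<Sum>k\<le>n. g (k + m)) = sum g {m..n + m}"
        by (rule sum.reindex_bij_witness[of _ "\<lambda>i. i - m" "\<lambda>k. k + m"]) auto
      also have "\<dots> = sum g {1..n + m} - sum g {1..n0}"
      proof -
        have "{1..n + m} = {1..n0} \<union> {m..n + m}" "{1..n0} \<inter> {m..n + m} = {}" by (auto simp: m_def)
        then show ?thesis by (simp add: sum.union_disjoint)
      qed
      also have "sum g {1..n + m} = - (\<Sum>n=1..n+m. T n / (real n * (real n + 1)))"
        by (simp add: g_def sum_negf)
      finally show ?thesis using bounded[of "n + m"] sum_abs[of g "{1..n0}"] by linarith
    qed
  qed
  then have "summable (\<lambda>n. \<eta> / (real (n + m) + 1))"
    by (rule summable_comparison_test[rotated])
      (use g_ge[OF le_add2] \<open>\<eta> > 0\<close> in \<open>auto intro!: exI[of _ 0] simp del: of_nat_add\<close>)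
  then have "summable (\<lambda>n. (1 / \<eta>) * (\<eta> / (real (n + m) + 1)))" by (rule summable_mult)
  then have "summable (\<lambda>n. inverse (real (n + (m + 1))))"
    using \<open>\<eta> > 0\<close> by (simp add: field_simps)
  then have "summable (\<lambda>n. inverse (real n))" by (subst (asm) summable_iff_shift)
  then show False using not_summable_harmonic[where ?'a=real] by simp
qed

section \<open>Upper bounds for the Hausdorff dimension\<close>

text \<open>Each tail of the sequence of families is a cover, of arbitrarily small total size.\<close>
lemma hausdorff_measure_eq_0_of_limsup_cover:
  fixes E :: "'a::metric_space set" and \<U> :: "nat \<Rightarrow> 'a set set" and d :: "nat \<Rightarrow> real"
  assumes "s > 0" and fin: "\<And>n. finite (\<U> n)"
    and \<U>: "\<And>n U. U \<in> \<U> n \<Longrightarrow> bounded U \<and> diameter U \<le> d n"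
    and d: "d \<longlonglongrightarrow> 0"
    and cover: "\<And>x n0. x \<in> E \<Longrightarrow> \<exists>n\<ge>n0. x \<in> \<Union>(\<U> n)"
    and summable: "summable (\<lambda>n. card (\<U> n) * d n powr s)"
  shows "hausdorff_measure s E = 0"
proof -
  have small: "hausdorff_premeasure s \<delta> E \<le> 0 + ennreal e" if "\<delta> > 0" "e > 0" for \<delta> e :: real
  proof -
    obtain N1 where N1: "\<And>n. n \<ge> N1 \<Longrightarrow> d n < \<delta>"
      using order_tendstoD(2)[OF d \<open>\<delta> > 0\<close>] by (auto simp: eventually_sequentially)
    obtain N2 where N2: "\<And>n. n \<ge> N2 \<Longrightarrow> norm (\<Sum>i. card (\<U> (i + n)) * d (i + n) powr s) < e"
      using suminf_exist_split[OF \<open>e > 0\<close> summable] by blast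
    define n0 where "n0 = max N1 N2"
    have "\<exists>h. bij_betw h {..<card (\<U> (n + n0))} (\<U> (n + n0))" for n
      using ex_bij_betw_nat_finite[OF fin] by (simp add: lessThan_atLeast0)
    then obtain h where h: "\<And>n. bij_betw (h n) {..<card (\<U> (n + n0))} (\<U> (n + n0))" by metis
    define V where "V = (\<lambda>(n, i). if i < card (\<U> (n + n0)) then h n i else {})"
    have V_mem: "V (n, i) \<in> \<U> (n + n0)" if "i < card (\<U> (n + n0))" for n i
      using bij_betwE[OF h[of n]] that by (simp add: V_def)
    have gauge: "hausdorff_gauge s (V (n, i)) \<le> ennreal (d (n + n0) powr s)" if "i < card (\<U> (n + n0))" for n i
    proof (cases "V (n, i) = {}")
      case False
      have "diameter (V (n, i)) \<le> d (n + n0)" "0 \<le> diameter (V (n, i))"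
        using \<U>[OF V_mem[OF that]] by (auto intro: diameter_ge_0)
      then show ?thesis using False \<open>s > 0\<close>
        by (auto simp: hausdorff_gauge_def intro!: ennreal_leI powr_mono2)
    qed (simp add: hausdorff_gauge_def)
    have "hausdorff_premeasure s \<delta> E \<le> (\<Sum>k. hausdorff_gauge s (V (prod_decode k)))"
      unfolding hausdorff_premeasure_def
    proof (rule INF_lower, safe)
      fix x assume "x \<in> E"
      then obtain n where n: "n \<ge> n0" "x \<in> \<Union>(\<U> n)" using cover by blast
      then obtain U where "U \<in> \<U> ((n - n0) + n0)" "x \<in> U" by auto
      then obtain i where "i < card (\<U> ((n - n0) + n0))" "h (n - n0) i = U"
        using bij_betw_imp_surj_on[OF h[of "n - n0"]] by (metis imageE lessThan_iff)
      then have "x \<in> V (prod_decode (prod_encode (n - n0, i)))" using \<open>x \<in> U\<close> by (simp add: V_def)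
      then show "x \<in> (\<Union>k. V (prod_decode k))" by blast
    next
      fix k
      obtain n i where k: "prod_decode k = (n, i)" by fastforce
      have "bounded (V (n, i)) \<and> diameter (V (n, i)) \<le> \<delta>"
      proof (cases "i < card (\<U> (n + n0))")
        case True
        have "N1 \<le> n + n0" by (simp add: n0_def)
        then show ?thesis using \<U>[OF V_mem[OF True]] N1[of "n + n0"] by fastforce
      next
        case False
        then have "V (n, i) = {}" by (simp add: V_def)
        then show ?thesis using \<open>\<delta> > 0\<close> by simp
      qed
      then show "bounded (V (prod_decode k))" "diameter (V (prod_decode k)) \<le> \<delta>"
        unfolding k by auto
    qed
    also have "\<dots> = (\<Sum>n. \<Sum>i. hausdorff_gauge s (V (n, i)))"
      by (rule suminf_ennreal_2dimen[where f = "\<lambda>x. hausdorff_gauge s (V x)"]) (rule refl)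
    also have "\<dots> \<le> (\<Sum>n. ennreal (card (\<U> (n + n0)) * d (n + n0) powr s))"
    proof (intro suminf_le)
      fix n
      have "(\<Sum>i. hausdorff_gauge s (V (n, i))) = (\<Sum>i<card (\<U> (n + n0)). hausdorff_gauge s (V (n, i)))"
        by (intro suminf_finite) (auto simp: V_def hausdorff_gauge_def)
      also have "\<dots> \<le> (\<Sum>i<card (\<U> (n + n0)). ennreal (d (n + n0) powr s))"
        by (intro sum_mono gauge) simp
      also have "\<dots> = ennreal (card (\<U> (n + n0)) * d (n + n0) powr s)"
        by (simp add: ennreal_mult ennreal_of_nat_eq_real_of_nat)
      finally show "(\<Sum>i. hausdorff_gauge s (V (n, i))) \<le> ennreal (card (\<U> (n + n0)) * d (n + n0) powr s)" .
    qed simp_all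
    also have "\<dots> = ennreal (\<Sum>n. card (\<U> (n + n0)) * d (n + n0) powr s)"
      using summable by (intro suminf_ennreal2) (auto intro: summable_ignore_initial_segment[of "\<lambda>n. card (\<U> n) * d n powr s"])
    also have "\<dots> \<le> ennreal e" using N2[of n0] by (intro ennreal_leI) (simp add: n0_def)
    finally show ?thesis by simp
  qed
  have "hausdorff_premeasure s \<delta> E \<le> 0" if "\<delta> > 0" for \<delta>
    by (rule ennreal_le_epsilon) (rule small[OF that])
  then have "hausdorff_measure s E \<le> 0" unfolding hausdorff_measure_def by (intro SUP_least) simp
  then show ?thesis by simp
qed

section \<open>Heavy cells\<close>

text \<open>The parameters \<open>a\<close>, \<open>b\<close>, \<open>c\<close> and the alphabet determine the weights and cells; sponges enter
  only later, through the diameters of the cells.\<close>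
locale sierpinski_parameters = index_set +
  fixes a b c :: real
  assumes params: "0 < a" "a \<le> b" "b \<le> c" "c < 1"
begin

text \<open>Cells of side \<open>c ^ n\<close> fix \<open>n\<close> letters in direction \<open>z\<close>, \<open>alpha * n\<close> in direction \<open>y\<close> and \<open>alpha * beta * n\<close>
  in direction \<open>x\<close>.\<close>
definition alpha :: real where "alpha = ln c / ln b"
definition beta :: real where "beta = ln b / ln a"

lemma ln_params: "ln a < 0" "ln b < 0" "ln c < 0" "ln a \<le> ln b" "ln b \<le> ln c"
  using params by auto

lemma alpha_beta: "0 < alpha" "alpha \<le> 1" "0 < beta" "beta \<le> 1"
  using ln_params by (auto simp: alpha_def beta_def zero_less_divide_iff divide_le_eq)

text \<open>Maximising the dimension over the conditional distribution of \<open>j\<close> given \<open>i\<close> produces a multiple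
  of \<open>ln (partition_y i)\<close>, and then maximising over the distribution of \<open>i\<close> produces
  a multiple of \<open>ln partition_z\<close>; the maximisers are \<open>weight2\<close> and \<open>weight1\<close> below.\<close>
definition fibre_count :: "nat \<Rightarrow> nat \<Rightarrow> real" where "fibre_count i j = real (num_k \<A> i j)"
definition partition_y :: "nat \<Rightarrow> real" where "partition_y i = (\<Sum>j=1..num_j \<A> i. fibre_count i j powr beta)"
definition partition_z :: real where "partition_z = (\<Sum>i=1..num_i \<A>. partition_y i powr alpha)"

lemma fibre_count_ge_1: "(i, j) \<in> idx2 \<A> \<Longrightarrow> 1 \<le> fibre_count i j"
  using num_k_pos[of i j] by (simp add: fibre_count_def Suc_le_eq)

lemma partition_y_ge_1:
  assumes "i \<in> {1..num_i \<A>}"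
  shows "1 \<le> partition_y i"
proof -
  have one: "1 \<in> {1..num_j \<A> i}" using assms valid by (auto simp: valid_alphabet_def Suc_le_eq)
  then have "1 \<le> fibre_count i 1" using assms by (intro fibre_count_ge_1) (auto simp: idx2_Sigma[OF valid])
  then have "1 \<le> fibre_count i 1 powr beta" using alpha_beta by (intro ge_one_powr_ge_zero) auto
  also have "\<dots> \<le> partition_y i" unfolding partition_y_def using one by (intro member_le_sum) auto
  finally show ?thesis .
qed

lemma partition_z_ge_1: "1 \<le> partition_z"
proof -
  have one: "1 \<in> {1..num_i \<A>}" using valid by (auto simp: valid_alphabet_def Suc_le_eq)
  then have "1 \<le> partition_y 1 powr alpha" using alpha_beta partition_y_ge_1[OF one] by (intro ge_one_powr_ge_zero) auto
  also have "\<dots> \<le> partition_z" unfolding partition_z_def using one by (intro member_le_sum) auto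
  finally show ?thesis .
qed

definition weight1 :: "nat \<Rightarrow> real" where "weight1 i = partition_y i powr alpha / partition_z"
definition weight2 :: "nat \<Rightarrow> nat \<Rightarrow> real" where "weight2 i j = fibre_count i j powr beta / partition_y i"

lemma weight1_pos: "i \<in> {1..num_i \<A>} \<Longrightarrow> 0 < weight1 i"
  using partition_y_ge_1[of i] partition_z_ge_1 by (simp add: weight1_def)

lemma weight2_pos: "(i, j) \<in> idx2 \<A> \<Longrightarrow> 0 < weight2 i j"
  using fibre_count_ge_1[of i j] partition_y_ge_1[of i] by (simp add: weight2_def idx2_Sigma[OF valid])

lemma sum_weight1: "(\<Sum>i=1..num_i \<A>. weight1 i) = 1"
  unfolding weight1_def sum_divide_distrib[symmetric] partition_z_def[symmetric] using partition_z_ge_1 by simp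

lemma sum_weight2: "i \<in> {1..num_i \<A>} \<Longrightarrow> (\<Sum>j=1..num_j \<A> i. weight2 i j) = 1"
  unfolding weight2_def sum_divide_distrib[symmetric] partition_y_def[symmetric] using partition_y_ge_1[of i] by simp

text \<open>A letter at level of detail 1, 2 or 3, retaining \<open>i\<close>, \<open>(i, j)\<close> or \<open>(i, j, k)\<close>. Forgotten entries
  become \<open>0\<close>, so that truncated letters stay in one type, and the weight of a truncated letter is the total
  weight of the letters above it.\<close>
definition truncate_symbol :: "nat \<Rightarrow> nat \<times> nat \<times> nat \<Rightarrow> nat \<times> nat \<times> nat" where
  "truncate_symbol e = (\<lambda>(i, j, k). (i, if 2 \<le> e then j else 0, if 3 \<le> e then k else 0))"

definition symbol_weight :: "nat \<Rightarrow> nat \<times> nat \<times> nat \<Rightarrow> real" where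
  "symbol_weight e = (\<lambda>(i, j, k). weight1 i * (if 2 \<le> e then weight2 i j else 1) * (if 3 \<le> e then 1 / fibre_count i j else 1))"

lemma symbol_weight_truncate: "symbol_weight e (truncate_symbol e w) = symbol_weight e w"
  by (auto simp: symbol_weight_def truncate_symbol_def split: prod.split)

lemma symbol_weight_pos: "w \<in> idx3 \<A> \<Longrightarrow> 0 < symbol_weight e w"
proof -
  assume "w \<in> idx3 \<A>"
  then obtain i j k where w: "w = (i, j, k)" "(i, j) \<in> idx2 \<A>" by (cases w) (auto simp: idx2_def)
  then have "i \<in> {1..num_i \<A>}" by (simp add: idx2_Sigma[OF valid])
  then show ?thesis
    using weight1_pos weight2_pos[OF w(2)] fibre_count_ge_1[OF w(2)] by (simp add: symbol_weight_def w)
qed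

lemma sum_symbol_weight: "(\<Sum>x\<in>truncate_symbol e ` idx3 \<A>. symbol_weight e x) = 1"
proof -
  consider "3 \<le> e" | "e = 2" | "e < 2" by linarith
  then show ?thesis
  proof cases
    case 1
    have img: "truncate_symbol e ` idx3 \<A> = idx3 \<A>" using 1 by (auto simp: truncate_symbol_def image_iff)
    have "(\<Sum>x\<in>truncate_symbol e ` idx3 \<A>. symbol_weight e x) = (\<Sum>(i, j)\<in>idx2 \<A>. weight1 i * weight2 i j)"
      unfolding img sum_idx3
    proof (intro sum.cong refl, clarify)
      fix i j assume "(i, j) \<in> idx2 \<A>"
      then have "num_k \<A> i j \<noteq> 0" using num_k_pos by simp
      then show "(\<Sum>k=1..num_k \<A> i j. symbol_weight e (i, j, k)) = weight1 i * weight2 i j"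
        using 1 by (simp add: symbol_weight_def fibre_count_def)
    qed
    also have "\<dots> = (\<Sum>i=1..num_i \<A>. weight1 i * (\<Sum>j=1..num_j \<A> i. weight2 i j))"
      by (simp add: sum_idx2 sum_distrib_left)
    also have "\<dots> = 1" using sum_weight2 sum_weight1 by simp
    finally show ?thesis .
  next
    case 2
    have img: "truncate_symbol e ` idx3 \<A> = (\<lambda>(i, j). (i, j, 0)) ` idx2 \<A>"
      using 2 by (force simp: truncate_symbol_def idx2_def image_iff)
    have inj: "inj_on (\<lambda>(i, j). (i, j, 0 :: nat)) (idx2 \<A>)" by (auto simp: inj_on_def)
    have "(\<Sum>x\<in>truncate_symbol e ` idx3 \<A>. symbol_weight e x) = (\<Sum>(i, j)\<in>idx2 \<A>. weight1 i * weight2 i j)"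
      unfolding img sum.reindex[OF inj] by (intro sum.cong) (auto simp: 2 symbol_weight_def)
    also have "\<dots> = (\<Sum>i=1..num_i \<A>. weight1 i * (\<Sum>j=1..num_j \<A> i. weight2 i j))"
      by (simp add: sum_idx2 sum_distrib_left)
    also have "\<dots> = 1" using sum_weight2 sum_weight1 by simp
    finally show ?thesis .
  next
    case 3
    have "truncate_symbol e ` idx3 \<A> = (\<lambda>i. (i, 0, 0)) ` {1..num_i \<A>}"
    proof (intro equalityI subsetI)
      fix x :: "nat \<times> nat \<times> nat" assume "x \<in> (\<lambda>i. (i, 0, 0)) ` {1..num_i \<A>}"
      then obtain i where i: "i \<in> {1..num_i \<A>}" "x = (i, 0, 0)" by blast
      then have "(i, 1, 1) \<in> idx3 \<A>" using valid by (auto simp: idx3_def valid_alphabet_def Suc_le_eq)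
      then show "x \<in> truncate_symbol e ` idx3 \<A>"
        using i 3 by (intro image_eqI[of _ _ "(i, 1, 1)"]) (auto simp: truncate_symbol_def)
    qed (use 3 in \<open>auto simp: truncate_symbol_def idx3_def\<close>)
    then show ?thesis using 3 sum_weight1 by (simp add: sum.reindex inj_on_def symbol_weight_def comp_def)
  qed
qed

definition depth2 :: "nat \<Rightarrow> nat" where "depth2 n = nat \<lfloor>alpha * real n\<rfloor>"
definition depth3 :: "nat \<Rightarrow> nat" where "depth3 n = nat \<lfloor>(alpha * beta) * real n\<rfloor>"

lemma depths: "depth3 n \<le> depth2 n" "depth2 n \<le> n"
proof -
  have "alpha * beta * real n \<le> alpha * real n" using alpha_beta by (intro mult_right_mono) (auto simp: mult_left_le)
  then show "depth3 n \<le> depth2 n" unfolding depth2_def depth3_def by (intro nat_mono floor_mono)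
  have "alpha * real n \<le> real n" using alpha_beta by (simp add: mult_left_le_one_le)
  then show "depth2 n \<le> n" unfolding depth2_def by linarith
qed

definition detail :: "nat \<Rightarrow> nat \<Rightarrow> nat" where
  "detail n l = (if l < depth3 n then 3 else if l < depth2 n then 2 else 1)"

definition cells :: "nat \<Rightarrow> (nat \<Rightarrow> nat \<times> nat \<times> nat) set" where
  "cells n = PiE {..<n} (\<lambda>l. truncate_symbol (detail n l) ` idx3 \<A>)"

definition cell_mass :: "nat \<Rightarrow> (nat \<Rightarrow> nat \<times> nat \<times> nat) \<Rightarrow> real" where
  "cell_mass n g = (\<Prod>l<n. symbol_weight (detail n l) (g l))"

definition cell_of :: "nat \<Rightarrow> (nat \<Rightarrow> nat \<times> nat \<times> nat) \<Rightarrow> nat \<Rightarrow> nat \<times> nat \<times> nat" where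
  "cell_of n \<sigma> = (\<lambda>l\<in>{..<n}. truncate_symbol (detail n l) (\<sigma> l))"

lemma finite_cells: "finite (cells n)"
  by (simp add: cells_def finite_PiE)

lemma sum_cell_mass: "(\<Sum>g\<in>cells n. cell_mass n g) = 1"
  unfolding cells_def cell_mass_def
  by (subst prod_sum_PiE[symmetric]) (simp_all add: sum_symbol_weight)

lemma cell_of_in_cells: "\<sigma> \<in> code_space \<A> \<Longrightarrow> cell_of n \<sigma> \<in> cells n"
  by (auto simp: cell_of_def cells_def code_space_def)

lemma cell_mass_nonneg:
  assumes "g \<in> cells n"
  shows "0 \<le> cell_mass n g"
  unfolding cell_mass_def
proof (rule prod_nonneg)
  fix l assume "l \<in> {..<n}"
  then obtain w where "w \<in> idx3 \<A>" "g l = truncate_symbol (detail n l) w"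
    using assms by (force simp: cells_def PiE_iff)
  then show "0 \<le> symbol_weight (detail n l) (g l)"
    using symbol_weight_pos[of w] by (simp add: symbol_weight_truncate less_imp_le)
qed

text \<open>Markov's inequality for the cell masses, which sum to 1.\<close>
lemma card_heavy_cells:
  assumes "\<theta> > 0"
  shows "card {g\<in>cells n. \<theta> \<le> cell_mass n g} \<le> 1 / \<theta>"
proof -
  have "real (card {g\<in>cells n. \<theta> \<le> cell_mass n g}) * \<theta> = (\<Sum>g | g \<in> cells n \<and> \<theta> \<le> cell_mass n g. \<theta>)" by simp
  also have "\<dots> \<le> (\<Sum>g | g \<in> cells n \<and> \<theta> \<le> cell_mass n g. cell_mass n g)" by (intro sum_mono) auto
  also have "\<dots> \<le> (\<Sum>g\<in>cells n. cell_mass n g)"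
    using finite_cells cell_mass_nonneg by (intro sum_mono2) auto
  finally show ?thesis using assms by (simp add: sum_cell_mass field_simps)
qed

text \<open>Substituting the explicit weights leaves only Birkhoff sums of the bounded functions \<open>F\<close> and \<open>G\<close>. The term
  \<open>beta * S - S'\<close> with sums up to \<open>depth2 n\<close> and \<open>depth3 n\<close> is split so that both of its parts compare
  with a sum up to \<open>n\<close>.\<close>
lemma ln_cell_mass:
  assumes "\<sigma> \<in> code_space \<A>"
  defines "F \<equiv> \<lambda>l. ln (partition_y (fst (\<sigma> l)))" and "G \<equiv> \<lambda>l. ln (fibre_count (fst (\<sigma> l)) (fst (snd (\<sigma> l))))"
  shows "ln (cell_mass n (cell_of n \<sigma>)) = - real n * ln partition_z +
    ((alpha * (\<Sum>l<n. F l) - (\<Sum>l<depth2 n. F l)) + (alpha * beta * (\<Sum>l<n. G l) - (\<Sum>l<depth3 n. G l))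
     - beta * (alpha * (\<Sum>l<n. G l) - (\<Sum>l<depth2 n. G l)))"
proof -
  have \<sigma>: "\<sigma> l \<in> idx3 \<A>" for l using assms(1) by (auto simp: code_space_def)
  have "cell_mass n (cell_of n \<sigma>) = (\<Prod>l<n. symbol_weight (detail n l) (\<sigma> l))"
    unfolding cell_mass_def cell_of_def by (intro prod.cong) (auto simp: symbol_weight_truncate)
  then have "ln (cell_mass n (cell_of n \<sigma>)) = (\<Sum>l<n. ln (symbol_weight (detail n l) (\<sigma> l)))"
    using symbol_weight_pos[OF \<sigma>] by (simp add: ln_prod less_imp_neq[symmetric])
  also have "\<dots> = (\<Sum>l<n. (alpha * F l - ln partition_z) + (if l < depth2 n then beta * G l - F l else 0) - (if l < depth3 n then G l else 0))"
  proof (intro sum.cong refl)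
    fix l
    obtain i j k where w: "\<sigma> l = (i, j, k)" by (cases "\<sigma> l")
    have ij: "(i, j) \<in> idx2 \<A>" "i \<in> {1..num_i \<A>}" using \<sigma>[of l] unfolding w by (auto simp: idx2_def idx3_def)
    have pos: "0 < partition_z" "0 < partition_y i" "0 < fibre_count i j"
      using partition_z_ge_1 partition_y_ge_1[OF ij(2)] fibre_count_ge_1[OF ij(1)] by auto
    have 1: "ln (weight1 i) = alpha * F l - ln partition_z" "ln (weight2 i j) = beta * G l - F l" "ln (1 / fibre_count i j) = - G l"
      using pos by (simp_all add: weight1_def weight2_def F_def G_def w ln_div ln_powr)
    show "ln (symbol_weight (detail n l) (\<sigma> l)) = (alpha * F l - ln partition_z) + (if l < depth2 n then beta * G l - F l else 0) - (if l < depth3 n then G l else 0)"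
      using depths(1)[of n] 1 weight1_pos[OF ij(2)] weight2_pos[OF ij(1)] pos
      by (auto simp: symbol_weight_def w detail_def ln_mult_pos ln_div)
  qed
  also have "\<dots> = alpha * (\<Sum>l<n. F l) - real n * ln partition_z + (\<Sum>l<n. if l < depth2 n then beta * G l - F l else 0) - (\<Sum>l<n. if l < depth3 n then G l else 0)"
    by (simp add: sum.distrib sum_subtractf sum_distrib_left)
  also have "(\<Sum>l<n. if l < depth2 n then beta * G l - F l else 0) = (\<Sum>l<depth2 n. beta * G l - F l)"
    by (rule sum.mono_neutral_cong_right) (use depths[of n] in auto)
  also have "(\<Sum>l<n. if l < depth3 n then G l else 0) = (\<Sum>l<depth3 n. G l)"
    by (rule sum.mono_neutral_cong_right) (use depths[of n] in auto)
  also have "(\<Sum>l<depth2 n. beta * G l - F l) = beta * (\<Sum>l<depth2 n. G l) - (\<Sum>l<depth2 n. F l)"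
    by (simp add: sum_subtractf sum_distrib_left)
  finally show ?thesis by (simp add: algebra_simps)
qed

lemma frequently_heavy:
  assumes \<sigma>: "\<sigma> \<in> code_space \<A>" and "\<eta> > 0"
  shows "\<exists>n\<ge>n0. exp (- real n * (ln partition_z + \<eta>)) \<le> cell_mass n (cell_of n \<sigma>)"
proof -
  define F where "F l = ln (partition_y (fst (\<sigma> l)))" for l
  define G where "G l = ln (fibre_count (fst (\<sigma> l)) (fst (snd (\<sigma> l))))" for l
  have \<sigma>_in: "\<sigma> l \<in> idx3 \<A>" for l using \<sigma> by (auto simp: code_space_def)
  define B where "B = Max ((\<lambda>w. \<bar>ln (partition_y (fst w))\<bar>) ` idx3 \<A> \<union> (\<lambda>w. \<bar>ln (fibre_count (fst w) (fst (snd w)))\<bar>) ` idx3 \<A>)"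
  have B: "\<bar>F l\<bar> \<le> B" "\<bar>G l\<bar> \<le> B" for l
    unfolding B_def F_def G_def using \<sigma>_in[of l] by (auto intro!: Max_ge)
  define avg where "avg T M = (\<Sum>n=1..M. T n / (real n * (real n + 1)))" for T :: "nat \<Rightarrow> real" and M :: nat
  define T1 where "T1 n = alpha * (\<Sum>l<n. F l) - (\<Sum>l<depth2 n. F l)" for n
  define T2 where "T2 n = alpha * beta * (\<Sum>l<n. G l) - (\<Sum>l<depth3 n. G l)" for n
  define T3 where "T3 n = alpha * (\<Sum>l<n. G l) - (\<Sum>l<depth2 n. G l)" for n
  have ab: "0 < alpha * beta" "alpha * beta \<le> 1" using alpha_beta by (auto intro: mult_le_one)
  have bounds: "\<bar>avg T1 M\<bar> \<le> 3 * B" "\<bar>avg T2 M\<bar> \<le> 3 * B" "\<bar>avg T3 M\<bar> \<le> 3 * B" for M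
    unfolding avg_def T1_def T2_def T3_def depth2_def depth3_def
    by (intro dilated_sums_log_average ab alpha_beta B)+
  have "\<bar>avg (\<lambda>n. T1 n + T2 n - beta * T3 n) M\<bar> \<le> 9 * B" for M
  proof -
    have "avg (\<lambda>n. T1 n + T2 n - beta * T3 n) M = avg T1 M + avg T2 M - beta * avg T3 M"
      by (simp add: avg_def sum.distrib sum_subtractf sum_distrib_left add_divide_distrib diff_divide_distrib)
    moreover have "\<bar>beta * avg T3 M\<bar> \<le> 1 * (3 * B)"
      unfolding abs_mult using alpha_beta bounds(3)[of M] by (intro mult_mono) auto
    ultimately show ?thesis using bounds[of M] by linarith
  qed
  then obtain n where n: "n \<ge> n0" "- \<eta> * real n \<le> T1 n + T2 n - beta * T3 n"
    using frequently_ge_of_bounded_log_average[OF _ \<open>\<eta> > 0\<close>, of "\<lambda>n. T1 n + T2 n - beta * T3 n" "9 * B" n0]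
    unfolding avg_def by blast
  have "0 < cell_mass n (cell_of n \<sigma>)"
    unfolding cell_mass_def using symbol_weight_pos[OF \<sigma>_in]
    by (intro prod_pos) (auto simp: cell_of_def symbol_weight_truncate)
  moreover have "- real n * (ln partition_z + \<eta>) \<le> ln (cell_mass n (cell_of n \<sigma>))"
    using n(2) ln_cell_mass[OF \<sigma>, of n] unfolding T1_def T2_def T3_def F_def G_def by (simp add: algebra_simps)
  ultimately have "exp (- real n * (ln partition_z + \<eta>)) \<le> cell_mass n (cell_of n \<sigma>)"
    by (metis exp_le_cancel_iff exp_ln)
  then show ?thesis using n(1) by blast
qed

end

section \<open>Sponges close to a Sierpinski sponge\<close>

text \<open>Two words that select the same interval after \<open>n\<close> letters code points in it.\<close>
lemma (in line_code) code_val_diff_le: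
  assumes \<sigma>: "range \<sigma> \<subseteq> W" and \<tau>: "range \<tau> \<subseteq> W"
    and agree: "\<And>l. l < n \<Longrightarrow> r (\<sigma> l) = r (\<tau> l) \<and> u (\<sigma> l) = u (\<tau> l)"
    and R: "\<And>w. w \<in> W \<Longrightarrow> r w \<le> R"
  shows "\<bar>code_val r u \<sigma> - code_val r u \<tau>\<bar> \<le> R ^ n"
proof -
  have "code_left r u \<sigma> n = code_left r u \<tau> n" "code_ratio r \<sigma> n = code_ratio r \<tau> n"
    using agree by (auto intro!: code_left_cong code_ratio_cong)
  moreover have "code_ratio r \<sigma> n \<le> (\<Prod>l<n. R)"
    unfolding code_ratio_def using \<sigma> by (intro prod_mono) (auto intro: R less_imp_le[OF ratio_pos])
  ultimately show ?thesis
    using code_val_ge[OF \<sigma>, of n] code_val_le[OF \<sigma>, of n] code_val_ge[OF \<tau>, of n] code_val_le[OF \<tau>, of n]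
    by (simp add: abs_le_iff)
qed

lemma divide_add_ge:
  fixes h \<kappa> \<epsilon> :: real
  assumes "0 \<le> h" "0 < \<kappa>" "0 \<le> \<epsilon>"
  shows "h / \<kappa> - h / \<kappa>\<^sup>2 * \<epsilon> \<le> h / (\<kappa> + \<epsilon>)"
proof -
  have "h / \<kappa> - h / (\<kappa> + \<epsilon>) = h * \<epsilon> / (\<kappa> * (\<kappa> + \<epsilon>))"
    using assms by (simp add: field_simps)
  also have "\<dots> \<le> h * \<epsilon> / (\<kappa> * \<kappa>)"
    using assms by (intro divide_left_mono) auto
  finally show ?thesis by (simp add: power2_eq_square)
qed

lemma divide_diff_le:
  fixes h \<kappa> \<epsilon> :: real
  assumes "0 \<le> h" "0 < \<kappa>" "0 \<le> \<epsilon>" "\<epsilon> \<le> \<kappa> / 2"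
  shows "h / (\<kappa> - \<epsilon>) \<le> h / \<kappa> + 2 * h / \<kappa>\<^sup>2 * \<epsilon>"
proof -
  have "h / (\<kappa> - \<epsilon>) - h / \<kappa> = h * \<epsilon> / (\<kappa> * (\<kappa> - \<epsilon>))"
    using assms by (simp add: field_simps)
  also have "\<dots> \<le> h * \<epsilon> / (\<kappa> * (\<kappa> / 2))"
    using assms by (intro divide_left_mono mult_left_mono mult_pos_pos) auto
  also have "\<dots> = 2 * h / \<kappa>\<^sup>2 * \<epsilon>" by (simp add: power2_eq_square)
  finally show ?thesis by simp
qed

context sierpinski_parameters
begin

lemma truncate_symbol_eq_imp_proj:
  assumes "truncate_symbol e w = truncate_symbol e w'"
  shows "proj1 w = proj1 w'" "2 \<le> e \<Longrightarrow> proj2 w = proj2 w'" "3 \<le> e \<Longrightarrow> w = w'"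
  using assms by (auto simp: truncate_symbol_def proj1_def proj2_def split: prod.splits if_splits)


text \<open>The maximising vector, with its entropy, its conditional entropy, and the mean of \<open>ln m\<^sub>i\<^sub>j\<close>, the latter
  being the conditional entropy of the uniform distribution on the fibres.\<close>
definition opt_vector :: "nat \<Rightarrow> nat \<Rightarrow> real" where "opt_vector i j = weight1 i * weight2 i j"
definition opt_entropy_z :: real where "opt_entropy_z = - (\<Sum>i=1..num_i \<A>. weight1 i * ln (weight1 i))"
definition opt_entropy_y :: real where "opt_entropy_y = - (\<Sum>(i, j)\<in>idx2 \<A>. opt_vector i j * ln (weight2 i j))"
definition opt_log_count :: real where "opt_log_count = (\<Sum>(i, j)\<in>idx2 \<A>. opt_vector i j * ln (fibre_count i j))"

lemma marginal_opt_vector: "i \<in> {1..num_i \<A>} \<Longrightarrow> marginal \<A> opt_vector i = weight1 i"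
  using sum_weight2[of i] unfolding marginal_def opt_vector_def sum_distrib_left[symmetric] by simp

lemma idx2_fst: "(i, j) \<in> idx2 \<A> \<Longrightarrow> i \<in> {1..num_i \<A>}"
  by (simp add: idx2_Sigma[OF valid])

lemma opt_vector_pos: "(i, j) \<in> idx2 \<A> \<Longrightarrow> 0 < opt_vector i j"
  using weight1_pos weight2_pos idx2_fst by (simp add: opt_vector_def)

lemma sum_opt_vector_fst: "(\<Sum>(i, j)\<in>idx2 \<A>. opt_vector i j * f i) = (\<Sum>i=1..num_i \<A>. weight1 i * f i)"
proof -
  have "(\<Sum>(i, j)\<in>idx2 \<A>. opt_vector i j * f i) = (\<Sum>i=1..num_i \<A>. marginal \<A> opt_vector i * f i)"
    by (simp add: sum_idx2 marginal_def sum_distrib_right)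
  then show ?thesis by (simp add: marginal_opt_vector)
qed

lemma opt_vector_prob: "opt_vector \<in> prob_vectors \<A>"
  using opt_vector_pos sum_opt_vector_fst[of "\<lambda>_. 1"] sum_weight1
  by (auto simp: prob_vectors_def intro: less_imp_le)

lemma opt_entropies_nonneg: "0 \<le> opt_entropy_z" "0 \<le> opt_entropy_y" "0 \<le> opt_log_count"
proof -
  have le1: "weight1 i \<le> 1" if "i \<in> {1..num_i \<A>}" for i
    using member_le_sum[OF that, of weight1] weight1_pos sum_weight1 by (auto intro: less_imp_le)
  have le2: "weight2 i j \<le> 1" if "(i, j) \<in> idx2 \<A>" for i j
    using member_le_sum[of j "{1..num_j \<A> i}" "weight2 i"] weight2_pos sum_weight2[of i] that
    by (auto simp: idx2_Sigma[OF valid] intro: less_imp_le)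
  show "0 \<le> opt_entropy_z"
    unfolding opt_entropy_z_def neg_0_le_iff_le
    using le1 weight1_pos by (intro sum_nonpos mult_nonneg_nonpos) (auto intro: less_imp_le)
  show "0 \<le> opt_entropy_y"
    unfolding opt_entropy_y_def neg_0_le_iff_le
  proof (intro sum_nonpos, clarify)
    fix i j assume "(i, j) \<in> idx2 \<A>"
    then show "opt_vector i j * ln (weight2 i j) \<le> 0"
      using le2 weight2_pos opt_vector_pos by (intro mult_nonneg_nonpos) (auto intro: less_imp_le)
  qed
  show "0 \<le> opt_log_count"
    unfolding opt_log_count_def
  proof (intro sum_nonneg, clarify)
    fix i j assume ij: "(i, j) \<in> idx2 \<A>"
    then show "0 \<le> opt_vector i j * ln (fibre_count i j)"
      using fibre_count_ge_1[OF ij] opt_vector_pos[OF ij] by simp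
  qed
qed

text \<open>The value of the variational expression at the maximising vector, for the unperturbed parameters.\<close>
lemma entropy_identity: "opt_entropy_z / - ln c + opt_entropy_y / - ln b + opt_log_count / - ln a = ln partition_z / - ln c"
proof -
  define F where "F = (\<Sum>i=1..num_i \<A>. weight1 i * ln (partition_y i))"
  have "opt_entropy_z = ln partition_z - alpha * F"
  proof -
    have "weight1 i * ln (weight1 i) = alpha * (weight1 i * ln (partition_y i)) - weight1 i * ln partition_z" if "i \<in> {1..num_i \<A>}" for i
    proof -
      have "ln (weight1 i) = alpha * ln (partition_y i) - ln partition_z"
        using partition_y_ge_1[OF that] partition_z_ge_1 by (simp add: weight1_def ln_div ln_powr)
      then have "weight1 i * ln (weight1 i) = weight1 i * (alpha * ln (partition_y i) - ln partition_z)" by simp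
      then show ?thesis by (simp add: right_diff_distrib mult.left_commute)
    qed
    then have "(\<Sum>i=1..num_i \<A>. weight1 i * ln (weight1 i)) = alpha * F - (\<Sum>i=1..num_i \<A>. weight1 i) * ln partition_z"
      by (simp add: F_def sum_subtractf sum_distrib_left sum_distrib_right)
    then show ?thesis unfolding opt_entropy_z_def sum_weight1 by simp
  qed
  moreover have "opt_entropy_y = F - beta * opt_log_count"
  proof -
    have "opt_vector i j * ln (weight2 i j) = beta * (opt_vector i j * ln (fibre_count i j)) - opt_vector i j * ln (partition_y i)"
      if ij: "(i, j) \<in> idx2 \<A>" for i j
    proof -
      have "ln (weight2 i j) = beta * ln (fibre_count i j) - ln (partition_y i)"
        using partition_y_ge_1[OF idx2_fst[OF ij]] fibre_count_ge_1[OF ij] by (simp add: weight2_def ln_div ln_powr)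
      then have "opt_vector i j * ln (weight2 i j) = opt_vector i j * (beta * ln (fibre_count i j) - ln (partition_y i))" by simp
      then show ?thesis by (simp add: right_diff_distrib mult.left_commute)
    qed
    then have "(\<Sum>(i, j)\<in>idx2 \<A>. opt_vector i j * ln (weight2 i j)) =
        (\<Sum>(i, j)\<in>idx2 \<A>. beta * (opt_vector i j * ln (fibre_count i j)) - opt_vector i j * ln (partition_y i))"
      by (intro sum.cong) auto
    also have "\<dots> = beta * opt_log_count - (\<Sum>(i, j)\<in>idx2 \<A>. opt_vector i j * ln (partition_y i))"
      by (simp add: opt_log_count_def case_prod_unfold sum_subtractf sum_distrib_left)
    finally show ?thesis by (simp add: opt_entropy_y_def sum_opt_vector_fst F_def)
  qed
  ultimately have "opt_entropy_z = ln partition_z - alpha * (opt_entropy_y + beta * opt_log_count)" by simp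
  then have "opt_entropy_z + alpha * opt_entropy_y + alpha * beta * opt_log_count = ln partition_z" by (simp add: algebra_simps)
  moreover have "opt_entropy_y / - ln b = alpha * opt_entropy_y / - ln c" "opt_log_count / - ln a = alpha * beta * opt_log_count / - ln c"
    using ln_params by (simp_all add: alpha_def beta_def)
  ultimately show ?thesis by (simp only: add_divide_distrib[symmetric])
qed

text \<open>The first term bounds the change of the upper estimate, the others the change of the three
  summands of the variational expression at \<open>opt_vector\<close>.\<close>
definition lipschitz_const :: real where
  "lipschitz_const = 2 * ln partition_z / (ln c)\<^sup>2 + opt_entropy_z / (ln c)\<^sup>2 + opt_entropy_y / (ln b)\<^sup>2 + opt_log_count / (ln a)\<^sup>2"

context
  fixes \<epsilon> S assumes abc: "abc_sponge a b c \<epsilon> \<A> S"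
begin

interpretation sponge \<A> S
  using abc by unfold_locales (simp add: abc_sponge_def)

lemma eps_nonneg: "0 \<le> \<epsilon>"
  using abc by (simp add: abc_sponge_def)

lemma ratio_near:
  assumes "w \<in> idx3 \<A>"
  shows "rx S w \<le> a * exp \<epsilon>" "a * exp (- \<epsilon>) \<le> rx S w"
    "ry S w \<le> b * exp \<epsilon>" "b * exp (- \<epsilon>) \<le> ry S w"
    "rz S w \<le> c * exp \<epsilon>" "c * exp (- \<epsilon>) \<le> rz S w"
proof -
  obtain i j k where w: "w = (i, j, k)" by (cases w)
  have "exp (-\<epsilon>) \<le> ratio_x S i j k / a \<and> ratio_x S i j k / a \<le> exp \<epsilon> \<and>
        exp (-\<epsilon>) \<le> ratio_y S i j / b \<and> ratio_y S i j / b \<le> exp \<epsilon> \<and>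
        exp (-\<epsilon>) \<le> ratio_z S i / c \<and> ratio_z S i / c \<le> exp \<epsilon>"
    using abc assms unfolding abc_sponge_def w by blast
  moreover have "0 < b" "0 < c" using params by auto
  ultimately show "rx S w \<le> a * exp \<epsilon>" "a * exp (- \<epsilon>) \<le> rx S w"
    "ry S w \<le> b * exp \<epsilon>" "b * exp (- \<epsilon>) \<le> ry S w"
    "rz S w \<le> c * exp \<epsilon>" "c * exp (- \<epsilon>) \<le> rz S w"
    using params by (simp_all add: w rx_def ry_def rz_def pos_divide_le_eq pos_le_divide_eq mult.commute)
qed

text \<open>Rounding the depth down costs at most one factor \<open>x \<ge> a\<close>, and since the depth is at most \<open>n\<close> the
  perturbation costs at most \<open>exp (\<epsilon> * n)\<close>.\<close>
lemma power_depth_le: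
  assumes "0 < x" "x < 1" "0 \<le> \<gamma>" "\<gamma> * ln x = ln c" "nat \<lfloor>\<gamma> * real n\<rfloor> \<le> n" "a \<le> x"
  shows "(x * exp \<epsilon>) ^ nat \<lfloor>\<gamma> * real n\<rfloor> \<le> (c * exp \<epsilon>) ^ n / a"
proof -
  define k where "k = nat \<lfloor>\<gamma> * real n\<rfloor>"
  have "\<gamma> * real n - 1 \<le> real k" unfolding k_def by linarith
  then have "real k * ln x \<le> (\<gamma> * real n - 1) * ln x" using assms by (intro mult_right_mono_neg) auto
  also have "\<dots> = real n * ln c - ln x" using assms(4) by (simp add: algebra_simps)
  also have "\<dots> \<le> real n * ln c - ln a" using params assms by simp
  finally have "real k * ln x + real k * \<epsilon> \<le> real n * ln c - ln a + real n * \<epsilon>"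
    using assms(5) eps_nonneg by (intro add_mono mult_right_mono) (auto simp: k_def)
  then have "exp (real k * (ln x + \<epsilon>)) \<le> exp (real n * (ln c + \<epsilon>) - ln a)" by (simp add: algebra_simps)
  then show ?thesis
    using assms params by (simp add: k_def[symmetric] exp_of_nat_mult exp_add exp_diff)
qed

lemma dist_cell_le:
  assumes \<sigma>: "\<sigma> \<in> code_space \<A>" and \<tau>: "\<tau> \<in> code_space \<A>" and cell: "cell_of n \<sigma> = cell_of n \<tau>"
  shows "dist (sponge_point S \<sigma>) (sponge_point S \<tau>) \<le> 3 / a * (c * exp \<epsilon>) ^ n"
proof -
  have in_W: "range \<sigma> \<subseteq> idx3 \<A>" "range \<tau> \<subseteq> idx3 \<A>" using \<sigma> \<tau> by (auto simp: code_space_def)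
  have trunc: "truncate_symbol (detail n l) (\<sigma> l) = truncate_symbol (detail n l) (\<tau> l)" if "l < n" for l
    using fun_cong[OF cell, of l] that by (simp add: cell_of_def)
  have ab: "0 < b" "b < 1" "0 < c" "a < 1" using params by auto
  have "\<bar>code_val (rz S) (uz S) \<sigma> - code_val (rz S) (uz S) \<tau>\<bar> \<le> (c * exp \<epsilon>) ^ n"
  proof (rule Z.code_val_diff_le[OF in_W])
    show "rz S (\<sigma> l) = rz S (\<tau> l) \<and> uz S (\<sigma> l) = uz S (\<tau> l)" if "l < n" for l
      using truncate_symbol_eq_imp_proj(1)[OF trunc[OF that]] by (auto simp: proj1_def rz_def uz_def split: prod.splits)
  qed (rule ratio_near)
  also have "\<dots> \<le> (c * exp \<epsilon>) ^ n / a"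
    using params ab by (simp add: le_divide_eq mult_left_le)
  finally have z: "\<bar>code_val (rz S) (uz S) \<sigma> - code_val (rz S) (uz S) \<tau>\<bar> \<le> (c * exp \<epsilon>) ^ n / a" .
  have "\<bar>code_val (ry S) (uy S) \<sigma> - code_val (ry S) (uy S) \<tau>\<bar> \<le> (b * exp \<epsilon>) ^ depth2 n"
  proof (rule Y.code_val_diff_le[OF in_W])
    show "ry S (\<sigma> l) = ry S (\<tau> l) \<and> uy S (\<sigma> l) = uy S (\<tau> l)" if "l < depth2 n" for l
      using truncate_symbol_eq_imp_proj(2)[OF trunc[of l]] that depths(2)[of n]
      by (auto simp: proj2_def ry_def uy_def detail_def split: prod.splits)
  qed (rule ratio_near)
  also have "\<dots> \<le> (c * exp \<epsilon>) ^ n / a"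
    unfolding depth2_def using depths(2)[of n] alpha_beta params ab ln_params
    by (intro power_depth_le) (auto simp: depth2_def alpha_def)
  finally have y: "\<bar>code_val (ry S) (uy S) \<sigma> - code_val (ry S) (uy S) \<tau>\<bar> \<le> (c * exp \<epsilon>) ^ n / a" .
  have "\<bar>code_val (rx S) (ux S) \<sigma> - code_val (rx S) (ux S) \<tau>\<bar> \<le> (a * exp \<epsilon>) ^ depth3 n"
  proof (rule X.code_val_diff_le[OF in_W])
    show "rx S (\<sigma> l) = rx S (\<tau> l) \<and> ux S (\<sigma> l) = ux S (\<tau> l)" if "l < depth3 n" for l
      using truncate_symbol_eq_imp_proj(3)[OF trunc[of l]] that depths[of n] by (simp add: detail_def)
  qed (rule ratio_near)
  also have "\<dots> \<le> (c * exp \<epsilon>) ^ n / a"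
    unfolding depth3_def
  proof (rule power_depth_le)
    show "0 \<le> alpha * beta" using alpha_beta by simp
    show "alpha * beta * ln a = ln c" using ln_params by (simp add: alpha_def beta_def)
    show "nat \<lfloor>alpha * beta * real n\<rfloor> \<le> n" using depths[of n] by (simp add: depth3_def)
  qed (use params ab in auto)
  finally have x: "\<bar>code_val (rx S) (ux S) \<sigma> - code_val (rx S) (ux S) \<tau>\<bar> \<le> (c * exp \<epsilon>) ^ n / a" .
  have "dist (sponge_point S \<sigma>) (sponge_point S \<tau>) \<le> (\<Sum>i\<in>UNIV. \<bar>(sponge_point S \<sigma> - sponge_point S \<tau>) $ i\<bar>)"
    unfolding dist_norm by (rule norm_le_l1_cart)
  also have "\<dots> \<le> 3 * ((c * exp \<epsilon>) ^ n / a)"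
    using x y z by (simp add: sum_3 sponge_point_def vector_3)
  finally show ?thesis by simp
qed

text \<open>There are at most \<open>exp (n * (ln partition_z + \<eta>))\<close> heavy cells of level \<open>n\<close>, of diameter at most a constant
  times \<open>(c * exp \<epsilon>) ^ n\<close>, and each point lies in heavy cells of infinitely many levels. The condition on \<open>s\<close>
  leaves room for an \<open>\<eta>\<close> that makes the total size a geometric series.\<close>
lemma hausdorff_measure_eq_0:
  assumes "\<epsilon> < - ln c" and s: "ln partition_z / (- ln c - \<epsilon>) < s"
  shows "hausdorff_measure s (sponge_set \<A> S) = 0"
proof -
  have "0 \<le> ln partition_z" using partition_z_ge_1 by simp
  then have "0 \<le> ln partition_z / (- ln c - \<epsilon>)" using assms by simp
  then have "s > 0" using s by linarith
  have gap: "ln partition_z + s * (ln c + \<epsilon>) < 0" using assms s by (simp add: divide_less_eq algebra_simps)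
  define g where "g = ln partition_z + s * (ln c + \<epsilon>)"
  define \<eta> where "\<eta> = - g / 2"
  have "g < 0" using gap by (simp add: g_def)
  then have \<eta>: "\<eta> > 0" "g + \<eta> < 0" by (auto simp: \<eta>_def)
  define heavy where "heavy n = {g\<in>cells n. exp (- real n * (ln partition_z + \<eta>)) \<le> cell_mass n g}" for n
  define U where "U n g = sponge_point S ` {\<sigma>\<in>code_space \<A>. cell_of n \<sigma> = g}" for n g
  define d where "d n = 3 / a * (c * exp \<epsilon>) ^ n" for n
  have d_nonneg: "0 \<le> d n" for n using params by (simp add: d_def)
  have card_heavy: "card (U n ` heavy n) \<le> exp (real n * (ln partition_z + \<eta>))" for n
  proof -
    have "finite (heavy n)" using finite_cells by (simp add: heavy_def)
    then have "real (card (U n ` heavy n)) \<le> real (card (heavy n))" by (simp add: card_image_le)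
    also have "\<dots> \<le> 1 / exp (- real n * (ln partition_z + \<eta>))" unfolding heavy_def by (rule card_heavy_cells) simp
    finally show ?thesis by (simp add: exp_minus inverse_eq_divide)
  qed
  show ?thesis
  proof (rule hausdorff_measure_eq_0_of_limsup_cover[OF \<open>s > 0\<close>, where \<U> = "\<lambda>n. U n ` heavy n" and d = d])
    show "finite (U n ` heavy n)" for n using finite_cells by (simp add: heavy_def)
    show "bounded V \<and> diameter V \<le> d n" if V_in: "V \<in> U n ` heavy n" for n V
    proof
      obtain g where V: "V = U n g" using V_in by blast
      have "V \<subseteq> sponge_point S ` code_space \<A>" unfolding V U_def by blast
      then show "bounded V" using compact_imp_bounded[OF compact_sponge_points] bounded_subset by blast
      show "diameter V \<le> d n"
      proof (rule diameter_le)
        fix x y assume "x \<in> V" "y \<in> V"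
        then obtain \<sigma> \<tau> where \<sigma>: "\<sigma> \<in> code_space \<A>" "cell_of n \<sigma> = g" "x = sponge_point S \<sigma>"
          and \<tau>: "\<tau> \<in> code_space \<A>" "cell_of n \<tau> = g" "y = sponge_point S \<tau>"
          unfolding V U_def by blast
        have "cell_of n \<sigma> = cell_of n \<tau>" using \<sigma>(2) \<tau>(2) by simp
        from dist_cell_le[OF \<sigma>(1) \<tau>(1) this] show "norm (x - y) \<le> d n"
          unfolding \<sigma>(3) \<tau>(3) d_def dist_norm .
      qed (use d_nonneg in simp)
    qed
    have small: "0 < c * exp \<epsilon>" "c * exp \<epsilon> < 1"
    proof -
      show "0 < c * exp \<epsilon>" using params by simp
      have "exp (ln c + \<epsilon>) < 1" using assms(1) by simp
      then show "c * exp \<epsilon> < 1" using params by (simp add: exp_add)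
    qed
    have "(\<lambda>n. 3 / a * (c * exp \<epsilon>) ^ n) \<longlonglongrightarrow> 3 / a * 0"
      using small by (intro tendsto_mult tendsto_const LIMSEQ_realpow_zero) auto
    then show "d \<longlonglongrightarrow> 0" by (simp add: d_def[abs_def])
    show "\<exists>n\<ge>n0. x \<in> \<Union>(U n ` heavy n)" if x_in: "x \<in> sponge_set \<A> S" for x n0
    proof -
      obtain \<sigma> where \<sigma>: "\<sigma> \<in> code_space \<A>" "x = sponge_point S \<sigma>"
        using x_in by (auto simp: sponge_set_eq)
      obtain n where n: "n \<ge> n0" "exp (- real n * (ln partition_z + \<eta>)) \<le> cell_mass n (cell_of n \<sigma>)"
        using frequently_heavy[OF \<sigma>(1) \<eta>(1)] by blast
      then have "cell_of n \<sigma> \<in> heavy n" using cell_of_in_cells[OF \<sigma>(1)] by (simp add: heavy_def)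
      moreover have "x \<in> U n (cell_of n \<sigma>)" using \<sigma> by (auto simp: U_def)
      ultimately show ?thesis using n(1) by blast
    qed
    define q where "q = exp (g + \<eta>)"
    have q: "0 \<le> q" "q < 1" using \<eta>(2) by (auto simp: q_def)
    have bound: "card (U n ` heavy n) * d n powr s \<le> (3 / a) powr s * q ^ n" for n
    proof -
      have "d n powr s = (3 / a) powr s * ((c * exp \<epsilon>) ^ n) powr s"
        unfolding d_def by (rule powr_mult)
      also have "((c * exp \<epsilon>) ^ n) powr s = exp (real n * (s * (ln c + \<epsilon>)))"
        using params small by (simp add: powr_def ln_realpow ln_mult_pos algebra_simps)
      finally have "card (U n ` heavy n) * d n powr s \<le> exp (real n * (ln partition_z + \<eta>)) * ((3 / a) powr s * exp (real n * (s * (ln c + \<epsilon>))))"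
        using card_heavy[of n] by (simp add: mult_right_mono)
      also have "\<dots> = (3 / a) powr s * q ^ n"
        by (simp add: q_def g_def exp_of_nat_mult[symmetric] exp_add[symmetric] algebra_simps)
      finally show ?thesis .
    qed
    have "summable (\<lambda>n. (3 / a) powr s * q ^ n)" using q by (intro summable_mult summable_geometric) auto
    then show "summable (\<lambda>n. card (U n ` heavy n) * d n powr s)"
      by (rule summable_comparison_test'[where N = 0]) (use bound in simp)
  qed
qed

lemma hausdorff_dim_le:
  assumes "\<epsilon> < - ln c"
  shows "hausdorff_dim (sponge_set \<A> S) \<le> ereal (ln partition_z / (- ln c - \<epsilon>))"
proof (rule ccontr)
  assume "\<not> hausdorff_dim (sponge_set \<A> S) \<le> ereal (ln partition_z / (- ln c - \<epsilon>))"
  then obtain s where s: "ereal (ln partition_z / (- ln c - \<epsilon>)) < ereal s" "ereal s < hausdorff_dim (sponge_set \<A> S)"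
    using ereal_dense2 by (meson not_le)
  have "0 \<le> ln partition_z / (- ln c - \<epsilon>)" using assms partition_z_ge_1 by simp
  then have "0 \<le> s" using s(1) by simp
  then have "hausdorff_dim (sponge_set \<A> S) \<le> ereal s"
    unfolding hausdorff_dim_def using hausdorff_measure_eq_0[OF assms] s(1) by (intro INF_lower) simp
  then show False using s(2) by simp
qed

text \<open>Perturbing the ratios changes the denominators of \<open>\<lambda>\<^sub>1\<close> and \<open>\<lambda>\<^sub>2\<close> by at most \<open>\<epsilon>\<close> and leaves the entropies
  alone. For the third summand, the pressure at \<open>opt_log_count / (- ln a + \<epsilon>)\<close> is non-negative, so its
  zero lies further to the right.\<close>
lemma opt_value_ge:
  "opt_entropy_z / (- ln c + \<epsilon>) + opt_entropy_y / (- ln b + \<epsilon>) + opt_log_count / (- ln a + \<epsilon>)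
    \<le> lambda1 \<A> S opt_vector + lambda2 \<A> S opt_vector + t_exponent \<A> S opt_vector"
proof -
  have pos: "0 < a" "0 < b" "0 < c" using params by auto
  have ne: "{1..num_i \<A>} \<noteq> {}" "idx2 \<A> \<noteq> {}"
    using valid idx3_nonempty[OF valid] by (auto simp: valid_alphabet_def idx2_def Suc_le_eq)
  have lnz: "ln c - \<epsilon> \<le> ln (ratio_z S i)" if "i \<in> {1..num_i \<A>}" for i
  proof -
    have "(i, 1, 1) \<in> idx3 \<A>" using that valid by (auto simp: idx3_def valid_alphabet_def Suc_le_eq)
    from ratio_near(6)[OF this] have "ln (c * exp (- \<epsilon>)) \<le> ln (ratio_z S i)"
      using pos ratio_z_bounds[OF that] by (simp add: rz_def)
    then show ?thesis using pos by (simp add: ln_mult_pos)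
  qed
  have lny: "ln b - \<epsilon> \<le> ln (ratio_y S i j)" if "(i, j) \<in> idx2 \<A>" for i j
  proof -
    have "(i, j, 1) \<in> idx3 \<A>" using that num_k_pos[OF that] by (auto simp: idx3_iff_idx2 Suc_le_eq)
    from ratio_near(4)[OF this] have "ln (b * exp (- \<epsilon>)) \<le> ln (ratio_y S i j)"
      using pos ratio_y_bounds[OF that] by (simp add: ry_def)
    then show ?thesis using pos by (simp add: ln_mult_pos)
  qed
  have marg: "(\<Sum>i=1..num_i \<A>. f i (marginal \<A> opt_vector i)) = (\<Sum>i=1..num_i \<A>. f i (weight1 i))" for f :: "nat \<Rightarrow> real \<Rightarrow> real"
    by (intro sum.cong) (auto simp: marginal_opt_vector)
  have 1: "opt_entropy_z / (- ln c + \<epsilon>) \<le> lambda1 \<A> S opt_vector"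
  proof -
    define X where "X = (\<Sum>i=1..num_i \<A>. weight1 i * - ln (ratio_z S i))"
    have "0 < X" unfolding X_def using ne(1) weight1_pos ratio_z_bounds by (intro sum_pos mult_pos_pos) auto
    moreover have "X \<le> (\<Sum>i=1..num_i \<A>. weight1 i * (- ln c + \<epsilon>))"
      unfolding X_def using lnz weight1_pos by (intro sum_mono mult_left_mono) (force intro: less_imp_le)+
    then have "X \<le> - ln c + \<epsilon>" by (simp only: sum_distrib_right[symmetric] sum_weight1) simp
    moreover have "lambda1 \<A> S opt_vector = opt_entropy_z / X"
      using marg[of "\<lambda>_ x. x * ln x"] marg[of "\<lambda>i x. x * ln (ratio_z S i)"]
      by (simp add: lambda1_def opt_entropy_z_def X_def sum_negf)
    ultimately show ?thesis using opt_entropies_nonneg(1) by (simp add: divide_left_mono)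
  qed
  have 2: "opt_entropy_y / (- ln b + \<epsilon>) \<le> lambda2 \<A> S opt_vector"
  proof -
    define X where "X = (\<Sum>(i, j)\<in>idx2 \<A>. opt_vector i j * - ln (ratio_y S i j))"
    have "0 < X" unfolding X_def 
    proof (rule sum_pos)
      fix x assume x: "x \<in> idx2 \<A>"
      show "0 < (case x of (i, j) \<Rightarrow> opt_vector i j * - ln (ratio_y S i j))"
        using opt_vector_pos[of "fst x" "snd x"] ratio_y_bounds[of "fst x" "snd x"] x
        unfolding case_prod_unfold by (intro mult_pos_pos) auto
    qed (use ne(2) in auto)
    moreover have "X \<le> (\<Sum>(i, j)\<in>idx2 \<A>. opt_vector i j * (- ln b + \<epsilon>))"
      unfolding X_def
    proof (intro sum_mono, clarify)
      fix i j assume ij: "(i, j) \<in> idx2 \<A>"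
      show "opt_vector i j * - ln (ratio_y S i j) \<le> opt_vector i j * (- ln b + \<epsilon>)"
        using lny[OF ij] opt_vector_pos[OF ij] by (intro mult_left_mono) auto
    qed
    then have "X \<le> - ln b + \<epsilon>"
      by (simp only: sum_opt_vector_fst sum_distrib_right[symmetric] sum_weight1) simp
    moreover have "lambda2 \<A> S opt_vector = opt_entropy_y / X"
    proof -
      have "(\<Sum>(i, j)\<in>idx2 \<A>. opt_vector i j * ln (opt_vector i j)) =
          (\<Sum>(i, j)\<in>idx2 \<A>. opt_vector i j * ln (weight1 i) + opt_vector i j * ln (weight2 i j))"
      proof (intro sum.cong refl, clarify)
        fix i j assume ij: "(i, j) \<in> idx2 \<A>"
        show "opt_vector i j * ln (opt_vector i j) = opt_vector i j * ln (weight1 i) + opt_vector i j * ln (weight2 i j)"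
          using weight1_pos[OF idx2_fst[OF ij]] weight2_pos[OF ij]
          by (subst (2) opt_vector_def) (simp add: ln_mult_pos distrib_left)
      qed
      also have "\<dots> = (\<Sum>(i, j)\<in>idx2 \<A>. opt_vector i j * ln (weight1 i)) - opt_entropy_y"
        by (simp add: opt_entropy_y_def case_prod_unfold sum.distrib)
      also have "(\<Sum>(i, j)\<in>idx2 \<A>. opt_vector i j * ln (weight1 i)) = - opt_entropy_z"
        unfolding sum_opt_vector_fst opt_entropy_z_def by simp
      finally have "lambda2 \<A> S opt_vector = (- opt_entropy_y) / (\<Sum>(i, j)\<in>idx2 \<A>. opt_vector i j * ln (ratio_y S i j))"
        unfolding lambda2_def using marg[of "\<lambda>_ x. x * ln x"] by (simp add: opt_entropy_z_def)
      also have "(\<Sum>(i, j)\<in>idx2 \<A>. opt_vector i j * ln (ratio_y S i j)) = - X"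
        by (simp add: X_def case_prod_unfold sum_negf)
      finally show ?thesis by simp
    qed
    ultimately show ?thesis using opt_entropies_nonneg(2) by (simp add: divide_left_mono)
  qed
  have 3: "opt_log_count / (- ln a + \<epsilon>) \<le> t_exponent \<A> S opt_vector"
  proof (rule t_exponent_ge[OF opt_vector_prob])
    define s where "s = opt_log_count / (- ln a + \<epsilon>)"
    have denom: "0 < - ln a + \<epsilon>" using ln_params eps_nonneg by linarith
    then have "0 \<le> s" using opt_entropies_nonneg(3) by (simp add: s_def)
    have "(\<Sum>(i, j)\<in>idx2 \<A>. opt_vector i j * (ln (fibre_count i j) + s * (ln a - \<epsilon>))) \<le> pressure opt_vector s"
      unfolding pressure_def
    proof (intro sum_mono, clarify)
      fix i j assume ij: "(i, j) \<in> idx2 \<A>"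
      have "(\<Sum>k=1..num_k \<A> i j. exp (s * (ln a - \<epsilon>))) \<le> (\<Sum>k=1..num_k \<A> i j. ratio_x S i j k powr s)"
      proof (rule sum_mono)
        fix k assume k: "k \<in> {1..num_k \<A> i j}"
        then have "(i, j, k) \<in> idx3 \<A>" using ij by (simp add: idx3_iff_idx2)
        from ratio_near(2)[OF this] have "a * exp (- \<epsilon>) \<le> ratio_x S i j k" by (simp add: rx_def)
        then have "(a * exp (- \<epsilon>)) powr s \<le> ratio_x S i j k powr s"
          using pos \<open>0 \<le> s\<close> by (intro powr_mono2) auto
        then show "exp (s * (ln a - \<epsilon>)) \<le> ratio_x S i j k powr s"
          using pos by (simp add: powr_def ln_mult_pos)
      qed
      then have "fibre_count i j * exp (s * (ln a - \<epsilon>)) \<le> (\<Sum>k=1..num_k \<A> i j. ratio_x S i j k powr s)"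
        by (simp add: fibre_count_def)
      then have "ln (fibre_count i j * exp (s * (ln a - \<epsilon>))) \<le> ln (\<Sum>k=1..num_k \<A> i j. ratio_x S i j k powr s)"
        using fibre_count_ge_1[OF ij] by (intro ln_mono) auto
      then have "ln (fibre_count i j) + s * (ln a - \<epsilon>) \<le> ln (\<Sum>k=1..num_k \<A> i j. ratio_x S i j k powr s)"
        using fibre_count_ge_1[OF ij] by (simp add: ln_mult_pos)
      then show "opt_vector i j * (ln (fibre_count i j) + s * (ln a - \<epsilon>))
          \<le> opt_vector i j * ln (\<Sum>k=1..num_k \<A> i j. ratio_x S i j k powr s)"
        using opt_vector_pos[OF ij] by (intro mult_left_mono) auto
    qed
    moreover have "(\<Sum>(i, j)\<in>idx2 \<A>. opt_vector i j * (ln (fibre_count i j) + s * (ln a - \<epsilon>))) = 0"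
    proof -
      have "(\<Sum>(i, j)\<in>idx2 \<A>. opt_vector i j * (s * (ln a - \<epsilon>))) = s * (ln a - \<epsilon>)"
        unfolding sum_opt_vector_fst[of "\<lambda>_. s * (ln a - \<epsilon>)"] sum_distrib_right[symmetric] sum_weight1 by simp
      moreover have "s * (ln a - \<epsilon>) = - opt_log_count" using denom by (simp add: s_def field_simps)
      moreover have "(\<Sum>(i, j)\<in>idx2 \<A>. opt_vector i j * (ln (fibre_count i j) + s * (ln a - \<epsilon>))) =
          opt_log_count + (\<Sum>(i, j)\<in>idx2 \<A>. opt_vector i j * (s * (ln a - \<epsilon>)))"
        by (simp add: opt_log_count_def case_prod_unfold sum.distrib distrib_left)
      ultimately show ?thesis by linarith
    qed
    ultimately show "0 \<le> pressure opt_vector (opt_log_count / (- ln a + \<epsilon>))" by (simp add: s_def)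
  qed
  show ?thesis using 1 2 3 by linarith
qed

text \<open>The upper bound on the dimension also shows that the set of values in the definition of \<open>VP\<close> is bounded
  above, which makes the supremum meaningful.\<close>
lemma VP_approximates_dim:
  assumes "\<epsilon> \<le> - ln c / 2"
  shows "ereal (VP \<A> S) \<le> hausdorff_dim (sponge_set \<A> S)"
    and "hausdorff_dim (sponge_set \<A> S) \<le> ereal (VP \<A> S + lipschitz_const * \<epsilon>)"
proof -
  define val where "val p = lambda1 \<A> S p + lambda2 \<A> S p + t_exponent \<A> S p" for p
  have VP: "VP \<A> S = (SUP p\<in>prob_vectors \<A>. val p)" by (simp add: VP_def val_def)
  have val_le: "ereal (val p) \<le> hausdorff_dim (sponge_set \<A> S)" if "p \<in> prob_vectors \<A>" for p
    unfolding val_def using that by (rule VP_value_le_dim)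
  have dim_le: "hausdorff_dim (sponge_set \<A> S) \<le> ereal (ln partition_z / (- ln c - \<epsilon>))"
    using assms ln_params by (intro hausdorff_dim_le) linarith
  obtain D where D: "hausdorff_dim (sponge_set \<A> S) = ereal D"
    using val_le[OF opt_vector_prob] dim_le by (cases "hausdorff_dim (sponge_set \<A> S)") auto
  have val_le_D: "val p \<le> D" if "p \<in> prob_vectors \<A>" for p using val_le[OF that] by (simp add: D)
  then have "VP \<A> S \<le> D" unfolding VP using opt_vector_prob by (intro cSUP_least) auto
  then show "ereal (VP \<A> S) \<le> hausdorff_dim (sponge_set \<A> S)" by (simp add: D)
  have "val opt_vector \<le> VP \<A> S" unfolding VP
    using val_le_D opt_vector_prob by (intro cSUP_upper bdd_aboveI2) auto
  moreover have "ln partition_z / (- ln c - \<epsilon>) \<le> ln partition_z / (- ln c) + 2 * ln partition_z / (- ln c)\<^sup>2 * \<epsilon>"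
    using partition_z_ge_1 ln_params eps_nonneg assms by (intro divide_diff_le) auto
  moreover have "opt_entropy_z / (- ln c) - opt_entropy_z / (- ln c)\<^sup>2 * \<epsilon> \<le> opt_entropy_z / (- ln c + \<epsilon>)"
    using opt_entropies_nonneg ln_params eps_nonneg by (intro divide_add_ge) auto
  moreover have "opt_entropy_y / (- ln b) - opt_entropy_y / (- ln b)\<^sup>2 * \<epsilon> \<le> opt_entropy_y / (- ln b + \<epsilon>)"
    using opt_entropies_nonneg ln_params eps_nonneg by (intro divide_add_ge) auto
  moreover have "opt_log_count / (- ln a) - opt_log_count / (- ln a)\<^sup>2 * \<epsilon> \<le> opt_log_count / (- ln a + \<epsilon>)"
    using opt_entropies_nonneg ln_params eps_nonneg by (intro divide_add_ge) auto
  moreover have "lipschitz_const * \<epsilon> = 2 * ln partition_z / (- ln c)\<^sup>2 * \<epsilon> + opt_entropy_z / (- ln c)\<^sup>2 * \<epsilon> + opt_entropy_y / (- ln b)\<^sup>2 * \<epsilon> + opt_log_count / (- ln a)\<^sup>2 * \<epsilon>"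
    by (simp add: lipschitz_const_def distrib_right)
  ultimately have "ln partition_z / (- ln c - \<epsilon>) \<le> VP \<A> S + lipschitz_const * \<epsilon>"
    using opt_value_ge entropy_identity unfolding val_def by linarith
  with dim_le show "hausdorff_dim (sponge_set \<A> S) \<le> ereal (VP \<A> S + lipschitz_const * \<epsilon>)"
    by (meson ereal_less_eq(3) order_trans)
qed

end

end

theorem corollary1:
  fixes a b c :: real and \<A> :: alphabet and S\<^sub>0 :: sponge_data
  assumes "sierpinski_sponge a b c \<A> S\<^sub>0"
    and "t_lower a \<A> < t_upper a \<A>"
  shows "\<exists>C::real. \<forall>\<^sub>F \<epsilon> in at_right 0. \<forall>S. abc_sponge a b c \<epsilon> \<A> S \<longrightarrow>
           ereal (VP \<A> S) \<le> hausdorff_dim (sponge_set \<A> S) \<and>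
           hausdorff_dim (sponge_set \<A> S) \<le> ereal (VP \<A> S + C * \<epsilon>)"
proof -
  interpret sierpinski_parameters \<A> a b c
    using assms(1) by unfold_locales (auto simp: sierpinski_sponge_def abc_sponge_def self_affine_sponge_def)
  have "0 < - ln c / 2" using ln_params by simp
  then have "\<forall>\<^sub>F \<epsilon> in at_right 0. \<epsilon> \<in> {0<..<- ln c / 2}" by (rule eventually_at_right_real)
  then have "\<forall>\<^sub>F \<epsilon> in at_right 0. \<forall>S. abc_sponge a b c \<epsilon> \<A> S \<longrightarrow>
           ereal (VP \<A> S) \<le> hausdorff_dim (sponge_set \<A> S) \<and>
           hausdorff_dim (sponge_set \<A> S) \<le> ereal (VP \<A> S + lipschitz_const * \<epsilon>)"
  proof eventually_elim
    case (elim \<epsilon>)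
    then have "\<epsilon> \<le> - ln c / 2" by simp
    then show ?case using VP_approximates_dim by blast
  qed
  then show ?thesis by blast
qed

end
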